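(* For every typed term $M$ and every environment $\varepsilon$: $[\![M]\!]\varepsilon=\bigcup_{A\in\mathcal A(M)}[\![A]\!]\varepsilon$.
   Context: Types: type expressions $\sigma ::= t \mid \sigma+\sigma \mid \sigma\times\sigma\mid \sigma\to\sigma\mid \mu t.\sigma\mid \mathrm{void}$; types are closed type expressions; simple types $\tau::=\mathrm{void}\mid\tau+\tau\mid\tau\times\tau\mid\tau\to\tau$. $\preceq$: least relation with $\mathrm{void}\preceq\tau$ and $\sigma\preceq\sigma',\tau\preceq\tau'\Rightarrow\sigma\star\tau\preceq\sigma'\star\tau'$ ($\star\in\{+,\times,\to\}$, $\sigma,\tau$ simple). Unfolding $\rhd$: least relation with $\mu t.\tau\rhd\tau[\mu t.\tau/t]$, closed under $\star$ in either argument; $\tau\!\uparrow=\{\sigma\text{ simple}\mid\exists\tau'(\tau\rhd^*\tau',\sigma\preceq\tau')\}$. Type trees are non-empty, downward closed, directed sets of simple types; $\tau\!\uparrow$ is one. $\sigma\approx\tau$ iff $\sigma\!\uparrow=\tau\!\uparrow$. For type trees $\mathrm{void}=\{\mathrm{void}\}$, $\sigma\star\tau=\{\mathrm{void}\}\cup\{\sigma'\star\tau'\mid\sigma'\in\sigma,\tau'\in\tau\}$. Terms: variables $x^\sigma$ for each type $\sigma$; constants for all types $\sigma,\tau,\rho$: $0_{\sigma,\tau}:\sigma\to(\sigma+\tau)$, $1_{\sigma,\tau}:\tau\to(\sigma+\tau)$, $\mathrm{case}_{\sigma,\tau,\rho}:(\sigma+\tau)\to(\sigma\to\rho)\to(\tau\to\rho)\to\rho$,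 $\mathrm{pcase}_{\sigma,\tau,\rho}:(\sigma+\tau)\to\rho\to\rho\to\rho$, $\mathrm{pair}_{\sigma,\tau}:\sigma\to\tau\to(\sigma\times\tau)$, $\mathrm{fst}_{\sigma,\tau}:(\sigma\times\tau)\to\sigma$, $\mathrm{snd}_{\sigma,\tau}:(\sigma\times\tau)\to\tau$, $\Omega_\sigma:\sigma$. Typing: constants have their types; $x^\sigma:\sigma$; $M:\tau\Rightarrow\lambda x^\sigma.M:\sigma\to\tau$; $M:\sigma\to\tau,N:\sigma\Rightarrow MN:\tau$; $M:\sigma,\sigma\approx\tau\Rightarrow M:\tau$. Terms modulo $\alpha$-conversion; $(M,N)=\mathrm{pair}\,M\,N$. Reduction $\to$: least relation containing $\beta$ ($(\lambda x.M)N\to M[x:=N]$), closed under application in either position and under $\lambda$, and containing (for arbitrary terms $x,y,z,w,y_i,z_i$): $\mathrm{case}(0x)yz\to yx$; $\mathrm{case}(1x)yz\to zx$; $\mathrm{fst}(x,y)\to x$; $\mathrm{snd}(x,y)\to y$; $\mathrm{pcase}(0x)yz\to y$; $\mathrm{pcase}(1x)yz\to z$; $\mathrm{pcase}_{\sigma,\tau,\rho_0+\rho_1}x(0y)(0z)\to 0(\mathrm{pcase}_{\sigma,\tau,\rho_0}xyz)$; $\mathrm{pcase}_{\sigma,\tau,\rho_0+\rho_1}x(1y)(1z)\to 1(\mathrm{pcase}_{\sigma,\tau,\rho_1}xyz)$; $\mathrm{pcase}_{\sigma,\tau,\rho_1\times\rho_2}x(y_1,y_2)(z_1,z_2)\to(\mathrm{pcase}\,x\,y_1z_1,\mathrm{pcase}\,x\,y_2z_2)$;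 $(\mathrm{pcase}_{\sigma,\tau,\rho_1\to\rho_2}xyz)w\to\mathrm{pcase}_{\sigma,\tau,\rho_2}x(yw)(zw)$. $\to^*$: reflexive transitive closure. A normal form is a term admitting no $\to$-step. Approximations: the prefix order $\preceq$ on terms of the same type is the least relation with $\Omega\preceq M$, $x\preceq x$ for variables and constants, $M\preceq M'\Rightarrow\lambda x.M\preceq\lambda x.M'$, $M\preceq M',N\preceq N'\Rightarrow MN\preceq M'N'$. A normal form $A$ is a direct approximation of $M$ iff $A\preceq N$ for every $N$ with $M\to^*N$; $\mathcal A(M)$ is the set of normal forms that are direct approximations of some $N$ with $M\to^*N$. Semantics: a prime system $(A,\asymp,\le)$ has a set $A$ of primes, a reflexive symmetric consistency $\asymp$, a partial order $\le$, with $a\asymp b, c\le b\Rightarrow a\asymp c$. Its elements are the downward closed, pairwise consistent subsets of $A$, ordered by $\subseteq$; $\bot=\emptyset$; $\downarrow X=\{a\mid\exists b\in X,a\le b\}$. Sum $\mathbf A_0+\mathbf A_1$: primes $B_0\cup B_1$, $B_i=\{i\}\cup(\{i\}\times A_i)$; $a\asymp b$ iff both lie in one $B_i$ and, if $a=(i,a'),b=(i,b')$, $a'\asymp_ib'$; $a\le b$ iff ($a=i$, $b\in B_i$) or ($a=(i,a'),b=(i,b'),a'\le_ib'$). Product $\mathbf A_0\times\mathbf A_1$: primes $(\{0\}\times A_0)\cup(\{1\}\times A_1)$; $(i,a)\asymp(j,b)$ iff $i\ne j$ or $a\asymp_ib$; $(i,a)\le(j,b)$ iff $i=j$, $a\le_ib$.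 Function space $\mathbf A\to\mathbf B$: primes $(X,b)$, $X\subseteq A$ finite, pairwise consistent and pairwise $\le$-incomparable, $b\in B$; $(X,a)\asymp(Y,b)$ iff (all of $X$ consistent with all of $Y$ implies $a\asymp b$); $(X,a)\le(Y,b)$ iff $Y\subseteq\downarrow X$ and $a\le b$. An element $r$ of $\mathbf A\to\mathbf B$ denotes the continuous function $r\,d=\{a\mid\exists X\subseteq d,(X,a)\in r\}$; this is an order isomorphism onto the continuous functions between element domains, with inverse $\mathrm{Pr}(f)=\{(X,a)\mid a\in f(\downarrow X)\}$; curried functions of several arguments are converted by applying $\mathrm{Pr}$ iteratively. $\mathbf 0=(\emptyset,\emptyset,\emptyset)$. For a type tree $\sigma$: $\mathbf P_0(\sigma)=\mathbf 0$, $\mathbf P_{n+1}(\mathrm{void})=\mathbf 0$, $\mathbf P_{n+1}(\sigma\star\tau)=\mathbf P_n(\sigma)\star\mathbf P_n(\tau)$; these form an increasing chain, and $\mathbf P(\sigma)$ is its union (union of prime sets and of relations). $D_\sigma$ is the set of elements of $\mathbf P(\sigma)$; for a type $\sigma$, $D_\sigma=D_{\sigma\uparrow}$. In $D_{\sigma+\tau}$: $0d=\{0\}\cup(\{0\}\times d)$, $1d=\{1\}\cup(\{1\}\times d)$; in $D_{\sigma\times\tau}$: $\mathrm{pair}\,d\,e=(\{0\}\times d)\cup(\{1\}\times e)$. An environment $\varepsilon$ maps each variable $x^\sigma$ to an element of $D_\sigma$; $\varepsilon[x\mapsto d]$ updates $\varepsilon$ at $x$. The semantics: $[\![0]\!]\varepsilon=\mathrm{Pr}(d\mapsto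 0d)$, $[\![1]\!]\varepsilon=\mathrm{Pr}(d\mapsto 1d)$; $[\![\mathrm{case}]\!]\varepsilon$ corresponds to $\mathrm{case}\,d\,f\,g=\bot$ if $d=\bot$, $=f\,e$ if $d=0e$, $=g\,e$ if $d=1e$; $[\![\mathrm{pcase}]\!]\varepsilon$ corresponds to $\mathrm{pcase}\,a\,b\,c=b\cap c$ if $a=\bot$, $=b$ if $a=0a'$, $=c$ if $a=1a'$; $[\![\mathrm{pair}]\!]\varepsilon$ corresponds to $(d,e)\mapsto\mathrm{pair}\,d\,e$; $[\![\mathrm{fst}]\!]\varepsilon$, $[\![\mathrm{snd}]\!]\varepsilon$ correspond to $\mathrm{pair}\,d\,e\mapsto d$, resp. $e$; $[\![\Omega]\!]\varepsilon=\bot$; $[\![x]\!]\varepsilon=\varepsilon(x)$; $[\![\lambda x^\sigma.M]\!]\varepsilon=\mathrm{Pr}(d\in D_\sigma\mapsto[\![M]\!](\varepsilon[x\mapsto d]))$; $[\![MN]\!]\varepsilon=([\![M]\!]\varepsilon)([\![N]\!]\varepsilon)$. *)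

theory Defs
  imports Main "HOL-Library.FSet"
begin

section \<open>Types\<close>

datatype tyop = Sum | Prod | Arr

datatype texp = TVar nat | Bin tyop texp texp | Mu nat texp | Void

fun ftv :: "texp \<Rightarrow> nat set" where
  "ftv (TVar t) = {t}"
| "ftv (Bin c \<sigma> \<tau>) = ftv \<sigma> \<union> ftv \<tau>"
| "ftv (Mu t \<sigma>) = ftv \<sigma> - {t}"
| "ftv Void = {}"

definition is_type :: "texp \<Rightarrow> bool" where
  "is_type \<sigma> \<longleftrightarrow> ftv \<sigma> = {}"

fun simple :: "texp \<Rightarrow> bool" where
  "simple (TVar t) = False"
| "simple (Bin c \<sigma> \<tau>) = (simple \<sigma> \<and> simple \<tau>)"
| "simple (Mu t \<sigma>) = False"
| "simple Void = True"

text \<open>\<open>tsubst t \<rho> \<sigma>\<close> is \<open>\<sigma>[\<rho>/t]\<close>. No renaming of bound variables is needed, because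
  only closed \<open>\<rho>\<close> are ever substituted.\<close>

fun tsubst :: "nat \<Rightarrow> texp \<Rightarrow> texp \<Rightarrow> texp" where
  "tsubst t \<rho> (TVar s) = (if s = t then \<rho> else TVar s)"
| "tsubst t \<rho> (Bin c \<sigma> \<tau>) = Bin c (tsubst t \<rho> \<sigma>) (tsubst t \<rho> \<tau>)"
| "tsubst t \<rho> (Mu s \<sigma>) = (if s = t then Mu s \<sigma> else Mu s (tsubst t \<rho> \<sigma>))"
| "tsubst t \<rho> Void = Void"

inductive tprec :: "texp \<Rightarrow> texp \<Rightarrow> bool" where
  "tprec Void \<tau>"
| "simple \<sigma> \<Longrightarrow> simple \<tau> \<Longrightarrow> tprec \<sigma> \<sigma>' \<Longrightarrow> tprec \<tau> \<tau>' \<Longrightarrow> tprec (Bin c \<sigma> \<tau>) (Bin c \<sigma>' \<tau>')"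

inductive unfold :: "texp \<Rightarrow> texp \<Rightarrow> bool" where
  "unfold (Mu t \<tau>) (tsubst t (Mu t \<tau>) \<tau>)"
| "unfold \<sigma> \<sigma>' \<Longrightarrow> unfold (Bin c \<sigma> \<tau>) (Bin c \<sigma>' \<tau>)"
| "unfold \<tau> \<tau>' \<Longrightarrow> unfold (Bin c \<sigma> \<tau>) (Bin c \<sigma> \<tau>')"

definition up :: "texp \<Rightarrow> texp set" where
  "up \<tau> = {\<sigma>. simple \<sigma> \<and> (\<exists>\<tau>'. unfold\<^sup>*\<^sup>* \<tau> \<tau>' \<and> tprec \<sigma> \<tau>')}"

definition type_tree :: "texp set \<Rightarrow> bool" where
  "type_tree T \<longleftrightarrow> T \<noteq> {} \<and> (\<forall>\<sigma>\<in>T. simple \<sigma>)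
    \<and> (\<forall>\<tau>\<in>T. \<forall>\<sigma>. simple \<sigma> \<longrightarrow> tprec \<sigma> \<tau> \<longrightarrow> \<sigma> \<in> T)
    \<and> (\<forall>\<sigma>\<in>T. \<forall>\<tau>\<in>T. \<exists>\<rho>\<in>T. tprec \<sigma> \<rho> \<and> tprec \<tau> \<rho>)"

definition tyeq :: "texp \<Rightarrow> texp \<Rightarrow> bool" (infix "\<approx>" 50) where
  "\<sigma> \<approx> \<tau> \<longleftrightarrow> up \<sigma> = up \<tau>"

definition tree_bin :: "tyop \<Rightarrow> texp set \<Rightarrow> texp set \<Rightarrow> texp set" where
  "tree_bin c S T = {Void} \<union> {Bin c \<sigma> \<tau> | \<sigma> \<tau>. \<sigma> \<in> S \<and> \<tau> \<in> T}"


section \<open>Terms\<close>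

datatype cnst =
    In0 texp texp | In1 texp texp
  | Case texp texp texp | PCase texp texp texp
  | Pair texp texp | Fst texp texp | Snd texp texp
  | Omega texp

text \<open>Terms modulo \<open>\<alpha>\<close>-conversion: a free variable \<open>x\<^sup>\<sigma>\<close> is \<open>FVar x \<sigma>\<close>, a bound variable is a
  de Bruijn index. A term of the calculus is a \<open>trm\<close> that is typable in the empty context; a
  context lists the types of the enclosing binders, innermost first.\<close>

datatype trm = FVar nat texp | BVar nat | Con cnst | Lam texp trm | App trm trm

fun cnst_types :: "cnst \<Rightarrow> texp set" where
  "cnst_types (In0 \<sigma> \<tau>) = {\<sigma>, \<tau>}"
| "cnst_types (In1 \<sigma> \<tau>) = {\<sigma>, \<tau>}"
| "cnst_types (Case \<sigma> \<tau> \<rho>) = {\<sigma>, \<tau>, \<rho>}"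
| "cnst_types (PCase \<sigma> \<tau> \<rho>) = {\<sigma>, \<tau>, \<rho>}"
| "cnst_types (Pair \<sigma> \<tau>) = {\<sigma>, \<tau>}"
| "cnst_types (Fst \<sigma> \<tau>) = {\<sigma>, \<tau>}"
| "cnst_types (Snd \<sigma> \<tau>) = {\<sigma>, \<tau>}"
| "cnst_types (Omega \<sigma>) = {\<sigma>}"

fun ctype :: "cnst \<Rightarrow> texp" where
  "ctype (In0 \<sigma> \<tau>) = Bin Arr \<sigma> (Bin Sum \<sigma> \<tau>)"
| "ctype (In1 \<sigma> \<tau>) = Bin Arr \<tau> (Bin Sum \<sigma> \<tau>)"
| "ctype (Case \<sigma> \<tau> \<rho>) =
     Bin Arr (Bin Sum \<sigma> \<tau>) (Bin Arr (Bin Arr \<sigma> \<rho>) (Bin Arr (Bin Arr \<tau> \<rho>) \<rho>))"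
| "ctype (PCase \<sigma> \<tau> \<rho>) = Bin Arr (Bin Sum \<sigma> \<tau>) (Bin Arr \<rho> (Bin Arr \<rho> \<rho>))"
| "ctype (Pair \<sigma> \<tau>) = Bin Arr \<sigma> (Bin Arr \<tau> (Bin Prod \<sigma> \<tau>))"
| "ctype (Fst \<sigma> \<tau>) = Bin Arr (Bin Prod \<sigma> \<tau>) \<sigma>"
| "ctype (Snd \<sigma> \<tau>) = Bin Arr (Bin Prod \<sigma> \<tau>) \<tau>"
| "ctype (Omega \<sigma>) = \<sigma>"

inductive typing :: "texp list \<Rightarrow> trm \<Rightarrow> texp \<Rightarrow> bool" ("_ \<turnstile> _ : _" [50, 50, 50] 50) where
  T_FVar: "is_type \<sigma> \<Longrightarrow> \<Gamma> \<turnstile> FVar x \<sigma> : \<sigma>"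
| T_BVar: "n < length \<Gamma> \<Longrightarrow> \<Gamma> \<turnstile> BVar n : \<Gamma> ! n"
| T_Con: "\<forall>\<sigma>\<in>cnst_types c. is_type \<sigma> \<Longrightarrow> \<Gamma> \<turnstile> Con c : ctype c"
| T_Lam: "is_type \<sigma> \<Longrightarrow> \<sigma> # \<Gamma> \<turnstile> M : \<tau> \<Longrightarrow> \<Gamma> \<turnstile> Lam \<sigma> M : Bin Arr \<sigma> \<tau>"
| T_App: "\<Gamma> \<turnstile> M : Bin Arr \<sigma> \<tau> \<Longrightarrow> \<Gamma> \<turnstile> N : \<sigma> \<Longrightarrow> \<Gamma> \<turnstile> App M N : \<tau>"
| T_Conv: "\<Gamma> \<turnstile> M : \<sigma> \<Longrightarrow> is_type \<tau> \<Longrightarrow> \<sigma> \<approx> \<tau> \<Longrightarrow> \<Gamma> \<turnstile> M : \<tau>"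


section \<open>Reduction\<close>

fun lift :: "trm \<Rightarrow> nat \<Rightarrow> trm" where
  "lift (FVar x \<sigma>) k = FVar x \<sigma>"
| "lift (BVar i) k = (if i < k then BVar i else BVar (Suc i))"
| "lift (Con c) k = Con c"
| "lift (Lam \<sigma> M) k = Lam \<sigma> (lift M (Suc k))"
| "lift (App M N) k = App (lift M k) (lift N k)"

text \<open>Substitution of \<open>N\<close> for the index \<open>k\<close>, which is removed: larger indices are decremented.\<close>

fun subst :: "trm \<Rightarrow> trm \<Rightarrow> nat \<Rightarrow> trm" where
  "subst (FVar x \<sigma>) N k = FVar x \<sigma>"
| "subst (BVar i) N k = (if k < i then BVar (i - 1) else if i = k then N else BVar i)"
| "subst (Con c) N k = Con c"
| "subst (Lam \<sigma> M) N k = Lam \<sigma> (subst M (lift N 0) (Suc k))"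
| "subst (App M M') N k = App (subst M N k) (subst M' N k)"

abbreviation In0' :: "texp \<Rightarrow> texp \<Rightarrow> trm \<Rightarrow> trm" where
  "In0' \<sigma> \<tau> M \<equiv> App (Con (In0 \<sigma> \<tau>)) M"

abbreviation In1' :: "texp \<Rightarrow> texp \<Rightarrow> trm \<Rightarrow> trm" where
  "In1' \<sigma> \<tau> M \<equiv> App (Con (In1 \<sigma> \<tau>)) M"

abbreviation Case' :: "texp \<Rightarrow> texp \<Rightarrow> texp \<Rightarrow> trm \<Rightarrow> trm \<Rightarrow> trm \<Rightarrow> trm" where
  "Case' \<sigma> \<tau> \<rho> x y z \<equiv> App (App (App (Con (Case \<sigma> \<tau> \<rho>)) x) y) z"

abbreviation PCase' :: "texp \<Rightarrow> texp \<Rightarrow> texp \<Rightarrow> trm \<Rightarrow> trm \<Rightarrow> trm \<Rightarrow> trm" where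
  "PCase' \<sigma> \<tau> \<rho> x y z \<equiv> App (App (App (Con (PCase \<sigma> \<tau> \<rho>)) x) y) z"

abbreviation Pair' :: "texp \<Rightarrow> texp \<Rightarrow> trm \<Rightarrow> trm \<Rightarrow> trm" where
  "Pair' \<sigma> \<tau> M N \<equiv> App (App (Con (Pair \<sigma> \<tau>)) M) N"

text \<open>By the conversion rule for \<open>\<approx>\<close>, the subscripts of the constants in a typed redex need not
  coincide. Subscripts that the rules do not mention are therefore arbitrary on the left-hand sides;
  the constants \<open>0\<close>, \<open>1\<close>, \<open>pair\<close> created by the rules for \<open>pcase\<close> get the subscripts
  prescribed by the subscript of \<open>pcase\<close>.\<close>

inductive red :: "trm \<Rightarrow> trm \<Rightarrow> bool" where
  beta: "red (App (Lam \<sigma> M) N) (subst M N 0)"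
| appL: "red M M' \<Longrightarrow> red (App M N) (App M' N)"
| appR: "red N N' \<Longrightarrow> red (App M N) (App M N')"
| lam: "red M M' \<Longrightarrow> red (Lam \<sigma> M) (Lam \<sigma> M')"
| case0: "red (Case' \<sigma> \<tau> \<rho> (In0' \<sigma>' \<tau>' x) y z) (App y x)"
| case1: "red (Case' \<sigma> \<tau> \<rho> (In1' \<sigma>' \<tau>' x) y z) (App z x)"
| fst: "red (App (Con (Fst \<sigma> \<tau>)) (Pair' \<sigma>' \<tau>' x y)) x"
| snd: "red (App (Con (Snd \<sigma> \<tau>)) (Pair' \<sigma>' \<tau>' x y)) y"
| pcase0: "red (PCase' \<sigma> \<tau> \<rho> (In0' \<sigma>' \<tau>' x) y z) y"
| pcase1: "red (PCase' \<sigma> \<tau> \<rho> (In1' \<sigma>' \<tau>' x) y z) z"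
| pcase_in0: "red (PCase' \<sigma> \<tau> (Bin Sum \<rho>0 \<rho>1) x (In0' \<sigma>' \<tau>' y) (In0' \<sigma>'' \<tau>'' z))
    (In0' \<rho>0 \<rho>1 (PCase' \<sigma> \<tau> \<rho>0 x y z))"
| pcase_in1: "red (PCase' \<sigma> \<tau> (Bin Sum \<rho>0 \<rho>1) x (In1' \<sigma>' \<tau>' y) (In1' \<sigma>'' \<tau>'' z))
    (In1' \<rho>0 \<rho>1 (PCase' \<sigma> \<tau> \<rho>1 x y z))"
| pcase_pair: "red (PCase' \<sigma> \<tau> (Bin Prod \<rho>1 \<rho>2) x (Pair' \<sigma>' \<tau>' y1 y2) (Pair' \<sigma>'' \<tau>'' z1 z2))
    (Pair' \<rho>1 \<rho>2 (PCase' \<sigma> \<tau> \<rho>1 x y1 z1) (PCase' \<sigma> \<tau> \<rho>2 x y2 z2))"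
| pcase_app: "red (App (PCase' \<sigma> \<tau> (Bin Arr \<rho>1 \<rho>2) x y z) w)
    (PCase' \<sigma> \<tau> \<rho>2 x (App y w) (App z w))"

definition normal_form :: "trm \<Rightarrow> bool" where
  "normal_form M \<longleftrightarrow> (\<nexists>N. red M N)"


section \<open>Approximations\<close>

text \<open>The premise of the first rule expresses that the order relates terms of the same type.\<close>

inductive prefix :: "texp list \<Rightarrow> trm \<Rightarrow> trm \<Rightarrow> bool" where
  "\<Gamma> \<turnstile> M : \<sigma> \<Longrightarrow> prefix \<Gamma> (Con (Omega \<sigma>)) M"
| "prefix \<Gamma> (FVar x \<sigma>) (FVar x \<sigma>)"
| "prefix \<Gamma> (BVar n) (BVar n)"
| "prefix \<Gamma> (Con c) (Con c)"
| "prefix (\<sigma> # \<Gamma>) M M' \<Longrightarrow> prefix \<Gamma> (Lam \<sigma> M) (Lam \<sigma> M')"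
| "prefix \<Gamma> M M' \<Longrightarrow> prefix \<Gamma> N N' \<Longrightarrow> prefix \<Gamma> (App M N) (App M' N')"

definition direct_approx :: "trm \<Rightarrow> trm \<Rightarrow> bool" where
  "direct_approx A M \<longleftrightarrow> normal_form A \<and> (\<forall>N. red\<^sup>*\<^sup>* M N \<longrightarrow> prefix [] A N)"

definition approximations :: "trm \<Rightarrow> trm set" where
  "approximations M = {A. \<exists>N. red\<^sup>*\<^sup>* M N \<and> direct_approx A N}"


section \<open>Prime systems\<close>

text \<open>A common universe for the primes of all types; the indices \<open>0\<close> and \<open>1\<close> are \<open>False\<close> and
  \<open>True\<close>. \<open>Tag i\<close> is the prime \<open>i\<close> of a sum, \<open>Inj i a\<close> the prime \<open>(i, a)\<close> of a sum or a
  product, and \<open>Step X b\<close> the prime \<open>(X, b)\<close> of a function space.\<close>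

datatype prime = Tag bool | Inj bool prime | Step "prime fset" prime

record psys =
  primes :: "prime set"
  coh :: "(prime \<times> prime) set"
  leq :: "(prime \<times> prime) set"

definition elements :: "psys \<Rightarrow> prime set set" where
  "elements P = {d. d \<subseteq> primes P \<and> (\<forall>a\<in>d. \<forall>b\<in>d. (a, b) \<in> coh P)
    \<and> (\<forall>b\<in>d. \<forall>a. (a, b) \<in> leq P \<longrightarrow> a \<in> d)}"

definition down :: "psys \<Rightarrow> prime set \<Rightarrow> prime set" where
  "down P X = {a. \<exists>b\<in>X. (a, b) \<in> leq P}"

definition zero_psys :: psys where
  "zero_psys = \<lparr>primes = {}, coh = {}, leq = {}\<rparr>"

definition sum_block :: "bool \<Rightarrow> psys \<Rightarrow> prime set" where
  "sum_block i P = insert (Tag i) (Inj i ` primes P)"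

definition sum_psys :: "psys \<Rightarrow> psys \<Rightarrow> psys" where
  "sum_psys P0 P1 = (let P = (\<lambda>i. if i then P1 else P0) in
    \<lparr>primes = (\<Union>i. sum_block i (P i)),
     coh = {(a, b). \<exists>i. a \<in> sum_block i (P i) \<and> b \<in> sum_block i (P i)
       \<and> (\<forall>a' b'. a = Inj i a' \<longrightarrow> b = Inj i b' \<longrightarrow> (a', b') \<in> coh (P i))},
     leq = {(Tag i, b) | i b. b \<in> sum_block i (P i)}
       \<union> {(Inj i a, Inj i b) | i a b. (a, b) \<in> leq (P i)}\<rparr>)"

definition prod_psys :: "psys \<Rightarrow> psys \<Rightarrow> psys" where
  "prod_psys P0 P1 = (let P = (\<lambda>i. if i then P1 else P0) in
    \<lparr>primes = (\<Union>i. Inj i ` primes (P i)),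
     coh = {(Inj i a, Inj j b) | i a j b. a \<in> primes (P i) \<and> b \<in> primes (P j)
       \<and> (i \<noteq> j \<or> (a, b) \<in> coh (P i))},
     leq = {(Inj i a, Inj i b) | i a b. (a, b) \<in> leq (P i)}\<rparr>)"

definition step_base :: "psys \<Rightarrow> prime fset \<Rightarrow> bool" where
  "step_base P X \<longleftrightarrow> fset X \<subseteq> primes P \<and> (\<forall>a\<in>fset X. \<forall>b\<in>fset X. (a, b) \<in> coh P)
    \<and> (\<forall>a\<in>fset X. \<forall>b\<in>fset X. a \<noteq> b \<longrightarrow> (a, b) \<notin> leq P)"

definition fun_psys :: "psys \<Rightarrow> psys \<Rightarrow> psys" where
  "fun_psys P Q = (let S = {Step X b | X b. step_base P X \<and> b \<in> primes Q} in
    \<lparr>primes = S,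
     coh = {(Step X a, Step Y b) | X a Y b. Step X a \<in> S \<and> Step Y b \<in> S
       \<and> ((\<forall>x\<in>fset X. \<forall>y\<in>fset Y. (x, y) \<in> coh P) \<longrightarrow> (a, b) \<in> coh Q)},
     leq = {(Step X a, Step Y b) | X a Y b. Step X a \<in> S \<and> Step Y b \<in> S
       \<and> fset Y \<subseteq> down P (fset X) \<and> (a, b) \<in> leq Q}\<rparr>)"

fun bin_psys :: "tyop \<Rightarrow> psys \<Rightarrow> psys \<Rightarrow> psys" where
  "bin_psys Sum = sum_psys"
| "bin_psys Prod = prod_psys"
| "bin_psys Arr = fun_psys"

text \<open>A type tree is either \<open>{Void}\<close> or \<open>tree_bin c S T\<close> for unique \<open>c\<close>, \<open>S\<close>, \<open>T\<close>; see
  \<open>psys_level_Void\<close> and \<open>psys_level_bin\<close> below.\<close>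

primrec psys_level :: "nat \<Rightarrow> texp set \<Rightarrow> psys" where
  "psys_level 0 = (\<lambda>U. zero_psys)"
| "psys_level (Suc n) = (\<lambda>U. THE P. (U = {Void} \<and> P = zero_psys)
     \<or> (\<exists>c S T. type_tree S \<and> type_tree T \<and> U = tree_bin c S T
          \<and> P = bin_psys c (psys_level n S) (psys_level n T)))"

lemma tree_bin_inject:
  assumes "type_tree S" "type_tree T" "type_tree S'" "type_tree T'"
    and eq: "tree_bin c S T = tree_bin c' S' T'"
  shows "c = c' \<and> S = S' \<and> T = T'"
proof -
  have iff: "Bin d a b \<in> tree_bin e A B \<longleftrightarrow> d = e \<and> a \<in> A \<and> b \<in> B" for d e a b A B
    by (auto simp: tree_bin_def)
  obtain s t where st: "s \<in> S" "t \<in> T"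
    using assms(1,2) by (auto simp: type_tree_def)
  have *: "(d = c \<and> a \<in> S \<and> b \<in> T) \<longleftrightarrow> (d = c' \<and> a \<in> S' \<and> b \<in> T')" for d a b
    by (simp only: iff[symmetric] eq)
  from *[of c s t] st have "c = c'" "s \<in> S'" "t \<in> T'" by auto
  have "a \<in> S \<longleftrightarrow> a \<in> S'" for a
    using *[of c a t] \<open>c = c'\<close> st \<open>t \<in> T'\<close> by simp
  moreover have "b \<in> T \<longleftrightarrow> b \<in> T'" for b
    using *[of c s b] \<open>c = c'\<close> st \<open>s \<in> S'\<close> by simp
  ultimately show ?thesis using \<open>c = c'\<close> by (simp add: set_eq_iff)
qed

lemma tree_bin_not_Void:
  assumes "type_tree S" "type_tree T"
  shows "tree_bin c S T \<noteq> {Void}"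
proof -
  from assms obtain s t where "s \<in> S" "t \<in> T"
    by (auto simp: type_tree_def)
  then have "Bin c s t \<in> tree_bin c S T"
    by (auto simp: tree_bin_def)
  then show ?thesis by force
qed

lemma psys_level_Void: "psys_level (Suc n) {Void} = zero_psys"
proof -
  have "(\<exists>c S T. type_tree S \<and> type_tree T \<and> {Void} = tree_bin c S T
          \<and> P = bin_psys c (psys_level n S) (psys_level n T)) = False" for P
    using tree_bin_not_Void by metis
  then show ?thesis by (simp only: psys_level.simps simp_thms the_eq_trivial)
qed

lemma psys_level_bin:
  assumes "type_tree S" "type_tree T"
  shows "psys_level (Suc n) (tree_bin c S T) = bin_psys c (psys_level n S) (psys_level n T)"
proof -
  have "(\<exists>c' S' T'. type_tree S' \<and> type_tree T' \<and> tree_bin c S T = tree_bin c' S' T'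
          \<and> P = bin_psys c' (psys_level n S') (psys_level n T'))
     \<longleftrightarrow> P = bin_psys c (psys_level n S) (psys_level n T)" (is "?L \<longleftrightarrow> ?R") for P
  proof
    assume ?L
    then obtain c' S' T' where "type_tree S'" "type_tree T'" "tree_bin c S T = tree_bin c' S' T'"
      and P: "P = bin_psys c' (psys_level n S') (psys_level n T')"
      by (elim exE conjE)
    then have "c = c' \<and> S = S' \<and> T = T'"
      by (intro tree_bin_inject[OF assms])
    with P show ?R by simp
  next
    assume ?R
    with assms show ?L by (intro exI conjI) (assumption | rule refl)+
  qed
  then show ?thesis
    using tree_bin_not_Void[OF assms, of c] by simp
qed

definition tree_psys :: "texp set \<Rightarrow> psys" where
  "tree_psys T = \<lparr>primes = (\<Union>n. primes (psys_level n T)),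
     coh = (\<Union>n. coh (psys_level n T)), leq = (\<Union>n. leq (psys_level n T))\<rparr>"

definition PS :: "texp \<Rightarrow> psys" where
  "PS \<sigma> = tree_psys (up \<sigma>)"

definition D :: "texp \<Rightarrow> prime set set" where
  "D \<sigma> = elements (PS \<sigma>)"


section \<open>Semantics\<close>

definition fun_app :: "prime set \<Rightarrow> prime set \<Rightarrow> prime set" where
  "fun_app r d = {a. \<exists>X. fset X \<subseteq> d \<and> Step X a \<in> r}"

definition Pr :: "psys \<Rightarrow> (prime set \<Rightarrow> prime set) \<Rightarrow> prime set" where
  "Pr P f = {Step X a | X a. step_base P X \<and> a \<in> f (down P (fset X))}"

definition inj_sem :: "bool \<Rightarrow> prime set \<Rightarrow> prime set" where
  "inj_sem i d = {Tag i} \<union> Inj i ` d"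

definition pair_sem :: "prime set \<Rightarrow> prime set \<Rightarrow> prime set" where
  "pair_sem d e = Inj False ` d \<union> Inj True ` e"

definition case_sem :: "prime set \<Rightarrow> prime set \<Rightarrow> prime set \<Rightarrow> prime set" where
  "case_sem d f g =
    (if d = {} then {}
     else if \<exists>e. d = inj_sem False e then fun_app f (THE e. d = inj_sem False e)
     else fun_app g (THE e. d = inj_sem True e))"

definition pcase_sem :: "prime set \<Rightarrow> prime set \<Rightarrow> prime set \<Rightarrow> prime set" where
  "pcase_sem a b c =
    (if a = {} then b \<inter> c else if \<exists>a'. a = inj_sem False a' then b else c)"

definition fst_sem :: "prime set \<Rightarrow> prime set" where
  "fst_sem p = (THE d. \<exists>e. p = pair_sem d e)"

definition snd_sem :: "prime set \<Rightarrow> prime set" where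
  "snd_sem p = (THE e. \<exists>d. p = pair_sem d e)"

fun csem :: "cnst \<Rightarrow> prime set" where
  "csem (In0 \<sigma> \<tau>) = Pr (PS \<sigma>) (inj_sem False)"
| "csem (In1 \<sigma> \<tau>) = Pr (PS \<tau>) (inj_sem True)"
| "csem (Case \<sigma> \<tau> \<rho>) = Pr (PS (Bin Sum \<sigma> \<tau>)) (\<lambda>d. Pr (PS (Bin Arr \<sigma> \<rho>)) (\<lambda>f.
     Pr (PS (Bin Arr \<tau> \<rho>)) (\<lambda>g. case_sem d f g)))"
| "csem (PCase \<sigma> \<tau> \<rho>) = Pr (PS (Bin Sum \<sigma> \<tau>)) (\<lambda>a. Pr (PS \<rho>) (\<lambda>b.
     Pr (PS \<rho>) (\<lambda>c. pcase_sem a b c)))"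
| "csem (Pair \<sigma> \<tau>) = Pr (PS \<sigma>) (\<lambda>d. Pr (PS \<tau>) (\<lambda>e. pair_sem d e))"
| "csem (Fst \<sigma> \<tau>) = Pr (PS (Bin Prod \<sigma> \<tau>)) fst_sem"
| "csem (Snd \<sigma> \<tau>) = Pr (PS (Bin Prod \<sigma> \<tau>)) snd_sem"
| "csem (Omega \<sigma>) = {}"

type_synonym env = "nat \<Rightarrow> texp \<Rightarrow> prime set"

definition is_env :: "env \<Rightarrow> bool" where
  "is_env \<epsilon> \<longleftrightarrow> (\<forall>x \<sigma>. is_type \<sigma> \<longrightarrow> \<epsilon> x \<sigma> \<in> D \<sigma>)"

text \<open>The environment is split: \<open>\<epsilon>\<close> interprets the free variables and the list \<open>\<eta>\<close> the bound
  ones, so the update \<open>\<epsilon>[x \<mapsto> d]\<close> at a binder becomes \<open>d # \<eta>\<close>.\<close>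

fun sem :: "env \<Rightarrow> prime set list \<Rightarrow> trm \<Rightarrow> prime set" where
  "sem \<epsilon> \<eta> (FVar x \<sigma>) = \<epsilon> x \<sigma>"
| "sem \<epsilon> \<eta> (BVar n) = \<eta> ! n"
| "sem \<epsilon> \<eta> (Con c) = csem c"
| "sem \<epsilon> \<eta> (Lam \<sigma> M) = Pr (PS \<sigma>) (\<lambda>d. sem \<epsilon> (d # \<eta>) M)"
| "sem \<epsilon> \<eta> (App M N) = fun_app (sem \<epsilon> \<eta> M) (sem \<epsilon> \<eta> N)"

end

(* The inclusion from right to left is soundness of reduction together with monotonicity of the
   semantics in the prefix order. The converse is a computability argument by recursion on primes,
   which are finite objects even when the types are not: a term is computable at a prime a if a is
   in the semantics of one of its approximations, and if its components, or its applications to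
   arguments computable at the premises of a, are computable at the corresponding parts of a.

   Reduction is confluent only up to the subscripts of 0, 1 and pair: pcase (0 x) (0 y) (0 z)
   reduces to two copies of 0 y whose constants may carry different subscripts. Confluence is
   avoided by asking for an approximation below every reduct. *)

theory Submission
  imports Defs
begin


section \<open>Types and type trees\<close>

text \<open>Progress is measured instead by the prime under observation, whose rank drops when a
  component is entered, and by the number of arguments of the spine. A lambda is approximated
  through its body, so the bound variable has to be replaced by a term that is computable at the
  premises of the prime and whose value is generated by exactly these premises; otherwise
  abstracting it again would not give back the prime. A free variable with this value does both. The
  given environment may have no such variable to spare, so the argument runs in another environment
  that agrees with it on the names of the term.\<close>

inductive_cases unfold_BinE: "unfold (Bin c \<sigma> \<tau>) \<rho>"
inductive_cases unfold_MuE: "unfold (Mu t \<sigma>) \<rho>"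
inductive_cases tprec_BinE: "tprec (Bin c \<sigma> \<tau>) \<rho>"
inductive_cases tprec_BinRE: "tprec \<rho> (Bin c \<sigma> \<tau>)"

text \<open>\<open>unfold\<close> never works below a \<open>Mu\<close>, so distinct redexes are
  disjoint and neither duplicates nor erases the other; at most one step on each side closes the
  diagram.\<close>

lemma unfold_diamond:
  "unfold \<sigma> \<tau>1 \<Longrightarrow> unfold \<sigma> \<tau>2 \<Longrightarrow> \<tau>1 = \<tau>2 \<or> (\<exists>\<rho>. unfold \<tau>1 \<rho> \<and> unfold \<tau>2 \<rho>)"
proof (induction arbitrary: \<tau>2 rule: unfold.induct)
  case (1 t \<tau>)
  then show ?case by (auto elim: unfold_MuE)
next
  case (2 \<sigma> \<sigma>' c \<tau>)
  from "2.prems" consider \<sigma>'' where "\<tau>2 = Bin c \<sigma>'' \<tau>" "unfold \<sigma> \<sigma>''"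
    | \<tau>' where "\<tau>2 = Bin c \<sigma> \<tau>'" "unfold \<tau> \<tau>'" by (auto elim: unfold_BinE)
  then show ?case
  proof cases
    case (1 \<sigma>'')
    then show ?thesis using "2.IH"[of \<sigma>''] by (metis unfold.intros(2))
  next
    case (2 \<tau>')
    then show ?thesis using \<open>unfold \<sigma> \<sigma>'\<close> by (metis unfold.intros(2,3))
  qed
next
  case (3 \<tau> \<tau>' c \<sigma>)
  from "3.prems" consider \<sigma>'' where "\<tau>2 = Bin c \<sigma>'' \<tau>" "unfold \<sigma> \<sigma>''"
    | \<tau>'' where "\<tau>2 = Bin c \<sigma> \<tau>''" "unfold \<tau> \<tau>''" by (auto elim: unfold_BinE)
  then show ?case
  proof cases
    case (1 \<sigma>'')
    then show ?thesis using \<open>unfold \<tau> \<tau>'\<close> by (metis unfold.intros(2,3))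
  next
    case (2 \<tau>'')
    then show ?thesis using "3.IH"[of \<tau>''] by (metis unfold.intros(3))
  qed
qed

text \<open>Each side of the diamond needs at most one step, so the single step remains single while
  it is moved along the sequence.\<close>

lemma unfold_strip:
  "unfold\<^sup>*\<^sup>* \<sigma> \<tau>1 \<Longrightarrow> unfold \<sigma> \<tau>2 \<Longrightarrow> \<exists>\<rho>. (\<tau>1 = \<rho> \<or> unfold \<tau>1 \<rho>) \<and> unfold\<^sup>*\<^sup>* \<tau>2 \<rho>"
proof (induction rule: rtranclp_induct)
  case base
  then show ?case by (intro exI[of _ \<tau>2]) simp
next
  case (step y z)
  from step.IH[OF step.prems] obtain \<rho> where \<rho>: "y = \<rho> \<or> unfold y \<rho>" "unfold\<^sup>*\<^sup>* \<tau>2 \<rho>" by (elim exE conjE)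
  from \<rho>(1) show ?case
  proof
    assume "y = \<rho>"
    then have "unfold\<^sup>*\<^sup>* \<tau>2 z" using \<rho>(2) step.hyps(2) by (simp add: rtranclp.rtrancl_into_rtrancl)
    then show ?thesis by (intro exI[of _ z]) simp
  next
    assume "unfold y \<rho>"
    from unfold_diamond[OF this step.hyps(2)] show ?thesis
    proof (elim disjE exE conjE)
      assume "\<rho> = z"
      then show ?thesis using \<rho>(2) by (intro exI[of _ z]) simp
    next
      fix \<rho>' assume "unfold \<rho> \<rho>'" "unfold z \<rho>'"
      then show ?thesis using \<rho>(2) by (intro exI[of _ \<rho>']) (simp add: rtranclp.rtrancl_into_rtrancl)
    qed
  qed
qed

lemma unfold_confluent:
  "unfold\<^sup>*\<^sup>* \<sigma> \<tau>1 \<Longrightarrow> unfold\<^sup>*\<^sup>* \<sigma> \<tau>2 \<Longrightarrow> \<exists>\<rho>. unfold\<^sup>*\<^sup>* \<tau>1 \<rho> \<and> unfold\<^sup>*\<^sup>* \<tau>2 \<rho>"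
proof (induction rule: rtranclp_induct)
  case base
  then show ?case by (intro exI[of _ \<tau>2]) simp
next
  case (step y z)
  from step.IH[OF step.prems] obtain \<rho> where \<rho>: "unfold\<^sup>*\<^sup>* y \<rho>" "unfold\<^sup>*\<^sup>* \<tau>2 \<rho>" by (elim exE conjE)
  from unfold_strip[OF \<rho>(1) step.hyps(2)] obtain \<rho>' where
    "\<rho> = \<rho>' \<or> unfold \<rho> \<rho>'" "unfold\<^sup>*\<^sup>* z \<rho>'" by (elim exE conjE)
  moreover from this \<rho>(2) have "unfold\<^sup>*\<^sup>* \<tau>2 \<rho>'" by (auto intro: rtranclp.rtrancl_into_rtrancl)
  ultimately show ?case by (intro exI[of _ \<rho>']) simp
qed

text \<open>A simple type contains no \<open>Mu\<close>, so whatever is unfolded lies below one of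
  its \<open>Void\<close> leaves.\<close>

lemma tprec_unfold: "tprec \<sigma> \<tau> \<Longrightarrow> unfold \<tau> \<tau>' \<Longrightarrow> tprec \<sigma> \<tau>'"
proof (induction arbitrary: \<tau>' rule: tprec.induct)
  case (2 \<sigma> \<tau> \<sigma>' \<tau>' c)
  then show ?case by (auto elim!: unfold_BinE intro: tprec.intros)
qed (auto intro: tprec.intros)

lemma tprec_unfolds: "unfold\<^sup>*\<^sup>* \<tau> \<tau>' \<Longrightarrow> tprec \<sigma> \<tau> \<Longrightarrow> tprec \<sigma> \<tau>'"
  by (induction rule: rtranclp_induct) (auto intro: tprec_unfold)

lemma tprec_trans: "tprec \<sigma> \<tau> \<Longrightarrow> tprec \<tau> \<rho> \<Longrightarrow> tprec \<sigma> \<rho>"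
  by (induction arbitrary: \<rho> rule: tprec.induct) (auto elim!: tprec_BinE intro: tprec.intros)

lemma tprec_refl: "simple \<sigma> \<Longrightarrow> tprec \<sigma> \<sigma>"
  by (induction \<sigma>) (auto intro: tprec.intros)

text \<open>The upper bound is the overlay of the two prefixes: where one of them stops with
  \<open>Void\<close>, the other continues.\<close>

lemma tprec_directed:
  "tprec \<sigma>1 \<tau> \<Longrightarrow> tprec \<sigma>2 \<tau> \<Longrightarrow> simple \<sigma>1 \<Longrightarrow> simple \<sigma>2
    \<Longrightarrow> \<exists>\<rho>. simple \<rho> \<and> tprec \<sigma>1 \<rho> \<and> tprec \<sigma>2 \<rho> \<and> tprec \<rho> \<tau>"
proof (induction arbitrary: \<sigma>2 rule: tprec.induct)
  case (1 \<tau>)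
  then show ?case by (metis tprec.intros(1) tprec_refl)
next
  case (2 \<sigma> \<tau> \<sigma>' \<tau>' c)
  from "2.prems"(1) consider (V) "\<sigma>2 = Void" | (B) \<sigma>2' \<tau>2' where "\<sigma>2 = Bin c \<sigma>2' \<tau>2'"
    "simple \<sigma>2'" "simple \<tau>2'" "tprec \<sigma>2' \<sigma>'" "tprec \<tau>2' \<tau>'" by (auto elim: tprec_BinRE)
  then show ?case
  proof cases
    case V
    then show ?thesis using 2 by (intro exI[of _ "Bin c \<sigma> \<tau>"]) (auto intro: tprec.intros tprec_refl)
  next
    case (B \<sigma>2' \<tau>2')
    then obtain \<rho>1 \<rho>2 where "simple \<rho>1" "tprec \<sigma> \<rho>1" "tprec \<sigma>2' \<rho>1" "tprec \<rho>1 \<sigma>'"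
      "simple \<rho>2" "tprec \<tau> \<rho>2" "tprec \<tau>2' \<rho>2" "tprec \<rho>2 \<tau>'"
      using "2.IH"(1)[of \<sigma>2'] "2.IH"(2)[of \<tau>2'] \<open>simple \<sigma>\<close> \<open>simple \<tau>\<close> by auto
    then show ?thesis using B \<open>simple \<sigma>\<close> \<open>simple \<tau>\<close>
      by (intro exI[of _ "Bin c \<rho>1 \<rho>2"]) (auto intro: tprec.intros)
  qed
qed

lemma type_tree_up: "type_tree (up \<sigma>)"
  unfolding type_tree_def
proof (intro conjI ballI allI impI)
  have "Void \<in> up \<sigma>" by (auto simp: up_def intro: tprec.intros)
  then show "up \<sigma> \<noteq> {}" by blast
next
  fix \<tau>1 \<tau>2 assume "\<tau>1 \<in> up \<sigma>" "\<tau>2 \<in> up \<sigma>"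
  then obtain \<rho>1 \<rho>2 where s: "simple \<tau>1" "simple \<tau>2" and *: "unfold\<^sup>*\<^sup>* \<sigma> \<rho>1" "tprec \<tau>1 \<rho>1"
    "unfold\<^sup>*\<^sup>* \<sigma> \<rho>2" "tprec \<tau>2 \<rho>2" by (auto simp: up_def)
  \<comment> \<open>The two approximants may stem from different unfoldings; a common unfolding puts
    both below one expression.\<close>
  from unfold_confluent[OF *(1,3)] obtain \<rho> where "unfold\<^sup>*\<^sup>* \<rho>1 \<rho>" "unfold\<^sup>*\<^sup>* \<rho>2 \<rho>" by blast
  then have "tprec \<tau>1 \<rho>" "tprec \<tau>2 \<rho>" and u: "unfold\<^sup>*\<^sup>* \<sigma> \<rho>" using * by (auto intro: tprec_unfolds)
  from tprec_directed[OF this(1,2) s] obtain \<rho>' where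
    "simple \<rho>'" "tprec \<tau>1 \<rho>'" "tprec \<tau>2 \<rho>'" "tprec \<rho>' \<rho>" by blast
  then show "\<exists>\<rho>\<in>up \<sigma>. tprec \<tau>1 \<rho> \<and> tprec \<tau>2 \<rho>" using u by (auto simp: up_def)
qed (auto simp: up_def intro: tprec_trans)

lemma up_unfolds: "unfold\<^sup>*\<^sup>* \<sigma> \<tau> \<Longrightarrow> up \<sigma> = up \<tau>"
proof
  assume u: "unfold\<^sup>*\<^sup>* \<sigma> \<tau>"
  show "up \<sigma> \<subseteq> up \<tau>"
  proof
    fix \<rho> assume "\<rho> \<in> up \<sigma>"
    then obtain \<tau>' where "simple \<rho>" "unfold\<^sup>*\<^sup>* \<sigma> \<tau>'" "tprec \<rho> \<tau>'" by (auto simp: up_def)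
    with unfold_confluent[OF u this(2)] show "\<rho> \<in> up \<tau>"
      by (auto simp: up_def intro: tprec_unfolds)
  qed
  show "up \<tau> \<subseteq> up \<sigma>" using rtranclp_trans[OF u] unfolding up_def by blast
qed

lemma unfolds_Bin1: "unfold\<^sup>*\<^sup>* \<sigma> \<sigma>' \<Longrightarrow> unfold\<^sup>*\<^sup>* (Bin c \<sigma> \<tau>) (Bin c \<sigma>' \<tau>)"
  by (induction rule: rtranclp_induct) (auto intro: unfold.intros rtranclp.rtrancl_into_rtrancl)

lemma unfolds_Bin2: "unfold\<^sup>*\<^sup>* \<tau> \<tau>' \<Longrightarrow> unfold\<^sup>*\<^sup>* (Bin c \<sigma> \<tau>) (Bin c \<sigma> \<tau>')"
  by (induction rule: rtranclp_induct) (auto intro: unfold.intros rtranclp.rtrancl_into_rtrancl)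

lemma unfolds_BinD:
  "unfold\<^sup>*\<^sup>* (Bin c \<sigma> \<tau>) \<rho> \<Longrightarrow> \<exists>\<sigma>' \<tau>'. \<rho> = Bin c \<sigma>' \<tau>' \<and> unfold\<^sup>*\<^sup>* \<sigma> \<sigma>' \<and> unfold\<^sup>*\<^sup>* \<tau> \<tau>'"
  by (induction rule: rtranclp_induct)
    (auto elim!: unfold_BinE intro: rtranclp.rtrancl_into_rtrancl)

lemma up_Bin: "up (Bin c \<sigma> \<tau>) = tree_bin c (up \<sigma>) (up \<tau>)"
proof
  show "up (Bin c \<sigma> \<tau>) \<subseteq> tree_bin c (up \<sigma>) (up \<tau>)"
  proof
    fix \<rho> assume "\<rho> \<in> up (Bin c \<sigma> \<tau>)"
    then obtain \<sigma>' \<tau>' where "unfold\<^sup>*\<^sup>* \<sigma> \<sigma>'" "unfold\<^sup>*\<^sup>* \<tau> \<tau>'" "tprec \<rho> (Bin c \<sigma>' \<tau>')"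
      by (auto simp: up_def dest!: unfolds_BinD)
    then show "\<rho> \<in> tree_bin c (up \<sigma>) (up \<tau>)"
      by (auto simp: up_def tree_bin_def elim!: tprec_BinRE)
  qed
  show "tree_bin c (up \<sigma>) (up \<tau>) \<subseteq> up (Bin c \<sigma> \<tau>)"
  proof
    fix \<rho> assume "\<rho> \<in> tree_bin c (up \<sigma>) (up \<tau>)"
    then consider "\<rho> = Void" | \<sigma>' \<tau>' where "\<rho> = Bin c \<sigma>' \<tau>'" "\<sigma>' \<in> up \<sigma>" "\<tau>' \<in> up \<tau>"
      by (auto simp: tree_bin_def)
    then show "\<rho> \<in> up (Bin c \<sigma> \<tau>)"
    proof cases
      case 1
      then show ?thesis by (auto simp: up_def intro: tprec.intros)
    next
      case 2
      then obtain \<sigma>'' \<tau>'' where "unfold\<^sup>*\<^sup>* \<sigma> \<sigma>''" "tprec \<sigma>' \<sigma>''" "unfold\<^sup>*\<^sup>* \<tau> \<tau>''" "tprec \<tau>' \<tau>''"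
        "simple \<sigma>'" "simple \<tau>'" by (auto simp: up_def)
      moreover from this have "unfold\<^sup>*\<^sup>* (Bin c \<sigma> \<tau>) (Bin c \<sigma>'' \<tau>'')"
        by (meson rtranclp_trans unfolds_Bin1 unfolds_Bin2)
      ultimately show ?thesis using 2 by (auto simp: up_def intro: tprec.intros)
    qed
  qed
qed

text \<open>Case analysis on the type tree instead of the expression. An expression such as
  \<open>Mu t (TVar t)\<close> never exposes a constructor and has the trivial tree; if the tree is
  not trivial, some unfolding has a constructor at the top and the same tree.\<close>

lemma up_cases:
  obtains "up \<sigma> = {Void}" | c \<sigma>1 \<sigma>2 where "up \<sigma> = up (Bin c \<sigma>1 \<sigma>2)"
proof (cases "up \<sigma> \<subseteq> {Void}")
  case True
  then show ?thesis using that(1) type_tree_up[of \<sigma>] by (auto simp: type_tree_def)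
next
  case False
  then obtain \<rho> where \<rho>: "\<rho> \<in> up \<sigma>" "\<rho> \<noteq> Void" by blast
  then obtain \<tau> where \<tau>: "simple \<rho>" "unfold\<^sup>*\<^sup>* \<sigma> \<tau>" "tprec \<rho> \<tau>" by (auto simp: up_def)
  with \<rho>(2) obtain c \<sigma>1 \<sigma>2 where "\<tau> = Bin c \<sigma>1 \<sigma>2" by (auto elim: tprec.cases)
  with up_unfolds[OF \<tau>(2)] show ?thesis using that(2) by simp
qed

lemma tyeq_refl [simp, intro]: "\<sigma> \<approx> \<sigma>"
  and tyeq_sym: "\<sigma> \<approx> \<tau> \<Longrightarrow> \<tau> \<approx> \<sigma>"
  and tyeq_trans [trans]: "\<sigma> \<approx> \<tau> \<Longrightarrow> \<tau> \<approx> \<rho> \<Longrightarrow> \<sigma> \<approx> \<rho>"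
  by (auto simp: tyeq_def)

text \<open>Constructors are injective on type trees. This is what allows typing to be inverted
  across uses of the conversion rule.\<close>

lemma tyeq_Bin: "Bin c \<sigma> \<tau> \<approx> Bin c' \<sigma>' \<tau>' \<longleftrightarrow> c = c' \<and> \<sigma> \<approx> \<sigma>' \<and> \<tau> \<approx> \<tau>'"
  using tree_bin_inject[OF type_tree_up type_tree_up type_tree_up type_tree_up]
  unfolding tyeq_def up_Bin by metis


section \<open>Prime systems of types\<close>

text \<open>The axioms of a prime system, together with the requirement that both relations live on
  the primes, which the record type does not enforce.\<close>

definition psys_ok :: "psys \<Rightarrow> bool" where
  "psys_ok P \<longleftrightarrow> coh P \<subseteq> primes P \<times> primes P \<and> leq P \<subseteq> primes P \<times> primes P
    \<and> (\<forall>a\<in>primes P. (a, a) \<in> coh P \<and> (a, a) \<in> leq P)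
    \<and> sym (coh P) \<and> trans (leq P) \<and> antisym (leq P)
    \<and> (\<forall>a b c. (a, b) \<in> coh P \<longrightarrow> (c, b) \<in> leq P \<longrightarrow> (a, c) \<in> coh P)"

text \<open>Substructures carry the induced relations. Mere inclusion of the relations would not be
  preserved by function spaces, where consistency of the bases occurs as a premise.\<close>

definition psys_sub :: "psys \<Rightarrow> psys \<Rightarrow> bool" where
  "psys_sub P Q \<longleftrightarrow> primes P \<subseteq> primes Q \<and> coh P = coh Q \<inter> primes P \<times> primes P
    \<and> leq P = leq Q \<inter> primes P \<times> primes P"

lemma psys_okD:
  assumes "psys_ok P"
  shows "(a, b) \<in> coh P \<Longrightarrow> a \<in> primes P" "(a, b) \<in> coh P \<Longrightarrow> b \<in> primes P"
    "(a, b) \<in> leq P \<Longrightarrow> a \<in> primes P" "(a, b) \<in> leq P \<Longrightarrow> b \<in> primes P"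
    "a \<in> primes P \<Longrightarrow> (a, a) \<in> coh P" "a \<in> primes P \<Longrightarrow> (a, a) \<in> leq P"
    "(a, b) \<in> coh P \<Longrightarrow> (b, a) \<in> coh P"
    "(a, b) \<in> leq P \<Longrightarrow> (b, c) \<in> leq P \<Longrightarrow> (a, c) \<in> leq P"
    "(a, b) \<in> leq P \<Longrightarrow> (b, a) \<in> leq P \<Longrightarrow> a = b"
    "(a, b) \<in> coh P \<Longrightarrow> (c, b) \<in> leq P \<Longrightarrow> (a, c) \<in> coh P"
    "(a, b) \<in> coh P \<Longrightarrow> (c, a) \<in> leq P \<Longrightarrow> (c, b) \<in> coh P"
  using assms unfolding psys_ok_def by (auto dest: symD transD antisymD) (meson symD)+

lemma psys_ok_zero: "psys_ok zero_psys"
  by (auto simp: psys_ok_def zero_psys_def sym_def trans_def antisym_def)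

lemma mem_sum_block: "x \<in> sum_block i P \<longleftrightarrow> x = Tag i \<or> (\<exists>a\<in>primes P. x = Inj i a)"
  by (auto simp: sum_block_def)

text \<open>Sums and products are indexed by \<open>bool\<close>; selecting by the index treats both
  components at once, for prime systems, types, terms and sets of primes alike.\<close>

definition sel :: "'a \<Rightarrow> 'a \<Rightarrow> bool \<Rightarrow> 'a" where
  "sel x y i = (if i then y else x)"

lemma sel_simps [simp]: "sel x y False = x" "sel x y True = y"
  by (simp_all add: sel_def)

lemma sum_psys_primes: "x \<in> primes (sum_psys P0 P1) \<longleftrightarrow>
  (\<exists>i. x = Tag i \<or> (\<exists>a\<in>primes (sel P0 P1 i). x = Inj i a))"
  by (auto simp: sel_def sum_psys_def mem_sum_block)

lemma sum_psys_coh: "(x, y) \<in> coh (sum_psys P0 P1) \<longleftrightarrow>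
  x \<in> primes (sum_psys P0 P1) \<and> y \<in> primes (sum_psys P0 P1) \<and>
  (\<exists>i. (x = Tag i \<or> (\<exists>a. x = Inj i a)) \<and> (y = Tag i \<or> (\<exists>a. y = Inj i a)) \<and>
    (\<forall>a b. x = Inj i a \<longrightarrow> y = Inj i b \<longrightarrow> (a, b) \<in> coh (sel P0 P1 i)))"
  unfolding sum_psys_primes by (auto simp: sel_def sum_psys_def mem_sum_block Let_def)

lemma sum_psys_leq: "(x, y) \<in> leq (sum_psys P0 P1) \<longleftrightarrow>
  (\<exists>i. x = Tag i \<and> (y = Tag i \<or> (\<exists>a\<in>primes (sel P0 P1 i). y = Inj i a))) \<or>
  (\<exists>i a b. x = Inj i a \<and> y = Inj i b \<and> (a, b) \<in> leq (sel P0 P1 i))"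
  by (auto simp: sel_def sum_psys_def mem_sum_block)

lemma prod_psys_primes: "x \<in> primes (prod_psys P0 P1) \<longleftrightarrow>
  (\<exists>i. \<exists>a\<in>primes (sel P0 P1 i). x = Inj i a)"
  by (auto simp: sel_def prod_psys_def)

lemma prod_psys_coh: "(x, y) \<in> coh (prod_psys P0 P1) \<longleftrightarrow>
  (\<exists>i j a b. x = Inj i a \<and> y = Inj j b \<and> a \<in> primes (sel P0 P1 i)
    \<and> b \<in> primes (sel P0 P1 j) \<and> (i \<noteq> j \<or> (a, b) \<in> coh (sel P0 P1 i)))"
  by (auto simp: sel_def prod_psys_def Let_def)

lemma prod_psys_leq: "(x, y) \<in> leq (prod_psys P0 P1) \<longleftrightarrow>
  (\<exists>i a b. x = Inj i a \<and> y = Inj i b \<and> (a, b) \<in> leq (sel P0 P1 i))"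
  by (auto simp: sel_def prod_psys_def Let_def)

lemma fun_psys_primes: "x \<in> primes (fun_psys P Q) \<longleftrightarrow>
  (\<exists>X b. x = Step X b \<and> step_base P X \<and> b \<in> primes Q)"
  by (auto simp: fun_psys_def Let_def)

lemma fun_psys_coh: "(x, y) \<in> coh (fun_psys P Q) \<longleftrightarrow>
  (\<exists>X a Y b. x = Step X a \<and> y = Step Y b \<and> x \<in> primes (fun_psys P Q) \<and> y \<in> primes (fun_psys P Q)
    \<and> ((\<forall>x\<in>fset X. \<forall>y\<in>fset Y. (x, y) \<in> coh P) \<longrightarrow> (a, b) \<in> coh Q))"
  unfolding fun_psys_primes by (auto simp: fun_psys_def Let_def)

lemma fun_psys_leq: "(x, y) \<in> leq (fun_psys P Q) \<longleftrightarrow>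
  (\<exists>X a Y b. x = Step X a \<and> y = Step Y b \<and> x \<in> primes (fun_psys P Q) \<and> y \<in> primes (fun_psys P Q)
    \<and> fset Y \<subseteq> down P (fset X) \<and> (a, b) \<in> leq Q)"
  unfolding fun_psys_primes by (auto simp: fun_psys_def Let_def)

lemma psys_ok_sum:
  assumes "psys_ok P0" "psys_ok P1" shows "psys_ok (sum_psys P0 P1)"
proof -
  have "psys_ok (sel P0 P1 i)" for i using assms by (cases i) simp_all
  note d = psys_okD[OF this]
  have l: "(x, y) \<in> leq (sum_psys P0 P1) \<Longrightarrow> x \<in> primes (sum_psys P0 P1) \<and> y \<in> primes (sum_psys P0 P1)" for x y
    by (auto simp: sum_psys_leq sum_psys_primes dest: d(3,4))
  have r: "x \<in> primes (sum_psys P0 P1) \<Longrightarrow> (x, x) \<in> coh (sum_psys P0 P1) \<and> (x, x) \<in> leq (sum_psys P0 P1)" for x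
    by (auto simp: sum_psys_leq sum_psys_coh sum_psys_primes intro: d(5,6))
  show ?thesis
    unfolding psys_ok_def
  proof (intro conjI ballI allI impI)
    show "sym (coh (sum_psys P0 P1))"
    proof (rule symI)
      fix x y assume "(x, y) \<in> coh (sum_psys P0 P1)"
      then show "(y, x) \<in> coh (sum_psys P0 P1)"
        by (auto simp: sum_psys_coh intro: d(7))
    qed
    show "trans (leq (sum_psys P0 P1))"
    proof (rule transI)
      fix x y z assume "(x, y) \<in> leq (sum_psys P0 P1)" "(y, z) \<in> leq (sum_psys P0 P1)"
      then show "(x, z) \<in> leq (sum_psys P0 P1)"
        by (auto simp: sum_psys_leq intro: d(8) dest: d(4))
    qed
    show "antisym (leq (sum_psys P0 P1))"
    proof (rule antisymI)
      fix x y assume "(x, y) \<in> leq (sum_psys P0 P1)" "(y, x) \<in> leq (sum_psys P0 P1)"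
      then show "x = y" by (auto simp: sum_psys_leq intro: d(9))
    qed
    fix a b c assume ab: "(a, b) \<in> coh (sum_psys P0 P1)" and cb: "(c, b) \<in> leq (sum_psys P0 P1)"
    then have p: "a \<in> primes (sum_psys P0 P1)" "c \<in> primes (sum_psys P0 P1)"
      using l by (auto simp: sum_psys_coh)
    from ab cb show "(a, c) \<in> coh (sum_psys P0 P1)"
      by (auto simp: sum_psys_coh sum_psys_leq p intro: d(10))
  qed (use l r in \<open>auto simp: sum_psys_coh\<close>)
qed

lemma psys_ok_prod:
  assumes "psys_ok P0" "psys_ok P1" shows "psys_ok (prod_psys P0 P1)"
proof -
  note d0 = psys_okD[OF assms(1)] and d1 = psys_okD[OF assms(2)]
  have ok: "psys_ok (sel P0 P1 i)" for i using assms by (cases i) simp_all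
  have l: "leq (prod_psys P0 P1) \<subseteq> primes (prod_psys P0 P1) \<times> primes (prod_psys P0 P1)"
  proof (rule subrelI)
    fix x y assume "(x, y) \<in> leq (prod_psys P0 P1)"
    then obtain i a b where "x = Inj i a" "y = Inj i b" "(a, b) \<in> leq (sel P0 P1 i)"
      unfolding prod_psys_leq by (elim exE conjE)
    with psys_okD(3,4)[OF ok[of i], of a b]
    show "(x, y) \<in> primes (prod_psys P0 P1) \<times> primes (prod_psys P0 P1)"
      by (simp add: prod_psys_primes)
  qed
  show ?thesis
    unfolding psys_ok_def
  proof (intro conjI ballI allI impI l)
    show "sym (coh (prod_psys P0 P1))"
    proof (rule symI)
      fix x y assume "(x, y) \<in> coh (prod_psys P0 P1)"
      then show "(y, x) \<in> coh (prod_psys P0 P1)"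
        by (auto simp: prod_psys_coh ex_bool_eq intro: d0(7) d1(7))
    qed
    show "trans (leq (prod_psys P0 P1))"
    proof (rule transI)
      fix x y z assume "(x, y) \<in> leq (prod_psys P0 P1)" "(y, z) \<in> leq (prod_psys P0 P1)"
      then show "(x, z) \<in> leq (prod_psys P0 P1)"
        by (auto simp: prod_psys_leq ex_bool_eq intro: d0(8) d1(8))
    qed
    show "antisym (leq (prod_psys P0 P1))"
    proof (rule antisymI)
      fix x y assume "(x, y) \<in> leq (prod_psys P0 P1)" "(y, x) \<in> leq (prod_psys P0 P1)"
      then show "x = y" by (auto simp: prod_psys_leq ex_bool_eq intro: d0(9) d1(9))
    qed
    fix a b c assume ab: "(a, b) \<in> coh (prod_psys P0 P1)" and cb: "(c, b) \<in> leq (prod_psys P0 P1)"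
    then show "(a, c) \<in> coh (prod_psys P0 P1)"
      by (auto simp: prod_psys_coh prod_psys_leq ex_bool_eq intro: d0(10) d1(10) dest: d0(3) d1(3))
  qed (auto simp: prod_psys_coh prod_psys_leq prod_psys_primes ex_bool_eq intro: d0(5,6) d1(5,6))
qed

text \<open>An element of \<open>X\<close> lies below one of \<open>Y\<close>, and that one below
  another element of \<open>X\<close>; incomparability inside \<open>X\<close> collapses this chain.
  Antisymmetry of the order on step primes follows.\<close>

lemma step_base_antisym:
  assumes P: "psys_ok P" and X: "step_base P X" and Y: "step_base P Y"
    and XY: "fset X \<subseteq> down P (fset Y)" and YX: "fset Y \<subseteq> down P (fset X)"
  shows "fset X \<subseteq> fset Y"
proof
  fix a assume a: "a \<in> fset X"
  then obtain b where b: "b \<in> fset Y" "(a, b) \<in> leq P" using XY by (auto simp: down_def)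
  then obtain c where c: "c \<in> fset X" "(b, c) \<in> leq P" using YX by (auto simp: down_def)
  have "(a, c) \<in> leq P" using b c psys_okD(8)[OF P] by blast
  then have "a = c" using X a c by (auto simp: step_base_def)
  then show "a \<in> fset Y" using b c psys_okD(9)[OF P] by blast
qed

lemma down_trans: "psys_ok P \<Longrightarrow> X \<subseteq> down P Y \<Longrightarrow> down P X \<subseteq> down P Y"
  unfolding down_def by (blast dest: psys_okD(8))

lemma down_base: "psys_ok P \<Longrightarrow> step_base P X \<Longrightarrow> fset X \<subseteq> down P (fset X)"
  unfolding down_def step_base_def by (blast dest: psys_okD(6))

lemma psys_ok_fun:
  assumes P: "psys_ok P" and Q: "psys_ok Q" shows "psys_ok (fun_psys P Q)"
  unfolding psys_ok_def
proof (intro conjI ballI allI impI)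
  show "coh (fun_psys P Q) \<subseteq> primes (fun_psys P Q) \<times> primes (fun_psys P Q)"
    by (auto simp: fun_psys_coh)
  show "leq (fun_psys P Q) \<subseteq> primes (fun_psys P Q) \<times> primes (fun_psys P Q)"
    by (auto simp: fun_psys_leq)
  show "sym (coh (fun_psys P Q))"
    by (rule symI) (auto simp: fun_psys_coh intro: psys_okD[OF P] psys_okD[OF Q])
  show "trans (leq (fun_psys P Q))"
  proof (rule transI)
    fix x y z assume "(x, y) \<in> leq (fun_psys P Q)" "(y, z) \<in> leq (fun_psys P Q)"
    then obtain X a Y b Z c where "x = Step X a" "z = Step Z c" "x \<in> primes (fun_psys P Q)"
      "z \<in> primes (fun_psys P Q)" "fset Y \<subseteq> down P (fset X)" "fset Z \<subseteq> down P (fset Y)"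
      "(a, b) \<in> leq Q" "(b, c) \<in> leq Q" by (auto simp: fun_psys_leq)
    then show "(x, z) \<in> leq (fun_psys P Q)"
      using psys_okD(8)[OF Q, of a b c] down_trans[OF P, of "fset Y" "fset X"]
      by (auto simp: fun_psys_leq)
  qed
  show "antisym (leq (fun_psys P Q))"
  proof (rule antisymI)
    fix x y assume "(x, y) \<in> leq (fun_psys P Q)" "(y, x) \<in> leq (fun_psys P Q)"
    then obtain X a Y b where *: "x = Step X a" "y = Step Y b" "step_base P X" "step_base P Y"
      "fset X \<subseteq> down P (fset Y)" "fset Y \<subseteq> down P (fset X)" "(a, b) \<in> leq Q" "(b, a) \<in> leq Q"
      by (auto simp: fun_psys_leq fun_psys_primes)
    have "fset X = fset Y"
      using step_base_antisym[OF P *(3-6)] step_base_antisym[OF P *(4,3,6,5)] by (rule subset_antisym)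
    moreover have "a = b" using psys_okD(9)[OF Q *(7,8)] .
    ultimately show "x = y" using * by (simp add: fset_inject)
  qed
  {
    fix x assume "x \<in> primes (fun_psys P Q)"
    then show "(x, x) \<in> coh (fun_psys P Q)" "(x, x) \<in> leq (fun_psys P Q)"
      using down_base[OF P] by (auto simp: fun_psys_coh fun_psys_leq fun_psys_primes intro: psys_okD[OF Q])
  }
  fix x y z assume xy: "(x, y) \<in> coh (fun_psys P Q)" and zy: "(z, y) \<in> leq (fun_psys P Q)"
  from xy obtain X a Y b where x: "x = Step X a" and y: "y = Step Y b" and
    1: "(\<forall>x\<in>fset X. \<forall>y\<in>fset Y. (x, y) \<in> coh P) \<longrightarrow> (a, b) \<in> coh Q"
    unfolding fun_psys_coh by (elim exE conjE)
  from zy y obtain Z c where z: "z = Step Z c" and 2: "fset Y \<subseteq> down P (fset Z)" "(c, b) \<in> leq Q"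
    by (auto simp: fun_psys_leq)
  \<comment> \<open>Whatever is consistent with \<open>Z\<close> is consistent with everything below
    \<open>Z\<close>, in particular with \<open>Y\<close>, so the implication \<open>1\<close>
    applies.\<close>
  have "(a, c) \<in> coh Q" if "\<forall>x\<in>fset X. \<forall>z\<in>fset Z. (x, z) \<in> coh P"
  proof -
    have "\<forall>x\<in>fset X. \<forall>y\<in>fset Y. (x, y) \<in> coh P"
      using that 2(1) unfolding down_def by (blast dest: psys_okD(10)[OF P])
    then show ?thesis using 1 2(2) by (blast dest: psys_okD(10)[OF Q])
  qed
  then show "(x, z) \<in> coh (fun_psys P Q)"
    using x z xy zy by (auto simp: fun_psys_coh fun_psys_leq)
qed

lemma psys_ok_bin: "psys_ok P \<Longrightarrow> psys_ok Q \<Longrightarrow> psys_ok (bin_psys c P Q)"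
  by (cases c) (auto intro: psys_ok_sum psys_ok_prod psys_ok_fun)

section \<open>Substructures and the chain of levels\<close>

lemma psys_subD:
  assumes "psys_sub P Q"
  shows "a \<in> primes P \<Longrightarrow> a \<in> primes Q"
    "a \<in> primes P \<Longrightarrow> b \<in> primes P \<Longrightarrow> (a, b) \<in> coh P \<longleftrightarrow> (a, b) \<in> coh Q"
    "a \<in> primes P \<Longrightarrow> b \<in> primes P \<Longrightarrow> (a, b) \<in> leq P \<longleftrightarrow> (a, b) \<in> leq Q"
  using assms by (auto simp: psys_sub_def)

lemma psys_subI:
  assumes "primes P \<subseteq> primes Q" "coh P \<subseteq> primes P \<times> primes P" "leq P \<subseteq> primes P \<times> primes P"
    "\<And>a b. a \<in> primes P \<Longrightarrow> b \<in> primes P \<Longrightarrow> (a, b) \<in> coh P \<longleftrightarrow> (a, b) \<in> coh Q"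
    "\<And>a b. a \<in> primes P \<Longrightarrow> b \<in> primes P \<Longrightarrow> (a, b) \<in> leq P \<longleftrightarrow> (a, b) \<in> leq Q"
  shows "psys_sub P Q"
  using assms by (auto simp: psys_sub_def)

lemma psys_sub_step_base:
  "psys_sub P Q \<Longrightarrow> fset X \<subseteq> primes P \<Longrightarrow> step_base P X \<longleftrightarrow> step_base Q X"
  unfolding step_base_def by (meson psys_subD subsetD subsetI)

lemma psys_sub_bin:
  assumes P: "psys_sub P P'" and Q: "psys_sub Q Q'" and ok: "psys_ok P" "psys_ok Q"
  shows "psys_sub (bin_psys c P Q) (bin_psys c P' Q')"
proof (rule psys_subI)
  note d = psys_subD[OF P] psys_subD[OF Q]
  have ok': "psys_ok (bin_psys c P Q)" using ok by (rule psys_ok_bin)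
  then show "coh (bin_psys c P Q) \<subseteq> primes (bin_psys c P Q) \<times> primes (bin_psys c P Q)"
    "leq (bin_psys c P Q) \<subseteq> primes (bin_psys c P Q) \<times> primes (bin_psys c P Q)"
    by (auto simp: psys_ok_def)
  have sb: "step_base P X \<Longrightarrow> step_base P' X" for X
    using psys_sub_step_base[OF P, of X] by (auto simp: step_base_def)
  show sub: "primes (bin_psys c P Q) \<subseteq> primes (bin_psys c P' Q')"
    using d(1,4) sb
    by (cases c) (auto simp: sum_psys_primes prod_psys_primes fun_psys_primes ex_bool_eq)
  fix a b assume a: "a \<in> primes (bin_psys c P Q)" and b: "b \<in> primes (bin_psys c P Q)"
  have a': "a \<in> primes (bin_psys c P' Q')" and b': "b \<in> primes (bin_psys c P' Q')"
    using sub a b by auto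
  show "(a, b) \<in> coh (bin_psys c P Q) \<longleftrightarrow> (a, b) \<in> coh (bin_psys c P' Q')"
  proof (cases c)
    case Sum
    then show ?thesis using a b a' b' d
      by (auto simp: sum_psys_coh sum_psys_primes ex_bool_eq)
  next
    case Prod
    then show ?thesis using a b a' b' d
      by (auto simp: prod_psys_coh prod_psys_primes ex_bool_eq)
  next
    case Arr
    then obtain X x Y y where xy: "a = Step X x" "b = Step Y y" "fset X \<subseteq> primes P" "fset Y \<subseteq> primes P"
      "x \<in> primes Q" "y \<in> primes Q"
      using a b by (auto simp: fun_psys_primes step_base_def)
    have "(\<forall>x\<in>fset X. \<forall>y\<in>fset Y. (x, y) \<in> coh P) \<longleftrightarrow> (\<forall>x\<in>fset X. \<forall>y\<in>fset Y. (x, y) \<in> coh P')"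
      using xy psys_subD(2)[OF P] by blast
    then show ?thesis using xy Arr a b a' b' psys_subD(2)[OF Q] by (simp add: fun_psys_coh)
  qed
  show "(a, b) \<in> leq (bin_psys c P Q) \<longleftrightarrow> (a, b) \<in> leq (bin_psys c P' Q')"
  proof (cases c)
    case Sum
    then show ?thesis using a b a' b' d
      by (auto simp: sum_psys_leq sum_psys_primes ex_bool_eq)
  next
    case Prod
    then show ?thesis using a b a' b' d
      by (auto simp: prod_psys_leq prod_psys_primes ex_bool_eq)
  next
    case Arr
    then obtain X x Y y where xy: "a = Step X x" "b = Step Y y" "fset X \<subseteq> primes P" "fset Y \<subseteq> primes P"
      "x \<in> primes Q" "y \<in> primes Q"
      using a b by (auto simp: fun_psys_primes step_base_def)
    have "fset Y \<subseteq> down P (fset X) \<longleftrightarrow> fset Y \<subseteq> down P' (fset X)"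
      using xy psys_subD(3)[OF P] unfolding down_def by blast
    then show ?thesis using xy Arr a b a' b' psys_subD(3)[OF Q] by (simp add: fun_psys_leq)
  qed
qed

abbreviation PS_level :: "nat \<Rightarrow> texp \<Rightarrow> psys" where
  "PS_level n \<sigma> \<equiv> psys_level n (up \<sigma>)"

lemma PS_level_Bin: "PS_level (Suc n) (Bin c \<sigma> \<tau>) = bin_psys c (PS_level n \<sigma>) (PS_level n \<tau>)"
  unfolding up_Bin by (rule psys_level_bin[OF type_tree_up type_tree_up])

lemma psys_ok_PS_level: "psys_ok (PS_level n \<sigma>)"
proof (induction n arbitrary: \<sigma>)
  case 0
  then show ?case by (simp add: psys_ok_zero)
next
  case (Suc n)
  show ?case
  proof (cases \<sigma> rule: up_cases)
    case 1
    then show ?thesis using psys_level_Void psys_ok_zero by simp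
  next
    case (2 c \<sigma>1 \<sigma>2)
    then show ?thesis using PS_level_Bin[of n c \<sigma>1 \<sigma>2] Suc psys_ok_bin by (simp only:)
  qed
qed

lemma psys_sub_zero: "psys_sub zero_psys P"
  by (auto simp: psys_sub_def zero_psys_def)

lemma psys_sub_PS_level: "psys_sub (PS_level n \<sigma>) (PS_level (Suc n) \<sigma>)"
proof (induction n arbitrary: \<sigma>)
  case 0
  then show ?case by (simp add: psys_sub_zero del: psys_level.simps(2))
next
  case (Suc n)
  show ?case
  proof (cases \<sigma> rule: up_cases)
    case 1
    then show ?thesis using psys_level_Void psys_sub_zero by simp
  next
    case (2 c \<sigma>1 \<sigma>2)
    then show ?thesis using PS_level_Bin[of _ c \<sigma>1 \<sigma>2] Suc psys_sub_bin psys_ok_PS_level by (simp only:)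
  qed
qed

lemma psys_sub_refl: "psys_ok P \<Longrightarrow> psys_sub P P"
  by (auto simp: psys_sub_def psys_ok_def)

lemma psys_sub_trans: "psys_sub P Q \<Longrightarrow> psys_sub Q R \<Longrightarrow> psys_sub P R"
  by (auto simp: psys_sub_def)

lemma psys_sub_PS_level_le: "m \<le> n \<Longrightarrow> psys_sub (PS_level m \<sigma>) (PS_level n \<sigma>)"
  by (induction n rule: dec_induct)
    (auto intro: psys_sub_refl psys_ok_PS_level psys_sub_trans psys_sub_PS_level simp del: psys_level.simps)

lemma PS_simps:
  "primes (PS \<sigma>) = (\<Union>n. primes (PS_level n \<sigma>))" "coh (PS \<sigma>) = (\<Union>n. coh (PS_level n \<sigma>))"
  "leq (PS \<sigma>) = (\<Union>n. leq (PS_level n \<sigma>))"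
  by (simp_all add: PS_def tree_psys_def)

lemma psys_sub_PS: "psys_sub (PS_level n \<sigma>) (PS \<sigma>)"
proof (rule psys_subI)
  show "primes (PS_level n \<sigma>) \<subseteq> primes (PS \<sigma>)" by (auto simp: PS_simps)
  show "coh (PS_level n \<sigma>) \<subseteq> primes (PS_level n \<sigma>) \<times> primes (PS_level n \<sigma>)"
    "leq (PS_level n \<sigma>) \<subseteq> primes (PS_level n \<sigma>) \<times> primes (PS_level n \<sigma>)"
    using psys_ok_PS_level[of n \<sigma>] by (auto simp: psys_ok_def)
  fix a b assume ab: "a \<in> primes (PS_level n \<sigma>)" "b \<in> primes (PS_level n \<sigma>)"
  have *: "((a, b) \<in> coh (PS_level m \<sigma>) \<longrightarrow> (a, b) \<in> coh (PS_level n \<sigma>)) \<and>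
    ((a, b) \<in> leq (PS_level m \<sigma>) \<longrightarrow> (a, b) \<in> leq (PS_level n \<sigma>))" for m
  proof (cases "m \<le> n")
    case True
    then show ?thesis using psys_sub_PS_level_le[of m n \<sigma>] by (simp add: psys_sub_def)
  next
    case False
    then show ?thesis using psys_sub_PS_level_le[of n m \<sigma>] ab by (simp add: psys_sub_def)
  qed
  then show "(a, b) \<in> coh (PS_level n \<sigma>) \<longleftrightarrow> (a, b) \<in> coh (PS \<sigma>)"
    "(a, b) \<in> leq (PS_level n \<sigma>) \<longleftrightarrow> (a, b) \<in> leq (PS \<sigma>)" unfolding PS_simps by blast+
qed

text \<open>The levels form a chain. Through this fact the finiteness of bases makes the function
  space commute with the union of the levels.\<close>

lemma finite_PS_level: "finite F \<Longrightarrow> F \<subseteq> primes (PS \<sigma>) \<Longrightarrow> \<exists>n. F \<subseteq> primes (PS_level n \<sigma>)"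
proof (induction rule: finite_induct)
  case (insert x F)
  then obtain n m where "F \<subseteq> primes (PS_level n \<sigma>)" "x \<in> primes (PS_level m \<sigma>)" by (auto simp: PS_simps)
  then have "insert x F \<subseteq> primes (PS_level (max m n) \<sigma>)"
    using psys_sub_PS_level_le[of n "max m n" \<sigma>] psys_sub_PS_level_le[of m "max m n" \<sigma>]
    by (auto simp: psys_sub_def)
  then show ?case by blast
qed simp

lemma psys_ok_PS: "psys_ok (PS \<sigma>)"
proof -
  \<comment> \<open>Each axiom speaks of at most three primes, so it is inherited from one level
    that contains them all.\<close>
  have PS_level: "\<exists>n. a \<in> primes (PS_level n \<sigma>) \<and> b \<in> primes (PS_level n \<sigma>) \<and> c \<in> primes (PS_level n \<sigma>)"
    if "a \<in> primes (PS \<sigma>)" "b \<in> primes (PS \<sigma>)" "c \<in> primes (PS \<sigma>)" for a b c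
    using finite_PS_level[of "{a, b, c}" \<sigma>] that by auto
  have 1: "coh (PS \<sigma>) \<subseteq> primes (PS \<sigma>) \<times> primes (PS \<sigma>)" "leq (PS \<sigma>) \<subseteq> primes (PS \<sigma>) \<times> primes (PS \<sigma>)"
    using psys_ok_PS_level by (fastforce simp: PS_simps psys_ok_def)+
  have 2: "coh (PS \<sigma>) \<inter> primes (PS_level n \<sigma>) \<times> primes (PS_level n \<sigma>) = coh (PS_level n \<sigma>)"
     "leq (PS \<sigma>) \<inter> primes (PS_level n \<sigma>) \<times> primes (PS_level n \<sigma>) = leq (PS_level n \<sigma>)" for n
    using psys_sub_PS[of n \<sigma>] by (auto simp: psys_sub_def)
  have 3: "(a, b) \<in> coh (PS \<sigma>) \<longleftrightarrow> (a, b) \<in> coh (PS_level n \<sigma>)" "(a, b) \<in> leq (PS \<sigma>) \<longleftrightarrow> (a, b) \<in> leq (PS_level n \<sigma>)"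
    if "a \<in> primes (PS_level n \<sigma>)" "b \<in> primes (PS_level n \<sigma>)" for a b n
    using that 2[of n] by blast+
  show ?thesis
    unfolding psys_ok_def
  proof (intro conjI ballI allI impI 1)
    show "sym (coh (PS \<sigma>))"
      using psys_okD(7)[OF psys_ok_PS_level] unfolding sym_def PS_simps UN_iff by metis
    show "trans (leq (PS \<sigma>))"
    proof (rule transI)
      fix x y z assume h: "(x, y) \<in> leq (PS \<sigma>)" "(y, z) \<in> leq (PS \<sigma>)"
      then obtain n where "x \<in> primes (PS_level n \<sigma>)" "y \<in> primes (PS_level n \<sigma>)" "z \<in> primes (PS_level n \<sigma>)"
        using PS_level 1 by blast
      with h 3 show "(x, z) \<in> leq (PS \<sigma>)" using psys_okD(8)[OF psys_ok_PS_level] by metis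
    qed
    show "antisym (leq (PS \<sigma>))"
    proof (rule antisymI)
      fix x y assume h: "(x, y) \<in> leq (PS \<sigma>)" "(y, x) \<in> leq (PS \<sigma>)"
      then obtain n where "x \<in> primes (PS_level n \<sigma>)" "y \<in> primes (PS_level n \<sigma>)"
        using PS_level 1 by blast
      with h 3 show "x = y" using psys_okD(9)[OF psys_ok_PS_level] by metis
    qed
    {
      fix a assume "a \<in> primes (PS \<sigma>)"
      then show "(a, a) \<in> coh (PS \<sigma>)" "(a, a) \<in> leq (PS \<sigma>)"
        using psys_okD(5,6)[OF psys_ok_PS_level] unfolding PS_simps UN_iff by metis+
    }
    fix a b c assume h: "(a, b) \<in> coh (PS \<sigma>)" "(c, b) \<in> leq (PS \<sigma>)"
    then obtain n where "a \<in> primes (PS_level n \<sigma>)" "b \<in> primes (PS_level n \<sigma>)" "c \<in> primes (PS_level n \<sigma>)"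
      using PS_level 1 by blast
    with h 3 show "(a, c) \<in> coh (PS \<sigma>)" using psys_okD(10)[OF psys_ok_PS_level] by metis
  qed
qed

lemma psys_sub_eq: "psys_sub P Q \<Longrightarrow> psys_ok Q \<Longrightarrow> primes Q \<subseteq> primes P \<Longrightarrow> P = Q"
  by (intro psys.equality) (auto simp: psys_sub_def psys_ok_def)

text \<open>The domain equation. A level of the left side is built from levels of the components,
  which are substructures of their unions; conversely a prime of the right side involves only
  finitely many primes of the components, and these occur together at some level.\<close>

lemma PS_Bin: "PS (Bin c \<sigma> \<tau>) = bin_psys c (PS \<sigma>) (PS \<tau>)" (is "?L = ?R")
proof (rule psys_sub_eq)
  show ok: "psys_ok ?R" by (intro psys_ok_bin psys_ok_PS)
  have sub: "psys_sub (PS_level n (Bin c \<sigma> \<tau>)) ?R" for n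
    by (cases n) (auto simp del: psys_level.simps(2) simp: PS_level_Bin psys_sub_zero
        intro!: psys_sub_bin psys_sub_PS psys_ok_PS_level)
  show "psys_sub ?L ?R"
  proof (rule psys_subI)
    show "primes ?L \<subseteq> primes ?R" using psys_subD(1)[OF sub] by (auto simp: PS_simps(1)[of "Bin c \<sigma> \<tau>"])
    show "coh ?L \<subseteq> primes ?L \<times> primes ?L" "leq ?L \<subseteq> primes ?L \<times> primes ?L"
      using psys_ok_PS[of "Bin c \<sigma> \<tau>"] by (auto simp: psys_ok_def)
    fix a b assume "a \<in> primes ?L" "b \<in> primes ?L"
    then obtain n where "a \<in> primes (PS_level n (Bin c \<sigma> \<tau>))" "b \<in> primes (PS_level n (Bin c \<sigma> \<tau>))"
      using finite_PS_level[of "{a, b}" "Bin c \<sigma> \<tau>"] by auto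
    then show "(a, b) \<in> coh ?L \<longleftrightarrow> (a, b) \<in> coh ?R" "(a, b) \<in> leq ?L \<longleftrightarrow> (a, b) \<in> leq ?R"
      using psys_subD(2,3)[OF sub] psys_subD(2,3)[OF psys_sub_PS] by blast+
  qed
  have *: "primes (bin_psys c (PS_level n \<sigma>) (PS_level n \<tau>)) \<subseteq> primes ?L" for n
    using psys_subD(1)[OF psys_sub_PS[of "Suc n" "Bin c \<sigma> \<tau>"]] by (auto simp only: PS_level_Bin)
  show "primes ?R \<subseteq> primes ?L"
  proof
    fix x assume x: "x \<in> primes ?R"
    have "\<exists>n. x \<in> primes (bin_psys c (PS_level n \<sigma>) (PS_level n \<tau>))"
    proof (cases c)
      case Sum
      then show ?thesis using x by (auto simp: sum_psys_primes PS_simps sel_def split: if_splits)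
    next
      case Prod
      then show ?thesis using x by (auto simp: prod_psys_primes PS_simps sel_def split: if_splits)
    next
      case Arr
      then obtain X b where X: "x = Step X b" "step_base (PS \<sigma>) X" "b \<in> primes (PS \<tau>)"
        using x by (auto simp: fun_psys_primes)
      from X(2) finite_PS_level[of "fset X" \<sigma>] obtain n where n: "fset X \<subseteq> primes (PS_level n \<sigma>)"
        by (auto simp: step_base_def)
      from X(3) obtain m where m: "b \<in> primes (PS_level m \<tau>)" by (auto simp: PS_simps)
      have "fset X \<subseteq> primes (PS_level (max m n) \<sigma>)" "b \<in> primes (PS_level (max m n) \<tau>)"
        using n m psys_sub_PS_level_le[of n "max m n" \<sigma>] psys_sub_PS_level_le[of m "max m n" \<tau>]
        by (auto simp: psys_sub_def)
      then show ?thesis using X psys_sub_step_base[OF psys_sub_PS] Arr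
        by (auto simp: fun_psys_primes intro!: exI[of _ "max m n"])
    qed
    then show "x \<in> primes ?L" using * by blast
  qed
qed

lemma PS_cong: "\<sigma> \<approx> \<tau> \<Longrightarrow> PS \<sigma> = PS \<tau>"
  by (simp add: PS_def tyeq_def)


section \<open>Elements and continuous functions\<close>

lemma D_I:
  assumes "\<And>a. a \<in> d \<Longrightarrow> a \<in> primes (PS \<sigma>)"
    "\<And>a b. a \<in> d \<Longrightarrow> b \<in> d \<Longrightarrow> (a, b) \<in> coh (PS \<sigma>)"
    "\<And>a b. b \<in> d \<Longrightarrow> (a, b) \<in> leq (PS \<sigma>) \<Longrightarrow> a \<in> d"
  shows "d \<in> D \<sigma>"
  using assms by (simp add: D_def elements_def subset_iff)

lemma D_prime: "d \<in> D \<sigma> \<Longrightarrow> a \<in> d \<Longrightarrow> a \<in> primes (PS \<sigma>)"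
  and D_coh: "d \<in> D \<sigma> \<Longrightarrow> a \<in> d \<Longrightarrow> b \<in> d \<Longrightarrow> (a, b) \<in> coh (PS \<sigma>)"
  and D_down: "d \<in> D \<sigma> \<Longrightarrow> b \<in> d \<Longrightarrow> (a, b) \<in> leq (PS \<sigma>) \<Longrightarrow> a \<in> d"
  by (simp_all add: D_def elements_def subset_iff)

lemma D_cong: "\<sigma> \<approx> \<tau> \<Longrightarrow> D \<sigma> = D \<tau>"
  by (simp add: D_def PS_cong)

lemma D_empty: "{} \<in> D \<sigma>"
  by (rule D_I) simp_all

lemma down_D:
  assumes "\<And>a. a \<in> F \<Longrightarrow> a \<in> primes (PS \<sigma>)" "\<And>a b. a \<in> F \<Longrightarrow> b \<in> F \<Longrightarrow> (a, b) \<in> coh (PS \<sigma>)"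
  shows "down (PS \<sigma>) F \<in> D \<sigma>"
proof (rule D_I)
  note ok = psys_okD[OF psys_ok_PS]
  fix a assume "a \<in> down (PS \<sigma>) F"
  then obtain a' where a': "a' \<in> F" "(a, a') \<in> leq (PS \<sigma>)" unfolding down_def by (elim CollectE bexE)
  then show "a \<in> primes (PS \<sigma>)" using ok(3) by metis
  {
    fix b assume "b \<in> down (PS \<sigma>) F"
    then obtain b' where b': "b' \<in> F" "(b, b') \<in> leq (PS \<sigma>)" unfolding down_def by (elim CollectE bexE)
    from assms(2)[OF a'(1) b'(1)] show "(a, b) \<in> coh (PS \<sigma>)"
      using ok(10)[OF _ b'(2)] ok(11)[OF _ a'(2)] by metis
  }
  fix b assume "(b, a) \<in> leq (PS \<sigma>)"
  then have "(b, a') \<in> leq (PS \<sigma>)" using ok(8) a'(2) by metis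
  then show "b \<in> down (PS \<sigma>) F" using a'(1) unfolding down_def by (intro CollectI bexI)
qed

lemma down_base_D: "step_base (PS \<sigma>) X \<Longrightarrow> down (PS \<sigma>) (fset X) \<in> D \<sigma>"
  by (rule down_D) (auto simp: step_base_def)

lemma down_subset: "d \<in> D \<sigma> \<Longrightarrow> F \<subseteq> d \<Longrightarrow> down (PS \<sigma>) F \<subseteq> d"
proof
  fix a assume "d \<in> D \<sigma>" "F \<subseteq> d" "a \<in> down (PS \<sigma>) F"
  then show "a \<in> d" unfolding down_def using D_down by (elim CollectE bexE) (meson subsetD)
qed

lemma base_subset_down: "step_base (PS \<sigma>) X \<Longrightarrow> fset X \<subseteq> down (PS \<sigma>) (fset X)"
  by (rule down_base[OF psys_ok_PS])


text \<open>Continuity produces finite sets of primes, but \<open>Step\<close> takes antichains.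
  Discarding the members that lie below others turns a finite set into a base with the same downward
  closure.\<close>

lemma ex_step_base:
  assumes d: "d \<in> D \<sigma>"
  shows "finite F \<Longrightarrow> F \<subseteq> d \<Longrightarrow> \<exists>X. step_base (PS \<sigma>) X \<and> fset X \<subseteq> F \<and> F \<subseteq> down (PS \<sigma>) (fset X)"
proof (induction rule: finite_induct)
  case empty
  then show ?case by (intro exI[of _ "{||}"]) (simp add: step_base_def)
next
  case (insert a F)
  note ok = psys_okD[OF psys_ok_PS[of \<sigma>]]
  from insert obtain X where X: "step_base (PS \<sigma>) X" "fset X \<subseteq> F" "F \<subseteq> down (PS \<sigma>) (fset X)" by auto
  have ad: "a \<in> d" "F \<subseteq> d" using insert by auto
  show ?case
  proof (cases "a \<in> down (PS \<sigma>) (fset X)")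
    case True
    then show ?thesis using X by (intro exI[of _ X]) auto
  next
    case False
    \<comment> \<open>Here \<open>a\<close> is not below any member of \<open>X\<close>, so adding
      it and dropping everything below it leaves an antichain.\<close>
    define Y where "Y = finsert a (ffilter (\<lambda>x. (x, a) \<notin> leq (PS \<sigma>)) X)"
    have Y: "fset Y = insert a {x \<in> fset X. (x, a) \<notin> leq (PS \<sigma>)}" by (auto simp: Y_def)
    have Yd: "fset Y \<subseteq> d" using ad X by (auto simp: Y)
    have aX: "(a, x) \<notin> leq (PS \<sigma>)" if "x \<in> fset X" for x
      using False that unfolding down_def by blast
    have "step_base (PS \<sigma>) Y"
      unfolding step_base_def
    proof (intro conjI ballI impI)
      show "fset Y \<subseteq> primes (PS \<sigma>)" using Yd D_prime[OF d] by blast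
      fix x y assume xy: "x \<in> fset Y" "y \<in> fset Y"
      then show "(x, y) \<in> coh (PS \<sigma>)" using Yd D_coh[OF d] by blast
      assume "x \<noteq> y"
      with xy show "(x, y) \<notin> leq (PS \<sigma>)" using X(1) aX by (auto simp: Y step_base_def)
    qed
    moreover have "insert a F \<subseteq> down (PS \<sigma>) (fset Y)"
    proof
      fix f assume f: "f \<in> insert a F"
      have aY: "a \<in> fset Y" by (simp add: Y)
      show "f \<in> down (PS \<sigma>) (fset Y)"
      proof (cases "f = a")
        case True
        have "(a, a) \<in> leq (PS \<sigma>)" using ok(6) D_prime[OF d] ad by metis
        then show ?thesis using aY True unfolding down_def by blast
      next
        case False
        then obtain x where x: "x \<in> fset X" "(f, x) \<in> leq (PS \<sigma>)" using f X(3) unfolding down_def by blast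
        show ?thesis
        proof (cases "(x, a) \<in> leq (PS \<sigma>)")
          case True
          then have "(f, a) \<in> leq (PS \<sigma>)" using ok(8) x by metis
          then show ?thesis using aY unfolding down_def by blast
        next
          case False
          then have "x \<in> fset Y" using x by (simp add: Y)
          then show ?thesis using x unfolding down_def by blast
        qed
      qed
    qed
    ultimately show ?thesis using X(2) by (intro exI[of _ Y]) (auto simp: Y)
  qed
qed

text \<open>This form of continuity on \<open>D \<sigma>\<close> makes no reference to directed unions; it implies
  monotonicity.\<close>

definition cont :: "texp \<Rightarrow> (prime set \<Rightarrow> prime set) \<Rightarrow> bool" where
  "cont \<sigma> f \<longleftrightarrow> (\<forall>d\<in>D \<sigma>. \<forall>a\<in>f d. \<exists>F. finite F \<and> F \<subseteq> d \<and> (\<forall>d'\<in>D \<sigma>. F \<subseteq> d' \<longrightarrow> a \<in> f d'))"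

lemma contI:
  "(\<And>d a. d \<in> D \<sigma> \<Longrightarrow> a \<in> f d \<Longrightarrow> \<exists>F. finite F \<and> F \<subseteq> d \<and> (\<forall>d'\<in>D \<sigma>. F \<subseteq> d' \<longrightarrow> a \<in> f d')) \<Longrightarrow> cont \<sigma> f"
  by (simp add: cont_def)

lemma contE:
  "cont \<sigma> f \<Longrightarrow> d \<in> D \<sigma> \<Longrightarrow> a \<in> f d \<Longrightarrow> \<exists>F. finite F \<and> F \<subseteq> d \<and> (\<forall>d'\<in>D \<sigma>. F \<subseteq> d' \<longrightarrow> a \<in> f d')"
  by (simp add: cont_def)

lemma cont_mono:
  assumes f: "cont \<sigma> f" "d \<in> D \<sigma>" "d' \<in> D \<sigma>" "d \<subseteq> d'" shows "f d \<subseteq> f d'"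
proof
  fix a assume "a \<in> f d"
  from contE[OF f(1,2) this] obtain F where "F \<subseteq> d" "\<forall>d'\<in>D \<sigma>. F \<subseteq> d' \<longrightarrow> a \<in> f d'"
    by (elim exE conjE)
  then show "a \<in> f d'" using f(3,4) by simp
qed

lemma cont_base:
  assumes f: "cont \<sigma> f" "d \<in> D \<sigma>" "a \<in> f d"
  obtains X where "step_base (PS \<sigma>) X" "fset X \<subseteq> d" "a \<in> f (down (PS \<sigma>) (fset X))"
proof -
  from contE[OF f] obtain F where F: "finite F" "F \<subseteq> d" "\<forall>d'\<in>D \<sigma>. F \<subseteq> d' \<longrightarrow> a \<in> f d'"
    by (elim exE conjE)
  from ex_step_base[OF f(2) F(1,2)] obtain X where
    X: "step_base (PS \<sigma>) X" "fset X \<subseteq> F" "F \<subseteq> down (PS \<sigma>) (fset X)" by (elim exE conjE)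
  show ?thesis
    using that[OF X(1) subset_trans[OF X(2) F(2)]] F(3) down_base_D[OF X(1)] X(3) by simp
qed

lemma mem_Pr: "x \<in> Pr P f \<longleftrightarrow> (\<exists>X a. x = Step X a \<and> step_base P X \<and> a \<in> f (down P (fset X)))"
  by (simp add: Pr_def)

lemma Step_mem_Pr: "Step X a \<in> Pr P f \<longleftrightarrow> step_base P X \<and> a \<in> f (down P (fset X))"
  by (simp add: Pr_def)

lemma mem_fun_app: "a \<in> fun_app r d \<longleftrightarrow> (\<exists>X. fset X \<subseteq> d \<and> Step X a \<in> r)"
  by (simp add: fun_app_def)

lemma fun_app_mono: "r \<subseteq> r' \<Longrightarrow> d \<subseteq> d' \<Longrightarrow> fun_app r d \<subseteq> fun_app r' d'"
  unfolding fun_app_def by blast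

text \<open>One inclusion is monotonicity of \<open>f\<close>; for the other, a prime of
  \<open>f d\<close> already occurs at the downward closure of some base inside
  \<open>d\<close>.\<close>

lemma fun_app_Pr:
  assumes f: "cont \<sigma> f" and d: "d \<in> D \<sigma>"
  shows "fun_app (Pr (PS \<sigma>) f) d = f d"
proof
  show "fun_app (Pr (PS \<sigma>) f) d \<subseteq> f d"
  proof
    fix a assume "a \<in> fun_app (Pr (PS \<sigma>) f) d"
    then obtain X where X: "fset X \<subseteq> d" "step_base (PS \<sigma>) X" "a \<in> f (down (PS \<sigma>) (fset X))"
      by (auto simp: mem_fun_app Step_mem_Pr)
    show "a \<in> f d" using cont_mono[OF f down_base_D[OF X(2)] d down_subset[OF d X(1)]] X(3) by blast
  qed
  show "f d \<subseteq> fun_app (Pr (PS \<sigma>) f) d"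
  proof
    fix a assume "a \<in> f d"
    from cont_base[OF f d this] obtain X where
      "step_base (PS \<sigma>) X" "fset X \<subseteq> d" "a \<in> f (down (PS \<sigma>) (fset X))" .
    then show "a \<in> fun_app (Pr (PS \<sigma>) f) d" by (auto simp: mem_fun_app Step_mem_Pr)
  qed
qed

lemma PS_Arr: "PS (Bin Arr \<sigma> \<tau>) = fun_psys (PS \<sigma>) (PS \<tau>)"
  and PS_Sum: "PS (Bin Sum \<sigma> \<tau>) = sum_psys (PS \<sigma>) (PS \<tau>)"
  and PS_Prod: "PS (Bin Prod \<sigma> \<tau>) = prod_psys (PS \<sigma>) (PS \<tau>)"
  by (simp_all add: PS_Bin)

lemma Pr_D:
  assumes f: "cont \<sigma> f" and v: "\<And>d. d \<in> D \<sigma> \<Longrightarrow> f d \<in> D \<tau>"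
  shows "Pr (PS \<sigma>) f \<in> D (Bin Arr \<sigma> \<tau>)"
proof (rule D_I)
  fix x assume "x \<in> Pr (PS \<sigma>) f"
  then obtain X a where x: "x = Step X a" "step_base (PS \<sigma>) X" "a \<in> f (down (PS \<sigma>) (fset X))"
    by (auto simp: mem_Pr)
  have pa: "a \<in> primes (PS \<tau>)" using D_prime[OF v[OF down_base_D[OF x(2)]] x(3)] .
  then show px: "x \<in> primes (PS (Bin Arr \<sigma> \<tau>))" using x by (simp add: PS_Arr fun_psys_primes)
  {
    fix y assume "y \<in> Pr (PS \<sigma>) f"
    then obtain Y b where y: "y = Step Y b" "step_base (PS \<sigma>) Y" "b \<in> f (down (PS \<sigma>) (fset Y))"
      by (auto simp: mem_Pr)
    have pb: "b \<in> primes (PS \<tau>)" using D_prime[OF v[OF down_base_D[OF y(2)]] y(3)] .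
    have "(a, b) \<in> coh (PS \<tau>)" if XY: "\<forall>x\<in>fset X. \<forall>y\<in>fset Y. (x, y) \<in> coh (PS \<sigma>)"
    proof -
      \<comment> \<open>Bases that are consistent with each other generate a common element; its
        image under \<open>f\<close> contains \<open>a\<close> and \<open>b\<close>, which are
        therefore consistent.\<close>
      let ?Z = "down (PS \<sigma>) (fset X \<union> fset Y)"
      have Z: "?Z \<in> D \<sigma>"
      proof (rule down_D)
        fix u assume u: "u \<in> fset X \<union> fset Y"
        then show "u \<in> primes (PS \<sigma>)" using x(2) y(2) by (auto simp: step_base_def)
        fix w assume "w \<in> fset X \<union> fset Y"
        with u show "(u, w) \<in> coh (PS \<sigma>)" using x(2) y(2) XY psys_okD(7)[OF psys_ok_PS]
          unfolding step_base_def by (metis Un_iff)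
      qed
      have "down (PS \<sigma>) (fset X) \<subseteq> ?Z" "down (PS \<sigma>) (fset Y) \<subseteq> ?Z" by (auto simp: down_def)
      then have "a \<in> f ?Z" "b \<in> f ?Z"
        using cont_mono[OF f down_base_D Z] x y by blast+
      then show ?thesis using D_coh[OF v[OF Z]] by blast
    qed
    then show "(x, y) \<in> coh (PS (Bin Arr \<sigma> \<tau>))"
      using x y pa pb by (simp add: PS_Arr fun_psys_coh fun_psys_primes)
  }
  fix y assume yx: "(y, x) \<in> leq (PS (Bin Arr \<sigma> \<tau>))"
  then obtain Y b where y: "y = Step Y b" "step_base (PS \<sigma>) Y" "fset X \<subseteq> down (PS \<sigma>) (fset Y)"
    "(b, a) \<in> leq (PS \<tau>)"
    using x by (auto simp: PS_Arr fun_psys_leq fun_psys_primes)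
  have Y: "down (PS \<sigma>) (fset Y) \<in> D \<sigma>" using y(2) by (rule down_base_D)
  have "a \<in> f (down (PS \<sigma>) (fset Y))"
    using cont_mono[OF f down_base_D[OF x(2)] Y down_subset[OF Y y(3)]] x(3) by blast
  then have "b \<in> f (down (PS \<sigma>) (fset Y))" using D_down[OF v[OF Y] _ y(4)] by blast
  then show "y \<in> Pr (PS \<sigma>) f" using y by (simp add: Step_mem_Pr)
qed

lemma Step_leq_PS:
  "(Step X a, Step Y b) \<in> leq (PS (Bin Arr \<sigma> \<tau>)) \<longleftrightarrow> step_base (PS \<sigma>) X \<and> step_base (PS \<sigma>) Y
    \<and> fset Y \<subseteq> down (PS \<sigma>) (fset X) \<and> (a, b) \<in> leq (PS \<tau>)"
  using psys_okD(3,4)[OF psys_ok_PS, of a b \<tau>]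
  by (auto simp: PS_Arr fun_psys_leq fun_psys_primes)

lemma Step_prime_PS:
  "Step X a \<in> primes (PS (Bin Arr \<sigma> \<tau>)) \<longleftrightarrow> step_base (PS \<sigma>) X \<and> a \<in> primes (PS \<tau>)"
  by (simp add: PS_Arr fun_psys_primes)

lemma fun_app_D:
  assumes r: "r \<in> D (Bin Arr \<sigma> \<tau>)" and d: "d \<in> D \<sigma>"
  shows "fun_app r d \<in> D \<tau>"
proof (rule D_I)
  fix a assume "a \<in> fun_app r d"
  then obtain X where X: "fset X \<subseteq> d" "Step X a \<in> r" unfolding mem_fun_app by (elim exE conjE)
  have p: "step_base (PS \<sigma>) X" "a \<in> primes (PS \<tau>)" using D_prime[OF r X(2)] by (simp_all add: Step_prime_PS)
  show "a \<in> primes (PS \<tau>)" by (rule p(2))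
  {
    fix b assume "b \<in> fun_app r d"
    then obtain Y where Y: "fset Y \<subseteq> d" "Step Y b \<in> r" unfolding mem_fun_app by (elim exE conjE)
    have "\<forall>x\<in>fset X. \<forall>y\<in>fset Y. (x, y) \<in> coh (PS \<sigma>)"
      using X(1) Y(1) D_coh[OF d] by blast
    then show "(a, b) \<in> coh (PS \<tau>)"
      using D_coh[OF r X(2) Y(2)] by (simp add: PS_Arr fun_psys_coh)
  }
  fix b assume "(b, a) \<in> leq (PS \<tau>)"
  then have "(Step X b, Step X a) \<in> leq (PS (Bin Arr \<sigma> \<tau>))"
    using p base_subset_down[OF p(1)] by (simp add: Step_leq_PS)
  then have "Step X b \<in> r" using D_down[OF r X(2)] by blast
  then show "b \<in> fun_app r d" using X(1) unfolding mem_fun_app by (intro exI conjI)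
qed

lemma Pr_cong: "(\<And>d. d \<in> D \<sigma> \<Longrightarrow> f d = g d) \<Longrightarrow> Pr (PS \<sigma>) f = Pr (PS \<sigma>) g"
  using down_base_D by (fastforce simp: Pr_def)

text \<open>A prime of \<open>Pr (PS \<tau>) (f d)\<close> fixes the base at which the inner
  function is evaluated. Currying therefore reduces to continuity in the outer argument for each
  fixed inner one.\<close>

lemma cont_Pr:
  assumes "\<And>e. e \<in> D \<tau> \<Longrightarrow> cont \<sigma> (\<lambda>d. f d e)"
  shows "cont \<sigma> (\<lambda>d. Pr (PS \<tau>) (f d))"
proof (rule contI)
  fix d a assume d: "d \<in> D \<sigma>" and "a \<in> Pr (PS \<tau>) (f d)"
  then obtain X b where a: "a = Step X b" "step_base (PS \<tau>) X" "b \<in> f d (down (PS \<tau>) (fset X))"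
    by (auto simp: mem_Pr)
  from contE[OF assms[OF down_base_D[OF a(2)]] d a(3)] obtain F where
    "finite F" "F \<subseteq> d" "\<forall>d'\<in>D \<sigma>. F \<subseteq> d' \<longrightarrow> b \<in> f d' (down (PS \<tau>) (fset X))"
    by (elim exE conjE)
  then show "\<exists>F. finite F \<and> F \<subseteq> d \<and> (\<forall>d'\<in>D \<sigma>. F \<subseteq> d' \<longrightarrow> a \<in> Pr (PS \<tau>) (f d'))"
    using a by (intro exI[of _ F]) (simp add: Step_mem_Pr)
qed

section \<open>Semantics of the constants\<close>

definition proj :: "bool \<Rightarrow> prime set \<Rightarrow> prime set" where
  "proj i d = {a. Inj i a \<in> d}"

text \<open>A formula without description operator or case distinction. It agrees with
  \<open>case_sem\<close> on elements of a sum, and since the three sets occur only positively in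
  it, continuity in each of them can be read off.\<close>

definition casef :: "prime set \<Rightarrow> prime set \<Rightarrow> prime set \<Rightarrow> prime set" where
  "casef d f g = {b. Tag False \<in> d \<and> b \<in> fun_app f (proj False d) \<or> Tag True \<in> d \<and> b \<in> fun_app g (proj True d)}"

text \<open>On elements of a sum the first disjunct contributes something new only when no tag is
  present; it then gives the intersection, the value of the parallel conditional at bottom.\<close>

definition pcasef :: "prime set \<Rightarrow> prime set \<Rightarrow> prime set \<Rightarrow> prime set" where
  "pcasef a b c = {x. x \<in> b \<and> x \<in> c \<or> Tag False \<in> a \<and> x \<in> b \<or> Tag True \<in> a \<and> x \<in> c}"

lemma mem_inj_sem [simp]: "x \<in> inj_sem i d \<longleftrightarrow> x = Tag i \<or> (\<exists>a\<in>d. x = Inj i a)"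
  by (auto simp: inj_sem_def)

lemma mem_pair_sem: "x \<in> pair_sem d e \<longleftrightarrow> (\<exists>a\<in>d. x = Inj False a) \<or> (\<exists>a\<in>e. x = Inj True a)"
  by (auto simp: pair_sem_def)

lemma proj_inj_sem [simp]: "proj i (inj_sem i d) = d"
  by (auto simp: proj_def)

lemma proj_pair_sem [simp]: "proj False (pair_sem d e) = d" "proj True (pair_sem d e) = e"
  by (auto simp: proj_def mem_pair_sem)

text \<open>The tag is the least prime of its block, hence present as soon as any prime of the block
  is.\<close>

lemma D_Sum_Tag:
  assumes d: "d \<in> D (Bin Sum \<sigma> \<tau>)" and x: "x \<in> d"
  shows "\<exists>i. Tag i \<in> d \<and> (x = Tag i \<or> (\<exists>a. x = Inj i a))"
proof -
  from D_prime[OF d x] obtain i where i: "x = Tag i \<or> (\<exists>a\<in>primes (sel (PS \<sigma>) (PS \<tau>) i). x = Inj i a)"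
    unfolding PS_Sum sum_psys_primes by (elim exE)
  then have "(Tag i, x) \<in> leq (PS (Bin Sum \<sigma> \<tau>))" unfolding PS_Sum sum_psys_leq by blast
  then have "Tag i \<in> d" by (rule D_down[OF d x])
  then show ?thesis using i by blast
qed

lemma D_Sum_Tag_unique:
  assumes d: "d \<in> D (Bin Sum \<sigma> \<tau>)" and "Tag i \<in> d" "Tag j \<in> d"
  shows "i = j"
  using D_coh[OF d assms(2,3)] unfolding PS_Sum sum_psys_coh by auto

lemma D_Sum_cases:
  assumes d: "d \<in> D (Bin Sum \<sigma> \<tau>)"
  obtains "d = {}" | i where "d = inj_sem i (proj i d)"
proof (cases "d = {}")
  case False
  then obtain i where i: "Tag i \<in> d" using D_Sum_Tag[OF d] by blast
  have "d = inj_sem i (proj i d)"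
  proof
    show "d \<subseteq> inj_sem i (proj i d)"
    proof
      fix x assume x: "x \<in> d"
      from D_Sum_Tag[OF d x] obtain j where j: "Tag j \<in> d" "x = Tag j \<or> (\<exists>a. x = Inj j a)"
        by (elim exE conjE)
      have "j = i" by (rule D_Sum_Tag_unique[OF d j(1) i])
      then show "x \<in> inj_sem i (proj i d)" using j(2) x by (auto simp: proj_def)
    qed
    show "inj_sem i (proj i d) \<subseteq> d" using i by (auto simp: proj_def)
  qed
  then show ?thesis using that(2) by blast
qed (use that in blast)

lemma inj_sem_inject: "inj_sem i d = inj_sem j e \<longleftrightarrow> i = j \<and> d = e"
proof
  assume eq: "inj_sem i d = inj_sem j e"
  then have "Tag i \<in> inj_sem j e" using mem_inj_sem[of "Tag i" i d] by simp
  then have "i = j" by simp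
  moreover have "d = e" using arg_cong[OF eq, of "proj i"] unfolding \<open>i = j\<close> proj_inj_sem .
  ultimately show "i = j \<and> d = e" by simp
qed simp

lemma case_sem_eq:
  assumes d: "d \<in> D (Bin Sum \<sigma> \<tau>)"
  shows "case_sem d f g = casef d f g"
proof (cases rule: D_Sum_cases[OF d])
  case 1
  then show ?thesis by (simp add: case_sem_def casef_def)
next
  case (2 i)
  define e where "e = proj i d"
  have d: "d = inj_sem i e" using 2 by (simp add: e_def)
  have "d \<noteq> {}" unfolding d by (auto simp: inj_sem_def)
  then show ?thesis
    by (cases i) (auto simp: case_sem_def casef_def d inj_sem_inject)
qed

lemma pcase_sem_eq:
  assumes d: "d \<in> D (Bin Sum \<sigma> \<tau>)"
  shows "pcase_sem d b c = pcasef d b c"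
proof (cases rule: D_Sum_cases[OF d])
  case 1
  then show ?thesis by (auto simp: pcase_sem_def pcasef_def)
next
  case (2 i)
  define e where "e = proj i d"
  have d: "d = inj_sem i e" using 2 by (simp add: e_def)
  have "d \<noteq> {}" unfolding d by (auto simp: inj_sem_def)
  then show ?thesis
    by (cases i) (auto simp: pcase_sem_def pcasef_def d inj_sem_inject)
qed

lemma D_Prod_pair:
  assumes d: "d \<in> D (Bin Prod \<sigma> \<tau>)" shows "d = pair_sem (proj False d) (proj True d)"
proof -
  have "\<exists>i a. x = Inj i a" if "x \<in> d" for x
    using D_prime[OF d that] unfolding PS_Prod prod_psys_primes by blast
  then have "x \<in> d \<longleftrightarrow> x \<in> pair_sem (proj False d) (proj True d)" for x
    by (simp add: mem_pair_sem proj_def) (metis (full_types))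
  then show ?thesis by blast
qed

lemma fst_sem_pair: "fst_sem (pair_sem d e) = d"
  unfolding fst_sem_def by (rule the_equality) (metis proj_pair_sem)+

lemma snd_sem_pair: "snd_sem (pair_sem d e) = e"
  unfolding snd_sem_def by (rule the_equality) (metis proj_pair_sem)+

lemma fst_sem_eq: "d \<in> D (Bin Prod \<sigma> \<tau>) \<Longrightarrow> fst_sem d = proj False d"
  by (metis D_Prod_pair fst_sem_pair)

lemma snd_sem_eq: "d \<in> D (Bin Prod \<sigma> \<tau>) \<Longrightarrow> snd_sem d = proj True d"
  by (metis D_Prod_pair snd_sem_pair)

section \<open>Continuity of the operations\<close>

lemma cont_inj_sem: "cont \<sigma> (inj_sem i)"
proof (rule contI)
  fix d x assume "x \<in> inj_sem i d"
  then show "\<exists>F. finite F \<and> F \<subseteq> d \<and> (\<forall>d'\<in>D \<sigma>. F \<subseteq> d' \<longrightarrow> x \<in> inj_sem i d')"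
    \<comment> \<open>The set has at most one member and is empty if \<open>x\<close> is the tag. In
      that case the singleton that bounds it has an unspecified member, and the bound still
      holds.\<close>
    by (intro exI[of _ "{a \<in> d. x = Inj i a}"] conjI) (auto intro: finite_subset[of _ "{case x of Inj _ a \<Rightarrow> a}"])
qed

lemma cont_proj: "cont \<sigma> (proj i)"
proof (rule contI)
  fix d x assume "x \<in> proj i d"
  then show "\<exists>F. finite F \<and> F \<subseteq> d \<and> (\<forall>d'\<in>D \<sigma>. F \<subseteq> d' \<longrightarrow> x \<in> proj i d')"
    by (intro exI[of _ "{Inj i x}"]) (auto simp: proj_def)
qed

lemma cont_pair1: "cont \<sigma> (\<lambda>d. pair_sem d e)"
proof (rule contI)
  fix d x assume "x \<in> pair_sem d e"
  then show "\<exists>F. finite F \<and> F \<subseteq> d \<and> (\<forall>d'\<in>D \<sigma>. F \<subseteq> d' \<longrightarrow> x \<in> pair_sem d' e)"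
    by (intro exI[of _ "{a \<in> d. x = Inj False a}"] conjI)
      (auto simp: mem_pair_sem intro: finite_subset[of _ "{case x of Inj _ a \<Rightarrow> a}"])
qed

lemma cont_pair2: "cont \<sigma> (\<lambda>e. pair_sem d e)"
proof (rule contI)
  fix e x assume "x \<in> pair_sem d e"
  then show "\<exists>F. finite F \<and> F \<subseteq> e \<and> (\<forall>d'\<in>D \<sigma>. F \<subseteq> d' \<longrightarrow> x \<in> pair_sem d d')"
    by (intro exI[of _ "{a \<in> e. x = Inj True a}"] conjI)
      (auto simp: mem_pair_sem intro: finite_subset[of _ "{case x of Inj _ a \<Rightarrow> a}"])
qed

lemma casef_E:
  assumes "b \<in> casef d f g"
  obtains X where "Tag False \<in> d" "Inj False ` fset X \<subseteq> d" "Step X b \<in> f"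
  | X where "Tag True \<in> d" "Inj True ` fset X \<subseteq> d" "Step X b \<in> g"
  using assms unfolding casef_def mem_fun_app proj_def by blast

lemma casef_I:
  "Tag False \<in> d \<Longrightarrow> Inj False ` fset X \<subseteq> d \<Longrightarrow> Step X b \<in> f \<Longrightarrow> b \<in> casef d f g"
  "Tag True \<in> d \<Longrightarrow> Inj True ` fset X \<subseteq> d \<Longrightarrow> Step X b \<in> g \<Longrightarrow> b \<in> casef d f g"
  unfolding casef_def mem_fun_app proj_def by blast+

lemma cont_casef1: "cont \<sigma> (\<lambda>d. casef d f g)"
proof (rule contI)
  fix d b assume "b \<in> casef d f g"
  then show "\<exists>F. finite F \<and> F \<subseteq> d \<and> (\<forall>d'\<in>D \<sigma>. F \<subseteq> d' \<longrightarrow> b \<in> casef d' f g)"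
  proof (cases rule: casef_E)
    case (1 X)
    then show ?thesis by (intro exI[of _ "insert (Tag False) (Inj False ` fset X)"]) (auto intro: casef_I)
  next
    case (2 X)
    then show ?thesis by (intro exI[of _ "insert (Tag True) (Inj True ` fset X)"]) (auto intro: casef_I)
  qed
qed

lemma cont_casef2: "cont \<sigma> (\<lambda>f. casef d f g)"
proof (rule contI)
  fix f b assume "b \<in> casef d f g"
  then show "\<exists>F. finite F \<and> F \<subseteq> f \<and> (\<forall>d'\<in>D \<sigma>. F \<subseteq> d' \<longrightarrow> b \<in> casef d d' g)"
  proof (cases rule: casef_E)
    case (1 X)
    then show ?thesis by (intro exI[of _ "{Step X b}"]) (auto intro: casef_I)
  next
    case (2 X)
    then show ?thesis by (intro exI[of _ "{}"]) (auto intro: casef_I)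
  qed
qed

lemma cont_casef3: "cont \<sigma> (\<lambda>g. casef d f g)"
proof (rule contI)
  fix g b assume "b \<in> casef d f g"
  then show "\<exists>F. finite F \<and> F \<subseteq> g \<and> (\<forall>d'\<in>D \<sigma>. F \<subseteq> d' \<longrightarrow> b \<in> casef d f d')"
  proof (cases rule: casef_E)
    case (1 X)
    then show ?thesis by (intro exI[of _ "{}"]) (auto intro: casef_I)
  next
    case (2 X)
    then show ?thesis by (intro exI[of _ "{Step X b}"]) (auto intro: casef_I)
  qed
qed

lemma cont_pcasef1: "cont \<sigma> (\<lambda>a. pcasef a b c)"
proof (rule contI)
  fix d x assume "x \<in> pcasef d b c"
  then show "\<exists>F. finite F \<and> F \<subseteq> d \<and> (\<forall>d'\<in>D \<sigma>. F \<subseteq> d' \<longrightarrow> x \<in> pcasef d' b c)"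
    by (intro exI[of _ "d \<inter> {Tag False, Tag True}"]) (auto simp: pcasef_def)
qed

lemma cont_pcasef2: "cont \<sigma> (\<lambda>b. pcasef a b c)"
proof (rule contI)
  fix d x assume "x \<in> pcasef a d c"
  then show "\<exists>F. finite F \<and> F \<subseteq> d \<and> (\<forall>d'\<in>D \<sigma>. F \<subseteq> d' \<longrightarrow> x \<in> pcasef a d' c)"
    by (intro exI[of _ "d \<inter> {x}"]) (auto simp: pcasef_def)
qed

lemma cont_pcasef3: "cont \<sigma> (\<lambda>c. pcasef a b c)"
proof (rule contI)
  fix d x assume "x \<in> pcasef a b d"
  then show "\<exists>F. finite F \<and> F \<subseteq> d \<and> (\<forall>d'\<in>D \<sigma>. F \<subseteq> d' \<longrightarrow> x \<in> pcasef a b d')"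
    by (intro exI[of _ "d \<inter> {x}"]) (auto simp: pcasef_def)
qed

section \<open>The operations map elements to elements\<close>

lemma inj_sem_D:
  assumes d: "d \<in> D (sel \<sigma> \<tau> i)" shows "inj_sem i d \<in> D (Bin Sum \<sigma> \<tau>)"
proof (rule D_I)
  have s: "sel (PS \<sigma>) (PS \<tau>) i = PS (sel \<sigma> \<tau> i)" by (cases i) simp_all
  fix x assume x: "x \<in> inj_sem i d"
  show px: "x \<in> primes (PS (Bin Sum \<sigma> \<tau>))"
    unfolding PS_Sum sum_psys_primes using x D_prime[OF d]
    by (intro exI[of _ i]) (auto simp: s)
  {
    fix y assume y: "y \<in> inj_sem i d"
    then have py: "y \<in> primes (PS (Bin Sum \<sigma> \<tau>))"
      unfolding PS_Sum sum_psys_primes using D_prime[OF d]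
      by (intro exI[of _ i]) (auto simp: s)
    show "(x, y) \<in> coh (PS (Bin Sum \<sigma> \<tau>))"
      using px py unfolding PS_Sum sum_psys_coh
      by (intro conjI exI[of _ i]) (use x y D_coh[OF d] in \<open>auto simp: s\<close>)
  }
  fix y assume y: "(y, x) \<in> leq (PS (Bin Sum \<sigma> \<tau>))"
  show "y \<in> inj_sem i d"
    using y[unfolded PS_Sum sum_psys_leq]
  proof (elim disjE exE conjE)
    fix j a b assume "y = Inj j a" "x = Inj j b" "(a, b) \<in> leq (sel (PS \<sigma>) (PS \<tau>) j)"
    moreover from this x have "j = i" "b \<in> d" by auto
    ultimately show ?thesis using D_down[OF d] s by auto
  qed (use x in auto)
qed

lemma pair_sem_D:
  assumes d: "d \<in> D \<sigma>" and e: "e \<in> D \<tau>" shows "pair_sem d e \<in> D (Bin Prod \<sigma> \<tau>)"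
proof (rule D_I)
  fix x assume x: "x \<in> pair_sem d e"
  then obtain i a where xi: "x = Inj i a" "a \<in> sel d e i"
    by (auto simp: mem_pair_sem) (metis sel_simps)+
  have de: "sel d e i \<in> D (sel \<sigma> \<tau> i)" for i using d e by (cases i) simp_all
  have s: "sel (PS \<sigma>) (PS \<tau>) i = PS (sel \<sigma> \<tau> i)" for i by (cases i) simp_all
  note pa = D_prime[OF de xi(2)]
  then show "x \<in> primes (PS (Bin Prod \<sigma> \<tau>))"
    unfolding PS_Prod prod_psys_primes s using xi by blast
  {
    fix y assume "y \<in> pair_sem d e"
    then obtain j b where yj: "y = Inj j b" "b \<in> sel d e j"
      by (auto simp: mem_pair_sem) (metis sel_simps)+
    have "i \<noteq> j \<or> (a, b) \<in> coh (PS (sel \<sigma> \<tau> i))" using D_coh[OF de xi(2)] yj by blast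
    then show "(x, y) \<in> coh (PS (Bin Prod \<sigma> \<tau>))"
      unfolding PS_Prod prod_psys_coh s using xi(1) yj(1) pa D_prime[OF de yj(2)] by blast
  }
  fix y assume "(y, x) \<in> leq (PS (Bin Prod \<sigma> \<tau>))"
  then obtain b where y: "y = Inj i b" "(b, a) \<in> leq (PS (sel \<sigma> \<tau> i))"
    unfolding PS_Prod prod_psys_leq s using xi(1) by blast
  then have "b \<in> sel d e i" using D_down[OF de xi(2)] by blast
  then show "y \<in> pair_sem d e" using y(1) by (cases i) (auto simp: mem_pair_sem)
qed

lemma proj_Sum_D:
  assumes d: "d \<in> D (Bin Sum \<sigma> \<tau>)" shows "proj i d \<in> D (sel \<sigma> \<tau> i)"
proof (rule D_I)
  have s: "sel (PS \<sigma>) (PS \<tau>) i = PS (sel \<sigma> \<tau> i)" by (cases i) simp_all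
  fix a assume "a \<in> proj i d"
  then have a: "Inj i a \<in> d" by (simp add: proj_def)
  from D_prime[OF d a] show "a \<in> primes (PS (sel \<sigma> \<tau> i))"
    unfolding PS_Sum sum_psys_primes s[symmetric] by auto
  {
    fix b assume "b \<in> proj i d"
    then have b: "Inj i b \<in> d" by (simp add: proj_def)
    from D_coh[OF d a b] show "(a, b) \<in> coh (PS (sel \<sigma> \<tau> i))"
      unfolding PS_Sum sum_psys_coh s[symmetric] by auto
  }
  fix b assume "(b, a) \<in> leq (PS (sel \<sigma> \<tau> i))"
  then have "(Inj i b, Inj i a) \<in> leq (PS (Bin Sum \<sigma> \<tau>))"
    unfolding PS_Sum sum_psys_leq s[symmetric] by blast
  then show "b \<in> proj i d" using D_down[OF d a] by (simp add: proj_def)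
qed

lemma proj_Prod_D:
  assumes d: "d \<in> D (Bin Prod \<sigma> \<tau>)" shows "proj i d \<in> D (sel \<sigma> \<tau> i)"
proof (rule D_I)
  have s: "sel (PS \<sigma>) (PS \<tau>) i = PS (sel \<sigma> \<tau> i)" by (cases i) simp_all
  fix a assume "a \<in> proj i d"
  then have a: "Inj i a \<in> d" by (simp add: proj_def)
  from D_prime[OF d a] show "a \<in> primes (PS (sel \<sigma> \<tau> i))"
    unfolding PS_Prod prod_psys_primes s[symmetric] by auto
  {
    fix b assume "b \<in> proj i d"
    then have b: "Inj i b \<in> d" by (simp add: proj_def)
    from D_coh[OF d a b] show "(a, b) \<in> coh (PS (sel \<sigma> \<tau> i))"
      unfolding PS_Prod prod_psys_coh s[symmetric] by auto
  }
  fix b assume "(b, a) \<in> leq (PS (sel \<sigma> \<tau> i))"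
  then have "(Inj i b, Inj i a) \<in> leq (PS (Bin Prod \<sigma> \<tau>))"
    unfolding PS_Prod prod_psys_leq s[symmetric] by blast
  then show "b \<in> proj i d" using D_down[OF d a] by (simp add: proj_def)
qed

lemma casef_D:
  assumes d: "d \<in> D (Bin Sum \<sigma> \<tau>)" and f: "f \<in> D (Bin Arr \<sigma> \<rho>)" and g: "g \<in> D (Bin Arr \<tau> \<rho>)"
  shows "casef d f g \<in> D \<rho>"
proof (cases rule: D_Sum_cases[OF d])
  case 1
  then show ?thesis by (simp add: casef_def D_empty)
next
  case (2 i)
  have t: "Tag j \<in> d \<longleftrightarrow> j = i" for j by (subst 2) auto
  show ?thesis
    using fun_app_D[OF f, of "proj False d"] fun_app_D[OF g, of "proj True d"]
      proj_Sum_D[OF d, of False] proj_Sum_D[OF d, of True]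
    by (cases i) (simp_all add: casef_def t)
qed

lemma Int_D: "d \<in> D \<sigma> \<Longrightarrow> e \<in> D \<sigma> \<Longrightarrow> d \<inter> e \<in> D \<sigma>"
  by (rule D_I) (use D_prime D_coh D_down in \<open>blast+\<close>)

lemma pcasef_D:
  assumes d: "d \<in> D (Bin Sum \<sigma> \<tau>)" and f: "f \<in> D \<rho>" and g: "g \<in> D \<rho>"
  shows "pcasef d f g \<in> D \<rho>"
proof (cases rule: D_Sum_cases[OF d])
  case 1
  then have "pcasef d f g = f \<inter> g" by (auto simp: pcasef_def)
  then show ?thesis using Int_D[OF f g] by simp
next
  case (2 i)
  have t: "Tag j \<in> d \<longleftrightarrow> j = i" for j by (subst 2) auto
  have "pcasef d f g = (if i then g else f)" unfolding pcasef_def t by auto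
  then show ?thesis using f g by simp
qed

section \<open>The constants as elements of their domains, and their application\<close>

lemma csem_Case: "csem (Case \<sigma> \<tau> \<rho>) = Pr (PS (Bin Sum \<sigma> \<tau>)) (\<lambda>d. Pr (PS (Bin Arr \<sigma> \<rho>)) (\<lambda>f.
     Pr (PS (Bin Arr \<tau> \<rho>)) (\<lambda>g. casef d f g)))"
  unfolding csem.simps by (intro Pr_cong) (simp add: case_sem_eq)

lemma csem_PCase: "csem (PCase \<sigma> \<tau> \<rho>) = Pr (PS (Bin Sum \<sigma> \<tau>)) (\<lambda>a. Pr (PS \<rho>) (\<lambda>b.
     Pr (PS \<rho>) (\<lambda>c. pcasef a b c)))"
  unfolding csem.simps by (intro Pr_cong) (simp add: pcase_sem_eq)

lemma csem_Fst: "csem (Fst \<sigma> \<tau>) = Pr (PS (Bin Prod \<sigma> \<tau>)) (proj False)"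
  unfolding csem.simps by (intro Pr_cong) (simp add: fst_sem_eq)

lemma csem_Snd: "csem (Snd \<sigma> \<tau>) = Pr (PS (Bin Prod \<sigma> \<tau>)) (proj True)"
  unfolding csem.simps by (intro Pr_cong) (simp add: snd_sem_eq)

lemma csem_D: "csem c \<in> D (ctype c)"
proof (cases c)
  case (In0 \<sigma> \<tau>)
  then show ?thesis using inj_sem_D[of _ \<sigma> \<tau> False] by (auto intro!: Pr_D cont_inj_sem)
next
  case (In1 \<sigma> \<tau>)
  then show ?thesis using inj_sem_D[of _ \<sigma> \<tau> True] by (auto intro!: Pr_D cont_inj_sem)
next
  case (Case \<sigma> \<tau> \<rho>)
  show ?thesis unfolding Case csem_Case ctype.simps
    by (intro Pr_D cont_Pr cont_casef1 cont_casef2 cont_casef3 casef_D)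
next
  case (PCase \<sigma> \<tau> \<rho>)
  show ?thesis unfolding PCase csem_PCase ctype.simps
    by (intro Pr_D cont_Pr cont_pcasef1 cont_pcasef2 cont_pcasef3 pcasef_D)
next
  case (Pair \<sigma> \<tau>)
  show ?thesis unfolding Pair csem.simps ctype.simps
    by (intro Pr_D cont_Pr cont_pair1 cont_pair2 pair_sem_D)
next
  case (Fst \<sigma> \<tau>)
  then show ?thesis unfolding Fst csem_Fst ctype.simps using proj_Prod_D[of _ \<sigma> \<tau> False]
    by (auto intro!: Pr_D cont_proj)
next
  case (Snd \<sigma> \<tau>)
  then show ?thesis unfolding Snd csem_Snd ctype.simps using proj_Prod_D[of _ \<sigma> \<tau> True]
    by (auto intro!: Pr_D cont_proj)
next
  case (Omega \<sigma>)
  then show ?thesis by (simp add: D_empty)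
qed

lemma app_In0: "d \<in> D \<sigma> \<Longrightarrow> fun_app (csem (In0 \<sigma> \<tau>)) d = inj_sem False d"
  and app_In1: "e \<in> D \<tau> \<Longrightarrow> fun_app (csem (In1 \<sigma> \<tau>)) e = inj_sem True e"
  by (simp_all add: fun_app_Pr cont_inj_sem)

lemma app_Case:
  "d \<in> D (Bin Sum \<sigma> \<tau>) \<Longrightarrow> f \<in> D (Bin Arr \<sigma> \<rho>) \<Longrightarrow> g \<in> D (Bin Arr \<tau> \<rho>) \<Longrightarrow>
    fun_app (fun_app (fun_app (csem (Case \<sigma> \<tau> \<rho>)) d) f) g = casef d f g"
  unfolding csem_Case
  by (simp add: fun_app_Pr cont_Pr cont_casef1 cont_casef2 cont_casef3)

lemma app_PCase:
  "d \<in> D (Bin Sum \<sigma> \<tau>) \<Longrightarrow> f \<in> D \<rho> \<Longrightarrow> g \<in> D \<rho> \<Longrightarrow>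
    fun_app (fun_app (fun_app (csem (PCase \<sigma> \<tau> \<rho>)) d) f) g = pcasef d f g"
  unfolding csem_PCase
  by (simp add: fun_app_Pr cont_Pr cont_pcasef1 cont_pcasef2 cont_pcasef3)

lemma app_Pair:
  "d \<in> D \<sigma> \<Longrightarrow> e \<in> D \<tau> \<Longrightarrow> fun_app (fun_app (csem (Pair \<sigma> \<tau>)) d) e = pair_sem d e"
  by (simp add: fun_app_Pr cont_Pr cont_pair1 cont_pair2)

lemma app_Fst: "d \<in> D (Bin Prod \<sigma> \<tau>) \<Longrightarrow> fun_app (csem (Fst \<sigma> \<tau>)) d = proj False d"
  and app_Snd: "d \<in> D (Bin Prod \<sigma> \<tau>) \<Longrightarrow> fun_app (csem (Snd \<sigma> \<tau>)) d = proj True d"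
  unfolding csem_Fst csem_Snd by (simp_all add: fun_app_Pr cont_proj)

text \<open>A prime that both branches yield may come from different bases \<open>Y\<close> and
  \<open>Z\<close>. A base \<open>X\<close> inside \<open>w\<close> that generates both gives a step
  prime below \<open>Step Y b\<close> and below \<open>Step Z b\<close>, hence one common to the two
  functions.\<close>

lemma pcasef_app:
  assumes y: "y \<in> D (Bin Arr \<sigma> \<tau>)" and z: "z \<in> D (Bin Arr \<sigma> \<tau>)" and w: "w \<in> D \<sigma>"
  shows "pcasef x (fun_app y w) (fun_app z w) \<subseteq> fun_app (pcasef x y z) w"
proof
  fix b assume "b \<in> pcasef x (fun_app y w) (fun_app z w)"
  then consider "b \<in> fun_app y w" "b \<in> fun_app z w" | "Tag False \<in> x" "b \<in> fun_app y w"
    | "Tag True \<in> x" "b \<in> fun_app z w" by (auto simp: pcasef_def)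
  then show "b \<in> fun_app (pcasef x y z) w"
  proof cases
    case 1
    then obtain Y Z where Y: "fset Y \<subseteq> w" "Step Y b \<in> y" and Z: "fset Z \<subseteq> w" "Step Z b \<in> z"
      by (auto simp: mem_fun_app)
    from ex_step_base[OF w, of "fset Y \<union> fset Z"] Y Z obtain X where
      X: "step_base (PS \<sigma>) X" "fset X \<subseteq> fset Y \<union> fset Z" "fset Y \<union> fset Z \<subseteq> down (PS \<sigma>) (fset X)" by auto
    have "(b, b) \<in> leq (PS \<tau>)"
      using D_prime[OF y Y(2)] psys_okD(6)[OF psys_ok_PS] by (simp add: Step_prime_PS)
    then have "(Step X b, Step Y b) \<in> leq (PS (Bin Arr \<sigma> \<tau>))" "(Step X b, Step Z b) \<in> leq (PS (Bin Arr \<sigma> \<tau>))"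
      using X D_prime[OF y Y(2)] D_prime[OF z Z(2)] by (simp_all add: Step_leq_PS Step_prime_PS)
    then have "Step X b \<in> y" "Step X b \<in> z" using D_down[OF y Y(2)] D_down[OF z Z(2)] by blast+
    moreover have "fset X \<subseteq> w" using X Y Z by blast
    ultimately show ?thesis by (auto simp: mem_fun_app pcasef_def)
  qed (auto simp: mem_fun_app pcasef_def)
qed

section \<open>Semantics of terms\<close>

lemma sem_lift: "sem \<epsilon> (\<eta>1 @ d # \<eta>2) (lift M (length \<eta>1)) = sem \<epsilon> (\<eta>1 @ \<eta>2) M"
proof (induction M arbitrary: \<eta>1)
  case (Lam \<sigma> M)
  have "sem \<epsilon> (e # \<eta>1 @ d # \<eta>2) (lift M (Suc (length \<eta>1))) = sem \<epsilon> (e # \<eta>1 @ \<eta>2) M" for e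
    using Lam[of "e # \<eta>1"] by simp
  then show ?case by simp
qed (auto simp: nth_append Suc_diff_le)

lemma sem_subst:
  "sem \<epsilon> (\<eta>1 @ \<eta>2) (subst M N (length \<eta>1)) = sem \<epsilon> (\<eta>1 @ sem \<epsilon> (\<eta>1 @ \<eta>2) N # \<eta>2) M"
proof (induction M arbitrary: \<eta>1 N)
  case (Lam \<sigma> M)
  have "sem \<epsilon> (e # \<eta>1 @ \<eta>2) (subst M (lift N 0) (Suc (length \<eta>1)))
    = sem \<epsilon> (e # \<eta>1 @ sem \<epsilon> (\<eta>1 @ \<eta>2) N # \<eta>2) M" for e
    using Lam[of "e # \<eta>1" "lift N 0"] sem_lift[of \<epsilon> "[]" e "\<eta>1 @ \<eta>2" N] by simp
  then show ?case by simp
next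
  case (BVar n)
  consider "n < length \<eta>1" | "n = length \<eta>1" | k where "n = Suc (length \<eta>1 + k)"
    using less_imp_Suc_add linorder_neqE_nat by metis
  then show ?case by cases (simp_all add: nth_append)
qed simp_all

lemma finite_compact:
  assumes "finite X" "\<And>x. x \<in> X \<Longrightarrow> \<exists>F. finite F \<and> F \<subseteq> d \<and> (\<forall>d'. F \<subseteq> d' \<longrightarrow> P d' x)"
  shows "\<exists>F. finite F \<and> F \<subseteq> d \<and> (\<forall>d'. F \<subseteq> d' \<longrightarrow> (\<forall>x\<in>X. P d' x))"
  using assms
proof (induction rule: finite_induct)
  case empty
  then show ?case by (intro exI[of _ "{}"]) simp
next
  case (insert x X)
  have "\<exists>F. finite F \<and> F \<subseteq> d \<and> (\<forall>d'. F \<subseteq> d' \<longrightarrow> (\<forall>x\<in>X. P d' x))"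
    by (rule insert.IH) (rule insert.prems, simp)
  then obtain F where
    F: "finite F" "F \<subseteq> d" "\<forall>d'. F \<subseteq> d' \<longrightarrow> (\<forall>x\<in>X. P d' x)" by (elim exE conjE)
  from insert.prems[OF insertI1] obtain G where
    G: "finite G" "G \<subseteq> d" "\<forall>d'. G \<subseteq> d' \<longrightarrow> P d' x" by (elim exE conjE)
  show ?case using F G by (intro exI[of _ "F \<union> G"]) simp
qed

text \<open>Finite support in a single entry of the list, for arbitrary sets in place of elements.
  Under a lambda the prime itself supplies the new entry, so that entry does not vary; in an
  application the finitely many premises of the prime are served by the union of their
  supports.\<close>

lemma sem_compact:
  "a \<in> sem \<epsilon> (\<eta>1 @ d # \<eta>2) M \<Longrightarrow>
    \<exists>F. finite F \<and> F \<subseteq> d \<and> (\<forall>d'. F \<subseteq> d' \<longrightarrow> a \<in> sem \<epsilon> (\<eta>1 @ d' # \<eta>2) M)"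
proof (induction M arbitrary: \<eta>1 a)
  case (FVar x \<sigma>)
  then show ?case by (intro exI[of _ "{}"]) simp
next
  case (BVar n)
  then show ?case
    by (intro exI[of _ "if n = length \<eta>1 then {a} else {}"])
      (auto simp: nth_append nth_Cons split: nat.splits)
next
  case (Con c)
  then show ?case by (intro exI[of _ "{}"]) simp
next
  case (Lam \<sigma> M)
  then obtain X b where a: "a = Step X b" "step_base (PS \<sigma>) X"
    and b: "b \<in> sem \<epsilon> ((down (PS \<sigma>) (fset X) # \<eta>1) @ d # \<eta>2) M" by (auto simp: mem_Pr)
  from Lam.IH[OF b] a show ?case by (auto simp: Step_mem_Pr)
next
  case (App M N)
  then obtain X where X: "fset X \<subseteq> sem \<epsilon> (\<eta>1 @ d # \<eta>2) N" "Step X a \<in> sem \<epsilon> (\<eta>1 @ d # \<eta>2) M"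
    by (auto simp: mem_fun_app)
  from App.IH(1)[OF X(2)] obtain F where F: "finite F" "F \<subseteq> d"
    "\<forall>d'. F \<subseteq> d' \<longrightarrow> Step X a \<in> sem \<epsilon> (\<eta>1 @ d' # \<eta>2) M" by (elim exE conjE)
  have "\<exists>F. finite F \<and> F \<subseteq> d \<and> (\<forall>d'. F \<subseteq> d' \<longrightarrow> (\<forall>x\<in>fset X. x \<in> sem \<epsilon> (\<eta>1 @ d' # \<eta>2) N))"
    using X(1) by (intro finite_compact App.IH(2)) auto
  then obtain G where "finite G" "G \<subseteq> d"
    "\<forall>d'. G \<subseteq> d' \<longrightarrow> (\<forall>x\<in>fset X. x \<in> sem \<epsilon> (\<eta>1 @ d' # \<eta>2) N)" by (elim exE conjE)
  moreover from this have "a \<in> sem \<epsilon> (\<eta>1 @ d' # \<eta>2) (App M N)" if "F \<union> G \<subseteq> d'" for d'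
    using that F(3) unfolding sem.simps mem_fun_app by (intro exI[of _ X] conjI subsetI) simp_all
  ultimately show ?case using F(1,2) by (intro exI[of _ "F \<union> G"]) simp
qed

lemma cont_sem: "cont \<sigma> (\<lambda>d. sem \<epsilon> (d # \<eta>) M)"
proof (rule contI)
  fix d a assume "a \<in> sem \<epsilon> (d # \<eta>) M"
  then show "\<exists>F. finite F \<and> F \<subseteq> d \<and> (\<forall>d'\<in>D \<sigma>. F \<subseteq> d' \<longrightarrow> a \<in> sem \<epsilon> (d' # \<eta>) M)"
    using sem_compact[of a \<epsilon> "[]" d \<eta> M] by auto
qed

lemma sem_D:
  "\<Gamma> \<turnstile> M : \<tau> \<Longrightarrow> is_env \<epsilon> \<Longrightarrow> list_all2 (\<lambda>d \<sigma>. d \<in> D \<sigma>) \<eta> \<Gamma> \<Longrightarrow> sem \<epsilon> \<eta> M \<in> D \<tau>"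
proof (induction arbitrary: \<eta> rule: typing.induct)
  case (T_FVar \<sigma> \<Gamma> x)
  then show ?case by (simp add: is_env_def)
next
  case (T_BVar n \<Gamma>)
  then show ?case by (simp add: list_all2_conv_all_nth)
next
  case (T_Con c \<Gamma>)
  then show ?case by (simp add: csem_D)
next
  case (T_Lam \<sigma> \<Gamma> M \<tau>)
  then show ?case by (auto intro!: Pr_D cont_sem)
next
  case (T_App \<Gamma> M \<sigma> \<tau> N)
  then show ?case by (auto intro: fun_app_D)
next
  case (T_Conv \<Gamma> M \<sigma> \<tau>)
  then show ?case by (simp add: D_cong)
qed


section \<open>Typing\<close>

text \<open>\<open>T_BVar\<close> returns whatever the context contains. Over contexts of closed
  types every derivable type is closed, as the conversion rule demands of its target.\<close>

definition wfctx :: "texp list \<Rightarrow> bool" where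
  "wfctx \<Gamma> \<longleftrightarrow> (\<forall>\<sigma>\<in>set \<Gamma>. is_type \<sigma>)"

lemma wfctx_simps [simp]: "wfctx []" "wfctx (\<sigma> # \<Gamma>) \<longleftrightarrow> is_type \<sigma> \<and> wfctx \<Gamma>"
  by (auto simp: wfctx_def)

lemma is_type_Bin [simp]: "is_type (Bin c \<sigma> \<tau>) \<longleftrightarrow> is_type \<sigma> \<and> is_type \<tau>"
  by (auto simp: is_type_def)

lemma is_type_ctype: "\<forall>\<sigma>\<in>cnst_types c. is_type \<sigma> \<Longrightarrow> is_type (ctype c)"
  by (cases c) auto

lemma typing_is_type: "\<Gamma> \<turnstile> M : \<tau> \<Longrightarrow> wfctx \<Gamma> \<Longrightarrow> is_type \<tau>"
  by (induction rule: typing.induct) (auto simp: is_type_ctype wfctx_def)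

section \<open>Inversion and uniqueness of typing\<close>

lemma FVar_typing: "\<Gamma> \<turnstile> FVar x \<sigma> : \<tau> \<Longrightarrow> is_type \<sigma> \<and> \<sigma> \<approx> \<tau>"
  by (induction \<Gamma> "FVar x \<sigma>" \<tau> rule: typing.induct) (auto intro: tyeq_trans)

lemma BVar_typing: "\<Gamma> \<turnstile> BVar n : \<tau> \<Longrightarrow> n < length \<Gamma> \<and> \<Gamma> ! n \<approx> \<tau>"
  by (induction \<Gamma> "BVar n" \<tau> rule: typing.induct) (auto intro: tyeq_trans)

lemma Con_typing: "\<Gamma> \<turnstile> Con c : \<tau> \<Longrightarrow> (\<forall>\<sigma>\<in>cnst_types c. is_type \<sigma>) \<and> ctype c \<approx> \<tau>"
  by (induction \<Gamma> "Con c" \<tau> rule: typing.induct) (auto intro: tyeq_trans)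

lemma Lam_typing:
  "\<Gamma> \<turnstile> Lam \<sigma> M : \<tau> \<Longrightarrow> \<exists>\<tau>'. is_type \<sigma> \<and> \<sigma> # \<Gamma> \<turnstile> M : \<tau>' \<and> Bin Arr \<sigma> \<tau>' \<approx> \<tau>"
proof (induction \<Gamma> "Lam \<sigma> M" \<tau> rule: typing.induct)
  case (T_Lam \<Gamma> \<tau>)
  then show ?case by auto
next
  case (T_Conv \<Gamma> \<tau> \<tau>')
  then obtain \<tau>'' where "is_type \<sigma> \<and> \<sigma> # \<Gamma> \<turnstile> M : \<tau>'' \<and> Bin Arr \<sigma> \<tau>'' \<approx> \<tau>" by (elim exE)
  then show ?case using tyeq_trans[OF _ T_Conv.hyps(4)] by (intro exI[of _ \<tau>'']) simp
qed

lemma App_typing: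
  "\<Gamma> \<turnstile> App M N : \<tau> \<Longrightarrow> \<exists>\<sigma> \<tau>'. \<Gamma> \<turnstile> M : Bin Arr \<sigma> \<tau>' \<and> \<Gamma> \<turnstile> N : \<sigma> \<and> \<tau>' \<approx> \<tau>"
proof (induction \<Gamma> "App M N" \<tau> rule: typing.induct)
  case (T_App \<Gamma> \<sigma> \<tau>)
  then show ?case by (intro exI[of _ \<sigma>] exI[of _ \<tau>]) simp
next
  case (T_Conv \<Gamma> \<tau> \<tau>')
  then obtain \<sigma> \<rho> where "\<Gamma> \<turnstile> M : Bin Arr \<sigma> \<rho> \<and> \<Gamma> \<turnstile> N : \<sigma> \<and> \<rho> \<approx> \<tau>" by (elim exE)
  then show ?case using tyeq_trans[OF _ T_Conv.hyps(4)] by (intro exI[of _ \<sigma>] exI[of _ \<rho>]) simp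
qed

text \<open>This relates the subscripts of the constants that meet in a redex: they may differ as
  expressions, but typing makes them equivalent.\<close>

lemma typing_unique: "\<Gamma> \<turnstile> M : \<sigma> \<Longrightarrow> \<Gamma> \<turnstile> M : \<tau> \<Longrightarrow> \<sigma> \<approx> \<tau>"
proof (induction arbitrary: \<tau> rule: typing.induct)
  case (T_FVar \<sigma> \<Gamma> x)
  then show ?case by (simp add: FVar_typing)
next
  case (T_BVar n \<Gamma>)
  then show ?case by (simp add: BVar_typing)
next
  case (T_Con c \<Gamma>)
  then show ?case by (simp add: Con_typing)
next
  case (T_Lam \<sigma> \<Gamma> M \<rho>)
  from Lam_typing[OF T_Lam.prems] obtain \<tau>' where *: "\<sigma> # \<Gamma> \<turnstile> M : \<tau>'" "Bin Arr \<sigma> \<tau>' \<approx> \<tau>" by (elim exE conjE)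
  have "Bin Arr \<sigma> \<rho> \<approx> Bin Arr \<sigma> \<tau>'" using T_Lam.IH[OF *(1)] by (simp add: tyeq_Bin)
  then show ?case using *(2) by (rule tyeq_trans)
next
  case (T_App \<Gamma> M \<sigma> \<rho> N)
  from App_typing[OF T_App.prems] obtain \<sigma>' \<tau>' where *: "\<Gamma> \<turnstile> M : Bin Arr \<sigma>' \<tau>'" "\<tau>' \<approx> \<tau>" by (elim exE conjE)
  have "\<rho> \<approx> \<tau>'" using T_App.IH(1)[OF *(1)] by (simp add: tyeq_Bin)
  then show ?case using *(2) by (rule tyeq_trans)
next
  case (T_Conv \<Gamma> M \<sigma> \<rho>)
  then show ?case using tyeq_trans tyeq_sym by metis
qed

text \<open>Inverting the application yields an argument type that is only equivalent to
  \<open>\<sigma>\<close>. Uniqueness for \<open>M\<close> closes the gap, and closedness of the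
  type of \<open>M\<close> provides the side condition of conversion.\<close>

lemma App_typing_fun:
  assumes "\<Gamma> \<turnstile> App M N : \<tau>" "\<Gamma> \<turnstile> M : Bin Arr \<sigma> \<rho>" "wfctx \<Gamma>"
  shows "\<Gamma> \<turnstile> N : \<sigma>" "\<Gamma> \<turnstile> App M N : \<rho>" "\<rho> \<approx> \<tau>"
proof -
  from App_typing[OF assms(1)] obtain \<sigma>' \<tau>' where
    *: "\<Gamma> \<turnstile> M : Bin Arr \<sigma>' \<tau>'" "\<Gamma> \<turnstile> N : \<sigma>'" "\<tau>' \<approx> \<tau>" by (elim exE conjE)
  from typing_unique[OF *(1) assms(2)] have "\<sigma>' \<approx> \<sigma>" "\<tau>' \<approx> \<rho>" by (simp_all add: tyeq_Bin)
  with typing_is_type[OF assms(2,3)] * show N: "\<Gamma> \<turnstile> N : \<sigma>" and "\<rho> \<approx> \<tau>"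
    by (auto intro: T_Conv tyeq_trans tyeq_sym)
  show "\<Gamma> \<turnstile> App M N : \<rho>" using assms(2) N by (rule T_App)
qed

lemma Con1_typing:
  assumes "\<Gamma> \<turnstile> App (Con c) x : \<tau>" "wfctx \<Gamma>" "ctype c = Bin Arr \<sigma> \<rho>"
  shows "\<Gamma> \<turnstile> x : \<sigma>" "\<Gamma> \<turnstile> App (Con c) x : \<rho>" "\<rho> \<approx> \<tau>" "\<forall>\<sigma>\<in>cnst_types c. is_type \<sigma>"
proof -
  from App_typing[OF assms(1)] Con_typing show c: "\<forall>\<sigma>\<in>cnst_types c. is_type \<sigma>" by blast
  then have "\<Gamma> \<turnstile> Con c : Bin Arr \<sigma> \<rho>" using T_Con assms(3) by metis
  from App_typing_fun[OF assms(1) this assms(2)]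
  show "\<Gamma> \<turnstile> x : \<sigma>" "\<Gamma> \<turnstile> App (Con c) x : \<rho>" "\<rho> \<approx> \<tau>" by simp_all
qed

lemma Con2_typing:
  assumes "\<Gamma> \<turnstile> App (App (Con c) x) y : \<tau>" "wfctx \<Gamma>" "ctype c = Bin Arr \<sigma> (Bin Arr \<sigma>' \<rho>)"
  shows "\<Gamma> \<turnstile> x : \<sigma>" "\<Gamma> \<turnstile> y : \<sigma>'" "\<Gamma> \<turnstile> App (App (Con c) x) y : \<rho>" "\<rho> \<approx> \<tau>"
    "\<forall>\<sigma>\<in>cnst_types c. is_type \<sigma>"
proof -
  from App_typing[OF assms(1)] obtain \<theta> where "\<Gamma> \<turnstile> App (Con c) x : \<theta>" by blast
  note * = Con1_typing[OF this assms(2,3)]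
  from * App_typing_fun[OF assms(1) *(2) assms(2)]
  show "\<Gamma> \<turnstile> x : \<sigma>" "\<Gamma> \<turnstile> y : \<sigma>'" "\<Gamma> \<turnstile> App (App (Con c) x) y : \<rho>" "\<rho> \<approx> \<tau>"
    "\<forall>\<sigma>\<in>cnst_types c. is_type \<sigma>" by simp_all
qed

lemma Con3_typing:
  assumes "\<Gamma> \<turnstile> App (App (App (Con c) x) y) z : \<tau>" "wfctx \<Gamma>"
    "ctype c = Bin Arr \<sigma> (Bin Arr \<sigma>' (Bin Arr \<sigma>'' \<rho>))"
  shows "\<Gamma> \<turnstile> x : \<sigma>" "\<Gamma> \<turnstile> y : \<sigma>'" "\<Gamma> \<turnstile> z : \<sigma>''" "\<Gamma> \<turnstile> App (App (App (Con c) x) y) z : \<rho>" "\<rho> \<approx> \<tau>"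
    "\<forall>\<sigma>\<in>cnst_types c. is_type \<sigma>"
proof -
  from App_typing[OF assms(1)] obtain \<theta> where "\<Gamma> \<turnstile> App (App (Con c) x) y : \<theta>" by blast
  note * = Con2_typing[OF this assms(2,3)]
  from * App_typing_fun[OF assms(1) *(3) assms(2)]
  show "\<Gamma> \<turnstile> x : \<sigma>" "\<Gamma> \<turnstile> y : \<sigma>'" "\<Gamma> \<turnstile> z : \<sigma>''" "\<Gamma> \<turnstile> App (App (App (Con c) x) y) z : \<rho>" "\<rho> \<approx> \<tau>"
    "\<forall>\<sigma>\<in>cnst_types c. is_type \<sigma>" by simp_all
qed

lemma In0_typing:
  assumes "\<Gamma> \<turnstile> In0' \<sigma>' \<tau>' x : Bin Sum \<sigma> \<tau>" "wfctx \<Gamma>"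
  shows "\<Gamma> \<turnstile> x : \<sigma>" "\<Gamma> \<turnstile> x : \<sigma>'" "\<sigma>' \<approx> \<sigma>" "\<tau>' \<approx> \<tau>"
proof -
  note * = Con1_typing[OF assms ctype.simps(1)]
  then show "\<Gamma> \<turnstile> x : \<sigma>'" "\<sigma>' \<approx> \<sigma>" "\<tau>' \<approx> \<tau>" by (simp_all add: tyeq_Bin)
  then show "\<Gamma> \<turnstile> x : \<sigma>" using typing_is_type[OF assms] by (auto intro: T_Conv)
qed

lemma In1_typing:
  assumes "\<Gamma> \<turnstile> In1' \<sigma>' \<tau>' x : Bin Sum \<sigma> \<tau>" "wfctx \<Gamma>"
  shows "\<Gamma> \<turnstile> x : \<tau>" "\<Gamma> \<turnstile> x : \<tau>'" "\<sigma>' \<approx> \<sigma>" "\<tau>' \<approx> \<tau>"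
proof -
  note * = Con1_typing[OF assms ctype.simps(2)]
  then show "\<Gamma> \<turnstile> x : \<tau>'" "\<sigma>' \<approx> \<sigma>" "\<tau>' \<approx> \<tau>" by (simp_all add: tyeq_Bin)
  then show "\<Gamma> \<turnstile> x : \<tau>" using typing_is_type[OF assms] by (auto intro: T_Conv)
qed

lemma Pair_typing:
  assumes "\<Gamma> \<turnstile> Pair' \<sigma>' \<tau>' x y : Bin Prod \<sigma> \<tau>" "wfctx \<Gamma>"
  shows "\<Gamma> \<turnstile> x : \<sigma>" "\<Gamma> \<turnstile> y : \<tau>" "\<Gamma> \<turnstile> x : \<sigma>'" "\<Gamma> \<turnstile> y : \<tau>'" "\<sigma>' \<approx> \<sigma>" "\<tau>' \<approx> \<tau>"
proof -
  note * = Con2_typing[OF assms ctype.simps(5)]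
  then show "\<Gamma> \<turnstile> x : \<sigma>'" "\<Gamma> \<turnstile> y : \<tau>'" "\<sigma>' \<approx> \<sigma>" "\<tau>' \<approx> \<tau>" by (simp_all add: tyeq_Bin)
  then show "\<Gamma> \<turnstile> x : \<sigma>" "\<Gamma> \<turnstile> y : \<tau>" using typing_is_type[OF assms] by (auto intro: T_Conv)
qed

lemmas Case_typing = Con3_typing[OF _ _ ctype.simps(3)]
lemmas PCase_typing = Con3_typing[OF _ _ ctype.simps(4)]
lemmas Fst_typing = Con1_typing[OF _ _ ctype.simps(6)]
lemmas Snd_typing = Con1_typing[OF _ _ ctype.simps(7)]

lemma T_Con1: "ctype c = Bin Arr \<sigma> \<rho> \<Longrightarrow> \<forall>\<sigma>\<in>cnst_types c. is_type \<sigma> \<Longrightarrow> \<Gamma> \<turnstile> x : \<sigma> \<Longrightarrow> \<Gamma> \<turnstile> App (Con c) x : \<rho>"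
  using T_Con T_App by metis

lemma T_Con2: "ctype c = Bin Arr \<sigma> (Bin Arr \<sigma>' \<rho>) \<Longrightarrow> \<forall>\<sigma>\<in>cnst_types c. is_type \<sigma> \<Longrightarrow> \<Gamma> \<turnstile> x : \<sigma>
    \<Longrightarrow> \<Gamma> \<turnstile> y : \<sigma>' \<Longrightarrow> \<Gamma> \<turnstile> App (App (Con c) x) y : \<rho>"
  by (rule T_App[OF T_Con1])

lemma T_Con3: "ctype c = Bin Arr \<sigma> (Bin Arr \<sigma>' (Bin Arr \<sigma>'' \<rho>)) \<Longrightarrow> \<forall>\<sigma>\<in>cnst_types c. is_type \<sigma> \<Longrightarrow> \<Gamma> \<turnstile> x : \<sigma>
    \<Longrightarrow> \<Gamma> \<turnstile> y : \<sigma>' \<Longrightarrow> \<Gamma> \<turnstile> z : \<sigma>'' \<Longrightarrow> \<Gamma> \<turnstile> App (App (App (Con c) x) y) z : \<rho>"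
  by (rule T_App[OF T_Con2])

lemma T_In0: "is_type \<sigma> \<Longrightarrow> is_type \<tau> \<Longrightarrow> \<Gamma> \<turnstile> x : \<sigma> \<Longrightarrow> \<Gamma> \<turnstile> In0' \<sigma> \<tau> x : Bin Sum \<sigma> \<tau>"
  and T_In1: "is_type \<sigma> \<Longrightarrow> is_type \<tau> \<Longrightarrow> \<Gamma> \<turnstile> y : \<tau> \<Longrightarrow> \<Gamma> \<turnstile> In1' \<sigma> \<tau> y : Bin Sum \<sigma> \<tau>"
  and T_Pair: "is_type \<sigma> \<Longrightarrow> is_type \<tau> \<Longrightarrow> \<Gamma> \<turnstile> x : \<sigma> \<Longrightarrow> \<Gamma> \<turnstile> y : \<tau> \<Longrightarrow> \<Gamma> \<turnstile> Pair' \<sigma> \<tau> x y : Bin Prod \<sigma> \<tau>"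
  and T_PCase: "is_type \<sigma> \<Longrightarrow> is_type \<tau> \<Longrightarrow> is_type \<rho> \<Longrightarrow> \<Gamma> \<turnstile> s : Bin Sum \<sigma> \<tau> \<Longrightarrow> \<Gamma> \<turnstile> u : \<rho> \<Longrightarrow> \<Gamma> \<turnstile> v : \<rho>
    \<Longrightarrow> \<Gamma> \<turnstile> PCase' \<sigma> \<tau> \<rho> s u v : \<rho>"
  by (simp_all add: T_Con1[OF ctype.simps(1)] T_Con1[OF ctype.simps(2)] T_Con2[OF ctype.simps(5)]
      T_Con3[OF ctype.simps(4)])

section \<open>Preservation of typing under lifting, substitution and reduction\<close>

lemma lift_typing: "\<Gamma> \<turnstile> M : \<tau> \<Longrightarrow> \<Gamma> = \<Gamma>1 @ \<Gamma>2 \<Longrightarrow> \<Gamma>1 @ \<rho> # \<Gamma>2 \<turnstile> lift M (length \<Gamma>1) : \<tau>"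
proof (induction arbitrary: \<Gamma>1 rule: typing.induct)
  case (T_BVar n \<Gamma>)
  then have "\<Gamma> ! n = (\<Gamma>1 @ \<rho> # \<Gamma>2) ! (if n < length \<Gamma>1 then n else Suc n)"
    by (simp add: nth_append Suc_diff_le)
  then show ?case using T_BVar typing.T_BVar[of "if n < length \<Gamma>1 then n else Suc n" "\<Gamma>1 @ \<rho> # \<Gamma>2"]
    by (auto split: if_splits)
next
  case (T_Lam \<sigma> \<Gamma> M \<tau>)
  then show ?case using T_Lam.IH[of "\<sigma> # \<Gamma>1"] by (auto intro: typing.T_Lam)
next
  case (T_Con c \<Gamma>)
  then show ?case using typing.T_Con by simp
qed (auto intro: typing.intros)

lemma subst_typing:
  "\<Gamma> \<turnstile> M : \<tau> \<Longrightarrow> \<Gamma> = \<Gamma>1 @ \<rho> # \<Gamma>2 \<Longrightarrow> \<Gamma>1 @ \<Gamma>2 \<turnstile> N : \<rho> \<Longrightarrow> \<Gamma>1 @ \<Gamma>2 \<turnstile> subst M N (length \<Gamma>1) : \<tau>"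
proof (induction arbitrary: \<Gamma>1 N rule: typing.induct)
  case (T_BVar n \<Gamma>)
  consider "n < length \<Gamma>1" | "n = length \<Gamma>1" | k where "n = Suc (length \<Gamma>1 + k)"
    using less_imp_Suc_add linorder_neqE_nat by metis
  then show ?case
  proof cases
    case 1
    then show ?thesis using T_BVar typing.T_BVar[of n "\<Gamma>1 @ \<Gamma>2"] by (simp add: nth_append)
  next
    case 2
    then show ?thesis using T_BVar by (simp add: nth_append)
  next
    case (3 k)
    then show ?thesis using T_BVar typing.T_BVar[of "length \<Gamma>1 + k" "\<Gamma>1 @ \<Gamma>2"] by (simp add: nth_append)
  qed
next
  case (T_Lam \<sigma> \<Gamma> M \<tau>)
  then show ?case using T_Lam.IH[of "\<sigma> # \<Gamma>1" "lift N 0"] lift_typing[of "\<Gamma>1 @ \<Gamma>2" N \<rho> "[]" "\<Gamma>1 @ \<Gamma>2" \<sigma>]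
    by (auto intro: typing.T_Lam)
next
  case (T_Con c \<Gamma>)
  then show ?case using typing.T_Con by simp
next
  case (T_App \<Gamma> M \<sigma> \<tau> M')
  show ?case unfolding subst.simps
    by (rule typing.T_App[OF T_App.IH(1)[OF T_App.prems] T_App.IH(2)[OF T_App.prems]])
qed (auto intro: typing.intros)

text \<open>Each case derives an equivalent type for the reduct and converts at the end. Where
  \<open>pcase\<close> is distributed over \<open>0\<close>, \<open>1\<close> or
  \<open>pair\<close>, the new constructors take their subscripts from \<open>pcase\<close>; these
  are equivalent to the ones that disappear.\<close>

lemma subject_reduction: "red M N \<Longrightarrow> \<Gamma> \<turnstile> M : \<theta> \<Longrightarrow> wfctx \<Gamma> \<Longrightarrow> \<Gamma> \<turnstile> N : \<theta>"
proof (induction arbitrary: \<Gamma> \<theta> rule: red.induct)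
  case (beta \<sigma> M N)
  note t = typing_is_type[OF beta]
  from App_typing[OF beta(1)] obtain \<sigma>' \<tau>' where
    *: "\<Gamma> \<turnstile> Lam \<sigma> M : Bin Arr \<sigma>' \<tau>'" "\<Gamma> \<turnstile> N : \<sigma>'" "\<tau>' \<approx> \<theta>" by (elim exE conjE)
  from Lam_typing[OF *(1)] obtain \<tau>'' where
    2: "is_type \<sigma>" "\<sigma> # \<Gamma> \<turnstile> M : \<tau>''" "Bin Arr \<sigma> \<tau>'' \<approx> Bin Arr \<sigma>' \<tau>'" by (elim exE conjE)
  then have e: "\<sigma>' \<approx> \<sigma>" "\<tau>'' \<approx> \<theta>" using *(3) by (auto simp: tyeq_Bin intro: tyeq_sym tyeq_trans)
  have "\<Gamma> \<turnstile> N : \<sigma>" using *(2) 2(1) e(1) by (rule T_Conv)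
  then have "\<Gamma> \<turnstile> subst M N 0 : \<tau>''" using subst_typing[OF 2(2), of "[]" \<sigma> \<Gamma> N] by simp
  then show ?case using t e(2) by (rule T_Conv)
next
  case (appL M M' N)
  note t = typing_is_type[OF appL.prems]
  from App_typing[OF appL.prems(1)] obtain \<sigma> \<tau> where
    *: "\<Gamma> \<turnstile> M : Bin Arr \<sigma> \<tau>" "\<Gamma> \<turnstile> N : \<sigma>" "\<tau> \<approx> \<theta>" by (elim exE conjE)
  from appL.IH[OF *(1) appL.prems(2)] *(2) have "\<Gamma> \<turnstile> App M' N : \<tau>" by (rule T_App)
  then show ?case using t *(3) by (rule T_Conv)
next
  case (appR N N' M)
  note t = typing_is_type[OF appR.prems]
  from App_typing[OF appR.prems(1)] obtain \<sigma> \<tau> where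
    *: "\<Gamma> \<turnstile> M : Bin Arr \<sigma> \<tau>" "\<Gamma> \<turnstile> N : \<sigma>" "\<tau> \<approx> \<theta>" by (elim exE conjE)
  from *(1) appR.IH[OF *(2) appR.prems(2)] have "\<Gamma> \<turnstile> App M N' : \<tau>" by (rule T_App)
  then show ?case using t *(3) by (rule T_Conv)
next
  case (lam M M' \<sigma>)
  note t = typing_is_type[OF lam.prems]
  from Lam_typing[OF lam.prems(1)] obtain \<tau> where
    *: "is_type \<sigma>" "\<sigma> # \<Gamma> \<turnstile> M : \<tau>" "Bin Arr \<sigma> \<tau> \<approx> \<theta>" by (elim exE conjE)
  have "\<Gamma> \<turnstile> Lam \<sigma> M' : Bin Arr \<sigma> \<tau>" using *(1) lam.IH[OF *(2)] lam.prems(2) by (simp add: T_Lam)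
  then show ?case using t *(3) by (rule T_Conv)
next
  case (case0 \<sigma> \<tau> \<rho> \<sigma>' \<tau>' x y z)
  note t = typing_is_type[OF case0] and * = Case_typing[OF case0]
  show ?case by (rule T_Conv[OF T_App[OF *(2) In0_typing(1)[OF *(1) case0(2)]] t *(5)])
next
  case (case1 \<sigma> \<tau> \<rho> \<sigma>' \<tau>' x y z)
  note t = typing_is_type[OF case1] and * = Case_typing[OF case1]
  show ?case by (rule T_Conv[OF T_App[OF *(3) In1_typing(1)[OF *(1) case1(2)]] t *(5)])
next
  case (fst \<sigma> \<tau> \<sigma>' \<tau>' x y)
  note t = typing_is_type[OF fst] and * = Fst_typing[OF fst]
  show ?case by (rule T_Conv[OF Pair_typing(1)[OF *(1) fst(2)] t *(3)])
next
  case (snd \<sigma> \<tau> \<sigma>' \<tau>' x y)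
  note t = typing_is_type[OF snd] and * = Snd_typing[OF snd]
  show ?case by (rule T_Conv[OF Pair_typing(2)[OF *(1) snd(2)] t *(3)])
next
  case (pcase0 \<sigma> \<tau> \<rho> \<sigma>' \<tau>' x y z)
  note t = typing_is_type[OF pcase0] and * = PCase_typing[OF pcase0]
  show ?case by (rule T_Conv[OF *(2) t *(5)])
next
  case (pcase1 \<sigma> \<tau> \<rho> \<sigma>' \<tau>' x y z)
  note t = typing_is_type[OF pcase1] and * = PCase_typing[OF pcase1]
  show ?case by (rule T_Conv[OF *(3) t *(5)])
next
  case (pcase_in0 \<sigma> \<tau> \<rho>0 \<rho>1 x \<sigma>' \<tau>' y \<sigma>'' \<tau>'' z)
  note t = typing_is_type[OF pcase_in0] and * = PCase_typing[OF pcase_in0]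
  have "\<Gamma> \<turnstile> In0' \<rho>0 \<rho>1 (PCase' \<sigma> \<tau> \<rho>0 x y z) : Bin Sum \<rho>0 \<rho>1"
    using * In0_typing(1)[OF *(2) pcase_in0(2)] In0_typing(1)[OF *(3) pcase_in0(2)]
    by (intro T_In0 T_PCase) simp_all
  then show ?case using t *(5) by (rule T_Conv)
next
  case (pcase_in1 \<sigma> \<tau> \<rho>0 \<rho>1 x \<sigma>' \<tau>' y \<sigma>'' \<tau>'' z)
  note t = typing_is_type[OF pcase_in1] and * = PCase_typing[OF pcase_in1]
  have "\<Gamma> \<turnstile> In1' \<rho>0 \<rho>1 (PCase' \<sigma> \<tau> \<rho>1 x y z) : Bin Sum \<rho>0 \<rho>1"
    using * In1_typing(1)[OF *(2) pcase_in1(2)] In1_typing(1)[OF *(3) pcase_in1(2)]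
    by (intro T_In1 T_PCase) simp_all
  then show ?case using t *(5) by (rule T_Conv)
next
  case (pcase_pair \<sigma> \<tau> \<rho>1 \<rho>2 x \<sigma>' \<tau>' y1 y2 \<sigma>'' \<tau>'' z1 z2)
  note t = typing_is_type[OF pcase_pair] and * = PCase_typing[OF pcase_pair]
  have "\<Gamma> \<turnstile> Pair' \<rho>1 \<rho>2 (PCase' \<sigma> \<tau> \<rho>1 x y1 z1) (PCase' \<sigma> \<tau> \<rho>2 x y2 z2) : Bin Prod \<rho>1 \<rho>2"
    using * Pair_typing(1,2)[OF *(2) pcase_pair(2)] Pair_typing(1,2)[OF *(3) pcase_pair(2)]
    by (intro T_Pair T_PCase) simp_all
  then show ?case using t *(5) by (rule T_Conv)
next
  case (pcase_app \<sigma> \<tau> \<rho>1 \<rho>2 x y z w)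
  note t = typing_is_type[OF pcase_app]
  from App_typing[OF pcase_app(1)] obtain \<sigma>' \<tau>' where "\<Gamma> \<turnstile> PCase' \<sigma> \<tau> (Bin Arr \<rho>1 \<rho>2) x y z : Bin Arr \<sigma>' \<tau>'"
    by (elim exE conjE)
  note * = PCase_typing[OF this pcase_app(2)]
  note 2 = App_typing_fun[OF pcase_app(1) *(4) pcase_app(2)]
  have "\<Gamma> \<turnstile> PCase' \<sigma> \<tau> \<rho>2 x (App y w) (App z w) : \<rho>2"
    using * T_App[OF *(2) 2(1)] T_App[OF *(3) 2(1)] by (intro T_PCase) simp_all
  then show ?case using t 2(3) by (rule T_Conv)
qed

lemma subject_reductions: "red\<^sup>*\<^sup>* M N \<Longrightarrow> \<Gamma> \<turnstile> M : \<theta> \<Longrightarrow> wfctx \<Gamma> \<Longrightarrow> \<Gamma> \<turnstile> N : \<theta>"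
  by (induction rule: rtranclp_induct) (simp_all add: subject_reduction)

section \<open>Soundness of reduction\<close>

definition good_env :: "env \<Rightarrow> prime set list \<Rightarrow> texp list \<Rightarrow> bool" where
  "good_env \<epsilon> \<eta> \<Gamma> \<longleftrightarrow> is_env \<epsilon> \<and> list_all2 (\<lambda>d \<sigma>. d \<in> D \<sigma>) \<eta> \<Gamma> \<and> wfctx \<Gamma>"

lemma good_sem_D: "good_env \<epsilon> \<eta> \<Gamma> \<Longrightarrow> \<Gamma> \<turnstile> M : \<tau> \<Longrightarrow> sem \<epsilon> \<eta> M \<in> D \<tau>"
  by (simp add: good_env_def sem_D)

lemma Pr_mono: "(\<And>X. step_base P X \<Longrightarrow> f (down P (fset X)) \<subseteq> g (down P (fset X))) \<Longrightarrow> Pr P f \<subseteq> Pr P g"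
  by (auto simp: Pr_def)

lemma sem_beta:
  assumes "good_env \<epsilon> \<eta> \<Gamma>" "\<Gamma> \<turnstile> N : \<sigma>"
  shows "sem \<epsilon> \<eta> (App (Lam \<sigma> M) N) = sem \<epsilon> \<eta> (subst M N 0)"
  using fun_app_Pr[OF cont_sem good_sem_D[OF assms]] sem_subst[of \<epsilon> "[]" \<eta> M N] by simp

lemma sem_In0: "good_env \<epsilon> \<eta> \<Gamma> \<Longrightarrow> \<Gamma> \<turnstile> x : \<sigma> \<Longrightarrow> sem \<epsilon> \<eta> (In0' \<sigma> \<tau> x) = inj_sem False (sem \<epsilon> \<eta> x)"
  and sem_In1: "good_env \<epsilon> \<eta> \<Gamma> \<Longrightarrow> \<Gamma> \<turnstile> y : \<tau> \<Longrightarrow> sem \<epsilon> \<eta> (In1' \<sigma> \<tau> y) = inj_sem True (sem \<epsilon> \<eta> y)"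
  and sem_Pair: "good_env \<epsilon> \<eta> \<Gamma> \<Longrightarrow> \<Gamma> \<turnstile> x : \<sigma> \<Longrightarrow> \<Gamma> \<turnstile> y : \<tau> \<Longrightarrow>
    sem \<epsilon> \<eta> (Pair' \<sigma> \<tau> x y) = pair_sem (sem \<epsilon> \<eta> x) (sem \<epsilon> \<eta> y)"
  and sem_Fst: "good_env \<epsilon> \<eta> \<Gamma> \<Longrightarrow> \<Gamma> \<turnstile> p : Bin Prod \<sigma> \<tau> \<Longrightarrow> sem \<epsilon> \<eta> (App (Con (Fst \<sigma> \<tau>)) p) = proj False (sem \<epsilon> \<eta> p)"
  and sem_Snd: "good_env \<epsilon> \<eta> \<Gamma> \<Longrightarrow> \<Gamma> \<turnstile> p : Bin Prod \<sigma> \<tau> \<Longrightarrow> sem \<epsilon> \<eta> (App (Con (Snd \<sigma> \<tau>)) p) = proj True (sem \<epsilon> \<eta> p)"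
  and sem_Case: "good_env \<epsilon> \<eta> \<Gamma> \<Longrightarrow> \<Gamma> \<turnstile> s : Bin Sum \<sigma> \<tau> \<Longrightarrow> \<Gamma> \<turnstile> f : Bin Arr \<sigma> \<rho> \<Longrightarrow> \<Gamma> \<turnstile> g : Bin Arr \<tau> \<rho> \<Longrightarrow>
    sem \<epsilon> \<eta> (Case' \<sigma> \<tau> \<rho> s f g) = casef (sem \<epsilon> \<eta> s) (sem \<epsilon> \<eta> f) (sem \<epsilon> \<eta> g)"
  and sem_PCase: "good_env \<epsilon> \<eta> \<Gamma> \<Longrightarrow> \<Gamma> \<turnstile> s : Bin Sum \<sigma> \<tau> \<Longrightarrow> \<Gamma> \<turnstile> u : \<rho> \<Longrightarrow> \<Gamma> \<turnstile> v : \<rho> \<Longrightarrow>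
    sem \<epsilon> \<eta> (PCase' \<sigma> \<tau> \<rho> s u v) = pcasef (sem \<epsilon> \<eta> s) (sem \<epsilon> \<eta> u) (sem \<epsilon> \<eta> v)"
  by (simp_all only: sem.simps app_In0 app_In1 app_Pair app_Fst app_Snd app_Case app_PCase good_sem_D)

text \<open>The inclusion has the direction in which approximations of reducts are compared with the
  term itself. Apart from the substitution lemma for beta and the equations of the operations it
  rests on \<open>pcasef_app\<close>.\<close>

lemma red_sound: "red M N \<Longrightarrow> \<Gamma> \<turnstile> M : \<theta> \<Longrightarrow> good_env \<epsilon> \<eta> \<Gamma> \<Longrightarrow> sem \<epsilon> \<eta> N \<subseteq> sem \<epsilon> \<eta> M"
proof (induction arbitrary: \<Gamma> \<theta> \<eta> rule: red.induct)
  case (beta \<sigma> M N)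
  from App_typing[OF beta(1)] obtain \<sigma>' \<tau>' where
    *: "\<Gamma> \<turnstile> Lam \<sigma> M : Bin Arr \<sigma>' \<tau>'" "\<Gamma> \<turnstile> N : \<sigma>'" by (elim exE conjE)
  from Lam_typing[OF *(1)] obtain \<tau>'' where
    2: "is_type \<sigma>" "Bin Arr \<sigma> \<tau>'' \<approx> Bin Arr \<sigma>' \<tau>'" by (elim exE conjE)
  then have e: "\<sigma>' \<approx> \<sigma>" by (simp add: tyeq_Bin tyeq_sym)
  have "\<Gamma> \<turnstile> N : \<sigma>" using *(2) 2(1) e by (rule T_Conv)
  then show ?case using sem_beta beta(2) by blast
next
  case (appL M M' N)
  from App_typing[OF appL.prems(1)] obtain \<sigma> \<tau> where "\<Gamma> \<turnstile> M : Bin Arr \<sigma> \<tau>" by (elim exE conjE)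
  from appL.IH[OF this appL.prems(2)] show ?case by (simp add: fun_app_mono)
next
  case (appR N N' M)
  from App_typing[OF appR.prems(1)] obtain \<sigma> where "\<Gamma> \<turnstile> N : \<sigma>" by (elim exE conjE)
  from appR.IH[OF this appR.prems(2)] show ?case by (simp add: fun_app_mono)
next
  case (lam M M' \<sigma>)
  from Lam_typing[OF lam.prems(1)] obtain \<tau> where
    *: "is_type \<sigma>" "\<sigma> # \<Gamma> \<turnstile> M : \<tau>" by (elim exE conjE)
  have "good_env \<epsilon> (down (PS \<sigma>) (fset X) # \<eta>) (\<sigma> # \<Gamma>)" if "step_base (PS \<sigma>) X" for X
    using lam.prems(2) *(1) down_base_D[OF that] by (simp add: good_env_def)
  then show ?case unfolding sem.simps by (intro Pr_mono lam.IH[OF *(2)])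
next
  case (case0 \<sigma> \<tau> \<rho> \<sigma>' \<tau>' x y z)
  note g = case0(2) then have w: "wfctx \<Gamma>" by (simp add: good_env_def)
  note * = Case_typing[OF case0(1) w] note 1 = In0_typing[OF *(1) w]
  show ?case by (simp add: sem_Case[OF g *(1-3)] sem_In0[OF g 1(2)] casef_def del: sem.simps(5)) simp
next
  case (case1 \<sigma> \<tau> \<rho> \<sigma>' \<tau>' x y z)
  note g = case1(2) then have w: "wfctx \<Gamma>" by (simp add: good_env_def)
  note * = Case_typing[OF case1(1) w] note 1 = In1_typing[OF *(1) w]
  show ?case by (simp add: sem_Case[OF g *(1-3)] sem_In1[OF g 1(2)] casef_def del: sem.simps(5)) simp
next
  case (fst \<sigma> \<tau> \<sigma>' \<tau>' x y)
  note g = fst(2) then have w: "wfctx \<Gamma>" by (simp add: good_env_def)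
  note * = Fst_typing[OF fst(1) w] note 1 = Pair_typing[OF *(1) w]
  show ?case by (simp only: sem_Fst[OF g *(1)] sem_Pair[OF g 1(3,4)] proj_pair_sem)
next
  case (snd \<sigma> \<tau> \<sigma>' \<tau>' x y)
  note g = snd(2) then have w: "wfctx \<Gamma>" by (simp add: good_env_def)
  note * = Snd_typing[OF snd(1) w] note 1 = Pair_typing[OF *(1) w]
  show ?case by (simp only: sem_Snd[OF g *(1)] sem_Pair[OF g 1(3,4)] proj_pair_sem)
next
  case (pcase0 \<sigma> \<tau> \<rho> \<sigma>' \<tau>' x y z)
  note g = pcase0(2) then have w: "wfctx \<Gamma>" by (simp add: good_env_def)
  note * = PCase_typing[OF pcase0(1) w] note 1 = In0_typing[OF *(1) w]
  show ?case unfolding sem_PCase[OF g *(1-3)] sem_In0[OF g 1(2)] by (auto simp: pcasef_def)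
next
  case (pcase1 \<sigma> \<tau> \<rho> \<sigma>' \<tau>' x y z)
  note g = pcase1(2) then have w: "wfctx \<Gamma>" by (simp add: good_env_def)
  note * = PCase_typing[OF pcase1(1) w] note 1 = In1_typing[OF *(1) w]
  show ?case unfolding sem_PCase[OF g *(1-3)] sem_In1[OF g 1(2)] by (auto simp: pcasef_def)
next
  case (pcase_in0 \<sigma> \<tau> \<rho>0 \<rho>1 x \<sigma>' \<tau>' y \<sigma>'' \<tau>'' z)
  note g = pcase_in0(2) then have w: "wfctx \<Gamma>" by (simp add: good_env_def)
  note * = PCase_typing[OF pcase_in0(1) w]
  note 1 = In0_typing[OF *(2) w] and 2 = In0_typing[OF *(3) w]
  have t: "\<Gamma> \<turnstile> PCase' \<sigma> \<tau> \<rho>0 x y z : \<rho>0" using * 1 2 by (intro T_PCase) simp_all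
  show ?case unfolding sem_PCase[OF g *(1-3)] sem_In0[OF g 1(2)] sem_In0[OF g 2(2)]
      sem_In0[OF g t] sem_PCase[OF g *(1) 1(1) 2(1)] by (auto simp: pcasef_def)
next
  case (pcase_in1 \<sigma> \<tau> \<rho>0 \<rho>1 x \<sigma>' \<tau>' y \<sigma>'' \<tau>'' z)
  note g = pcase_in1(2) then have w: "wfctx \<Gamma>" by (simp add: good_env_def)
  note * = PCase_typing[OF pcase_in1(1) w]
  note 1 = In1_typing[OF *(2) w] and 2 = In1_typing[OF *(3) w]
  have t: "\<Gamma> \<turnstile> PCase' \<sigma> \<tau> \<rho>1 x y z : \<rho>1" using * 1 2 by (intro T_PCase) simp_all
  show ?case unfolding sem_PCase[OF g *(1-3)] sem_In1[OF g 1(2)] sem_In1[OF g 2(2)]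
      sem_In1[OF g t] sem_PCase[OF g *(1) 1(1) 2(1)] by (auto simp: pcasef_def)
next
  case (pcase_pair \<sigma> \<tau> \<rho>1 \<rho>2 x \<sigma>' \<tau>' y1 y2 \<sigma>'' \<tau>'' z1 z2)
  note g = pcase_pair(2) then have w: "wfctx \<Gamma>" by (simp add: good_env_def)
  note * = PCase_typing[OF pcase_pair(1) w]
  note 1 = Pair_typing[OF *(2) w] and 2 = Pair_typing[OF *(3) w]
  have t: "\<Gamma> \<turnstile> PCase' \<sigma> \<tau> \<rho>1 x y1 z1 : \<rho>1" "\<Gamma> \<turnstile> PCase' \<sigma> \<tau> \<rho>2 x y2 z2 : \<rho>2"
    using * 1 2 by (intro T_PCase; simp)+
  show ?case unfolding sem_PCase[OF g *(1-3)] sem_Pair[OF g 1(3,4)] sem_Pair[OF g 2(3,4)]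
      sem_Pair[OF g t] sem_PCase[OF g *(1) 1(1) 2(1)] sem_PCase[OF g *(1) 1(2) 2(2)]
    by (auto simp: pcasef_def mem_pair_sem)
next
  case (pcase_app \<sigma> \<tau> \<rho>1 \<rho>2 x y z w)
  note g = pcase_app(2) then have wf: "wfctx \<Gamma>" by (simp add: good_env_def)
  from App_typing[OF pcase_app(1)] obtain \<sigma>' \<tau>' where "\<Gamma> \<turnstile> PCase' \<sigma> \<tau> (Bin Arr \<rho>1 \<rho>2) x y z : Bin Arr \<sigma>' \<tau>'"
    by (elim exE conjE)
  note * = PCase_typing[OF this wf]
  note 2 = App_typing_fun[OF pcase_app(1) *(4) wf]
  have "sem \<epsilon> \<eta> (App (PCase' \<sigma> \<tau> (Bin Arr \<rho>1 \<rho>2) x y z) w)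
      = fun_app (pcasef (sem \<epsilon> \<eta> x) (sem \<epsilon> \<eta> y) (sem \<epsilon> \<eta> z)) (sem \<epsilon> \<eta> w)"
    unfolding sem.simps(5)[of _ _ "PCase' \<sigma> \<tau> (Bin Arr \<rho>1 \<rho>2) x y z"] sem_PCase[OF g *(1-3)] ..
  moreover have "sem \<epsilon> \<eta> (PCase' \<sigma> \<tau> \<rho>2 x (App y w) (App z w)) =
      pcasef (sem \<epsilon> \<eta> x) (fun_app (sem \<epsilon> \<eta> y) (sem \<epsilon> \<eta> w)) (fun_app (sem \<epsilon> \<eta> z) (sem \<epsilon> \<eta> w))"
    unfolding sem_PCase[OF g *(1) T_App[OF *(2) 2(1)] T_App[OF *(3) 2(1)]] by simp
  ultimately show ?case
    using pcasef_app[OF good_sem_D[OF g *(2)] good_sem_D[OF g *(3)] good_sem_D[OF g 2(1)]] by simp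
qed

lemma reds_sound: "red\<^sup>*\<^sup>* M N \<Longrightarrow> \<Gamma> \<turnstile> M : \<theta> \<Longrightarrow> good_env \<epsilon> \<eta> \<Gamma> \<Longrightarrow> sem \<epsilon> \<eta> N \<subseteq> sem \<epsilon> \<eta> M"
proof (induction rule: rtranclp_induct)
  case (step N N')
  have "\<Gamma> \<turnstile> N : \<theta>" using subject_reductions[OF step.hyps(1) step.prems(1)] step.prems(2) by (simp add: good_env_def)
  from red_sound[OF step.hyps(2) this step.prems(2)] step show ?case by blast
qed simp

lemma prefix_sem: "prefix \<Gamma> A M \<Longrightarrow> sem \<epsilon> \<eta> A \<subseteq> sem \<epsilon> \<eta> M"
  by (induction arbitrary: \<eta> rule: prefix.induct) (simp_all add: Pr_mono fun_app_mono)

text \<open>Ensures that the semantics of an approximation is an element of the domain of the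
  approximated term.\<close>

lemma prefix_typing: "prefix \<Gamma> A M \<Longrightarrow> \<Gamma> \<turnstile> M : \<tau> \<Longrightarrow> wfctx \<Gamma> \<Longrightarrow> \<Gamma> \<turnstile> A : \<tau>"
proof (induction arbitrary: \<tau> rule: prefix.induct)
  case (1 \<Gamma> M \<sigma>)
  have "\<Gamma> \<turnstile> Con (Omega \<sigma>) : \<sigma>" using T_Con[of "Omega \<sigma>" \<Gamma>] typing_is_type[OF 1(1,3)] by simp
  then show ?case using typing_unique[OF 1(1,2)] typing_is_type[OF 1(2,3)] by (blast intro: T_Conv)
next
  case (5 \<sigma> \<Gamma> M M')
  from Lam_typing[OF 5(3)] obtain \<tau>' where
    *: "is_type \<sigma>" "\<sigma> # \<Gamma> \<turnstile> M' : \<tau>'" "Bin Arr \<sigma> \<tau>' \<approx> \<tau>" by (elim exE conjE)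
  have "\<Gamma> \<turnstile> Lam \<sigma> M : Bin Arr \<sigma> \<tau>'" using *(1) 5(2)[OF *(2)] 5(4) by (simp add: T_Lam)
  then show ?case using typing_is_type[OF 5(3,4)] *(3) by (rule T_Conv)
next
  case (6 \<Gamma> M M' N N')
  from App_typing[OF 6(5)] obtain \<sigma> \<tau>' where
    *: "\<Gamma> \<turnstile> M' : Bin Arr \<sigma> \<tau>'" "\<Gamma> \<turnstile> N' : \<sigma>" "\<tau>' \<approx> \<tau>" by (elim exE conjE)
  have "\<Gamma> \<turnstile> App M N : \<tau>'" using 6(3)[OF *(1) 6(6)] 6(4)[OF *(2) 6(6)] by (rule T_App)
  then show ?case using typing_is_type[OF 6(5,6)] *(3) by (rule T_Conv)
qed simp_all


section \<open>Substitution and reduction\<close>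

lemma lift_lift: "i < k + 1 \<Longrightarrow> lift (lift t i) (Suc k) = lift (lift t k) i"
  by (induction t arbitrary: i k) auto

lemma lift_subst: "j < i + 1 \<Longrightarrow> lift (subst t s j) i = subst (lift t (i + 1)) (lift s i) j"
  by (induction t arbitrary: i j s) (simp_all add: diff_Suc lift_lift split: nat.split)

lemma lift_subst_lt: "i < j + 1 \<Longrightarrow> lift (subst t s j) i = subst (lift t i) (lift s i) (j + 1)"
  by (induction t arbitrary: i j s) (auto simp: lift_lift)

lemma subst_lift [simp]: "subst (lift t k) s k = t"
  by (induction t arbitrary: k s) simp_all

lemma subst_subst:
  "i < j + 1 \<Longrightarrow> subst (subst t (lift v i) (Suc j)) (subst u v j) i = subst (subst t u i) v j"
  by (induction t arbitrary: i j u v)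
    (simp_all add: diff_Suc lift_lift [symmetric] lift_subst_lt split: nat.split)

lemma red_subst: "red M M' \<Longrightarrow> red (subst M N k) (subst M' N k)"
proof (induction arbitrary: N k rule: red.induct)
  case (beta \<sigma> M P)
  have "subst (subst M (lift N 0) (Suc k)) (subst P N k) 0 = subst (subst M P 0) N k"
    by (rule subst_subst) simp
  then show ?case using red.beta[of \<sigma> "subst M (lift N 0) (Suc k)" "subst P N k"] by simp
qed (auto intro: red.intros)

lemma red_lift: "red M M' \<Longrightarrow> red (lift M k) (lift M' k)"
proof (induction arbitrary: k rule: red.induct)
  case (beta \<sigma> M P)
  have "lift (subst M P 0) k = subst (lift M (Suc k)) (lift P k) 0"
    using lift_subst[of 0 k M P] by simp
  then show ?case using red.beta[of \<sigma> "lift M (Suc k)" "lift P k"] by simp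
qed (auto intro: red.intros)

lemma reds_map:
  assumes "\<And>M M'. red M M' \<Longrightarrow> red (f M) (f M')"
  shows "red\<^sup>*\<^sup>* M M' \<Longrightarrow> red\<^sup>*\<^sup>* (f M) (f M')"
  by (induction rule: rtranclp_induct) (auto intro: assms rtranclp.rtrancl_into_rtrancl)

lemma reds_appL: "red\<^sup>*\<^sup>* M M' \<Longrightarrow> red\<^sup>*\<^sup>* (App M N) (App M' N)"
  by (rule reds_map) (rule red.appL)

lemma reds_appR: "red\<^sup>*\<^sup>* N N' \<Longrightarrow> red\<^sup>*\<^sup>* (App M N) (App M N')"
  by (rule reds_map) (rule red.appR)

lemma reds_app: "red\<^sup>*\<^sup>* M M' \<Longrightarrow> red\<^sup>*\<^sup>* N N' \<Longrightarrow> red\<^sup>*\<^sup>* (App M N) (App M' N')"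
  using rtranclp_trans[OF reds_appL reds_appR] .

lemma reds_lam: "red\<^sup>*\<^sup>* M M' \<Longrightarrow> red\<^sup>*\<^sup>* (Lam \<sigma> M) (Lam \<sigma> M')"
  by (rule reds_map) (rule red.lam)

lemma reds_lift: "red\<^sup>*\<^sup>* M M' \<Longrightarrow> red\<^sup>*\<^sup>* (lift M k) (lift M' k)"
  by (rule reds_map) (rule red_lift)

lemma reds_subst: "red\<^sup>*\<^sup>* M M' \<Longrightarrow> red\<^sup>*\<^sup>* (subst M N k) (subst M' N k)"
  by (rule reds_map) (rule red_subst)

lemma reds_subst2: "red\<^sup>*\<^sup>* N N' \<Longrightarrow> red\<^sup>*\<^sup>* (subst M N k) (subst M N' k)"
  by (induction M arbitrary: N N' k) (simp_all add: reds_app reds_lam reds_lift)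

inductive_cases red_LamE: "red (Lam \<sigma> M) N"
inductive_cases red_FVarE: "red (FVar x \<sigma>) N"
inductive_cases red_BVarE: "red (BVar n) N"
inductive_cases red_ConE: "red (Con c) N"

lemma reds_Lam: "red\<^sup>*\<^sup>* (Lam \<sigma> M) N \<Longrightarrow> \<exists>M'. N = Lam \<sigma> M' \<and> red\<^sup>*\<^sup>* M M'"
  by (induction rule: rtranclp_induct) (auto elim!: red_LamE intro: rtranclp.rtrancl_into_rtrancl)

text \<open>Abstraction of a free variable, inverse to substituting it for the index
  \<open>k\<close>: the variable becomes \<open>k\<close>, and the indices from \<open>k\<close> on
  are shifted to make room. It carries results about a body opened with a fresh variable back under
  the binder.\<close>

fun close :: "nat \<Rightarrow> texp \<Rightarrow> nat \<Rightarrow> trm \<Rightarrow> trm" where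
  "close x \<sigma> k (FVar y \<tau>) = (if y = x \<and> \<tau> = \<sigma> then BVar k else FVar y \<tau>)"
| "close x \<sigma> k (BVar i) = (if i < k then BVar i else BVar (Suc i))"
| "close x \<sigma> k (Con c) = Con c"
| "close x \<sigma> k (Lam \<tau> M) = Lam \<tau> (close x \<sigma> (Suc k) M)"
| "close x \<sigma> k (App M N) = App (close x \<sigma> k M) (close x \<sigma> k N)"

text \<open>Types are ignored, so a name outside this set is fresh at every type.\<close>

fun names :: "trm \<Rightarrow> nat set" where
  "names (FVar x \<sigma>) = {x}"
| "names (BVar i) = {}"
| "names (Con c) = {}"
| "names (Lam \<sigma> M) = names M"
| "names (App M N) = names M \<union> names N"

lemma finite_names: "finite (names M)"
  by (induction M) auto

lemma close_lift: "j \<le> k \<Longrightarrow> close x \<sigma> (Suc k) (lift M j) = lift (close x \<sigma> k M) j"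
  by (induction M arbitrary: j k) auto

lemma close_subst:
  "j \<le> k \<Longrightarrow> close x \<sigma> k (subst P N j) = subst (close x \<sigma> (Suc k) P) (close x \<sigma> k N) j"
  by (induction P arbitrary: N j k) (auto simp: close_lift)

lemma red_close: "red M M' \<Longrightarrow> red (close x \<sigma> k M) (close x \<sigma> k M')"
proof (induction arbitrary: k rule: red.induct)
  case (beta \<tau> M N)
  then show ?case using red.beta[of \<tau> "close x \<sigma> (Suc k) M" "close x \<sigma> k N"] by (simp add: close_subst)
qed (auto intro: red.intros)

lemma reds_close: "red\<^sup>*\<^sup>* M M' \<Longrightarrow> red\<^sup>*\<^sup>* (close x \<sigma> k M) (close x \<sigma> k M')"
  by (rule reds_map) (rule red_close)

lemma subst_close [simp]: "subst (close x \<sigma> k M) (FVar x \<sigma>) k = M"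
  by (induction M arbitrary: k) auto

text \<open>Without freshness, occurrences of the variable already present in \<open>M\<close> would
  become indices as well.\<close>

lemma close_subst_FVar: "x \<notin> names M \<Longrightarrow> close x \<sigma> k (subst M (FVar x \<sigma>) k) = M"
  by (induction M arbitrary: k) auto

lemma names_lift [simp]: "names (lift M k) = names M"
  by (induction M arbitrary: k) auto

lemma names_subst: "names (subst M N k) \<subseteq> names M \<union> names N"
proof (induction M arbitrary: N k)
  case (Lam \<sigma> M)
  then show ?case using Lam[of "lift N 0" "Suc k"] by simp
next
  case (App M M')
  show ?case using App(1)[of N k] App(2)[of N k] by auto
qed auto

lemma names_red: "red M N \<Longrightarrow> names N \<subseteq> names M"
proof (induction rule: red.induct)
  case (beta \<sigma> M N)
  then show ?case using names_subst[of M N 0] by auto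
qed auto

lemma names_reds: "red\<^sup>*\<^sup>* M N \<Longrightarrow> names N \<subseteq> names M"
  by (induction rule: rtranclp_induct) (auto dest: names_red)

lemma names_prefix: "prefix \<Gamma> A M \<Longrightarrow> names A \<subseteq> names M"
  by (induction rule: prefix.induct) auto

lemma sem_names: "(\<And>x \<sigma>. x \<in> names M \<Longrightarrow> \<epsilon> x \<sigma> = \<epsilon>' x \<sigma>) \<Longrightarrow> sem \<epsilon> \<eta> M = sem \<epsilon>' \<eta> M"
  by (induction M arbitrary: \<eta>) simp_all

lemma sem_close:
  "\<epsilon> x \<sigma> = d \<Longrightarrow> sem \<epsilon> (\<eta>1 @ d # \<eta>2) (close x \<sigma> (length \<eta>1) M) = sem \<epsilon> (\<eta>1 @ \<eta>2) M"
proof (induction M arbitrary: \<eta>1)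
  case (Lam \<tau> M)
  have "sem \<epsilon> (e # \<eta>1 @ d # \<eta>2) (close x \<sigma> (Suc (length \<eta>1)) M) = sem \<epsilon> (e # \<eta>1 @ \<eta>2) M" for e
    using Lam.IH[of "e # \<eta>1"] Lam.prems by simp
  then show ?case by simp
qed (auto simp: nth_append Suc_diff_le)

lemma close_typing: "\<Gamma> \<turnstile> M : \<tau> \<Longrightarrow> \<Gamma> = \<Gamma>1 @ \<Gamma>2 \<Longrightarrow> \<Gamma>1 @ \<rho> # \<Gamma>2 \<turnstile> close x \<rho> (length \<Gamma>1) M : \<tau>"
proof (induction arbitrary: \<Gamma>1 rule: typing.induct)
  case (T_BVar n \<Gamma>)
  then have "\<Gamma> ! n = (\<Gamma>1 @ \<rho> # \<Gamma>2) ! (if n < length \<Gamma>1 then n else Suc n)"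
    by (simp add: nth_append Suc_diff_le)
  then show ?case using T_BVar typing.T_BVar[of "if n < length \<Gamma>1 then n else Suc n" "\<Gamma>1 @ \<rho> # \<Gamma>2"]
    by (auto split: if_splits)
next
  case (T_FVar \<sigma> \<Gamma> y)
  then show ?case using typing.T_BVar[of "length \<Gamma>1" "\<Gamma>1 @ \<rho> # \<Gamma>2"] by (auto intro: typing.T_FVar)
next
  case (T_Lam \<sigma> \<Gamma> M \<tau>)
  then show ?case using T_Lam.IH[of "\<sigma> # \<Gamma>1"] by (auto intro: typing.T_Lam)
next
  case (T_Con c \<Gamma>)
  then show ?case using typing.T_Con by simp
qed (auto intro: typing.intros)

section \<open>Spines\<close>

definition spine :: "trm \<Rightarrow> trm list \<Rightarrow> trm" where
  "spine h Ns = foldl App h Ns"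

lemma spine_simps [simp]:
  "spine h [] = h" "spine h (N # Ns) = spine (App h N) Ns" "spine h (Ns @ [N]) = App (spine h Ns) N"
  by (simp_all add: spine_def)


fun is_head :: "trm \<Rightarrow> bool" where
  "is_head (FVar x \<sigma>) = True"
| "is_head (BVar n) = True"
| "is_head (Con c) = True"
| "is_head (Lam \<sigma> M) = False"
| "is_head (App M N) = False"

fun head :: "trm \<Rightarrow> trm" where
  "head (App M N) = head M"
| "head M = M"

lemma head_spine [simp]: "head (spine M Ns) = head M"
  by (induction Ns rule: rev_induct) auto


lemma spine_App: "is_head h \<Longrightarrow> spine h Ns = App M N \<longleftrightarrow> (\<exists>Ks. Ns = Ks @ [N] \<and> spine h Ks = M)"
  by (cases Ns rule: rev_cases) auto

lemma spine_eq_head: "is_head h \<Longrightarrow> is_head M \<Longrightarrow> spine h Ns = M \<longleftrightarrow> Ns = [] \<and> h = M"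
  by (cases Ns rule: rev_cases) auto

lemma spine_Lam: "is_head h \<Longrightarrow> spine h Ns \<noteq> Lam \<sigma> M"
  by (cases Ns rule: rev_cases) auto

lemma spine_inject: "is_head h \<Longrightarrow> is_head h' \<Longrightarrow> spine h Ns = spine h' Ns' \<longleftrightarrow> h = h' \<and> Ns = Ns'"
proof (induction Ns arbitrary: Ns' rule: rev_induct)
  case Nil
  then show ?case using spine_eq_head[of h' h Ns'] by auto
next
  case (snoc N Ns)
  show ?case
  proof (cases Ns' rule: rev_cases)
    case Nil
    then show ?thesis using snoc.prems by (cases h') auto
  next
    case Ns': (snoc Ks K)
    then show ?thesis using snoc.IH[OF snoc.prems, of Ks] by auto
  qed
qed

text \<open>Contraction at the head, expressed on the argument list; \<open>Ks\<close> are the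
  arguments beyond the redex. Beta is absent because the head of such a spine is never a
  \<open>Lam\<close>.\<close>

inductive contracts :: "trm \<Rightarrow> trm list \<Rightarrow> trm \<Rightarrow> bool" where
  "contracts (Con (Case \<sigma> \<tau> \<rho>)) (In0' \<sigma>' \<tau>' x # y # z # Ks) (spine (App y x) Ks)"
| "contracts (Con (Case \<sigma> \<tau> \<rho>)) (In1' \<sigma>' \<tau>' x # y # z # Ks) (spine (App z x) Ks)"
| "contracts (Con (Fst \<sigma> \<tau>)) (Pair' \<sigma>' \<tau>' x y # Ks) (spine x Ks)"
| "contracts (Con (Snd \<sigma> \<tau>)) (Pair' \<sigma>' \<tau>' x y # Ks) (spine y Ks)"
| "contracts (Con (PCase \<sigma> \<tau> \<rho>)) (In0' \<sigma>' \<tau>' x # y # z # Ks) (spine y Ks)"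
| "contracts (Con (PCase \<sigma> \<tau> \<rho>)) (In1' \<sigma>' \<tau>' x # y # z # Ks) (spine z Ks)"
| "contracts (Con (PCase \<sigma> \<tau> (Bin Sum \<rho>0 \<rho>1))) (x # In0' \<sigma>' \<tau>' y # In0' \<sigma>'' \<tau>'' z # Ks)
    (spine (In0' \<rho>0 \<rho>1 (PCase' \<sigma> \<tau> \<rho>0 x y z)) Ks)"
| "contracts (Con (PCase \<sigma> \<tau> (Bin Sum \<rho>0 \<rho>1))) (x # In1' \<sigma>' \<tau>' y # In1' \<sigma>'' \<tau>'' z # Ks)
    (spine (In1' \<rho>0 \<rho>1 (PCase' \<sigma> \<tau> \<rho>1 x y z)) Ks)"
| "contracts (Con (PCase \<sigma> \<tau> (Bin Prod \<rho>1 \<rho>2))) (x # Pair' \<sigma>' \<tau>' y1 y2 # Pair' \<sigma>'' \<tau>'' z1 z2 # Ks)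
    (spine (Pair' \<rho>1 \<rho>2 (PCase' \<sigma> \<tau> \<rho>1 x y1 z1) (PCase' \<sigma> \<tau> \<rho>2 x y2 z2)) Ks)"
| "contracts (Con (PCase \<sigma> \<tau> (Bin Arr \<rho>1 \<rho>2))) (x # y # z # w # Ks)
    (spine (PCase' \<sigma> \<tau> \<rho>2 x (App y w) (App z w)) Ks)"

lemma contracts_snoc: "contracts h Ns T \<Longrightarrow> contracts h (Ns @ [N]) (App T N)"
proof (induction rule: contracts.induct)
  case (1 \<sigma> \<tau> \<rho> \<sigma>' \<tau>' x y z Ks)
  then show ?case using contracts.intros(1)[of \<sigma> \<tau> \<rho> \<sigma>' \<tau>' x y z "Ks @ [N]"] by simp
next
  case (2 \<sigma> \<tau> \<rho> \<sigma>' \<tau>' x y z Ks)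
  then show ?case using contracts.intros(2)[of \<sigma> \<tau> \<rho> \<sigma>' \<tau>' x y z "Ks @ [N]"] by simp
next
  case (3 \<sigma> \<tau> \<sigma>' \<tau>' x y Ks)
  then show ?case using contracts.intros(3)[of \<sigma> \<tau> \<sigma>' \<tau>' x y "Ks @ [N]"] by simp
next
  case (4 \<sigma> \<tau> \<sigma>' \<tau>' x y Ks)
  then show ?case using contracts.intros(4)[of \<sigma> \<tau> \<sigma>' \<tau>' x y "Ks @ [N]"] by simp
next
  case (5 \<sigma> \<tau> \<rho> \<sigma>' \<tau>' x y z Ks)
  then show ?case using contracts.intros(5)[of \<sigma> \<tau> \<rho> \<sigma>' \<tau>' x y z "Ks @ [N]"] by simp
next
  case (6 \<sigma> \<tau> \<rho> \<sigma>' \<tau>' x y z Ks)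
  then show ?case using contracts.intros(6)[of \<sigma> \<tau> \<rho> \<sigma>' \<tau>' x y z "Ks @ [N]"] by simp
next
  case (7 \<sigma> \<tau> \<rho>0 \<rho>1 x \<sigma>' \<tau>' y \<sigma>'' \<tau>'' z Ks)
  then show ?case using contracts.intros(7)[of \<sigma> \<tau> \<rho>0 \<rho>1 x \<sigma>' \<tau>' y \<sigma>'' \<tau>'' z "Ks @ [N]"] by simp
next
  case (8 \<sigma> \<tau> \<rho>0 \<rho>1 x \<sigma>' \<tau>' y \<sigma>'' \<tau>'' z Ks)
  then show ?case using contracts.intros(8)[of \<sigma> \<tau> \<rho>0 \<rho>1 x \<sigma>' \<tau>' y \<sigma>'' \<tau>'' z "Ks @ [N]"] by simp
next
  case (9 \<sigma> \<tau> \<rho>1 \<rho>2 x \<sigma>' \<tau>' y1 y2 \<sigma>'' \<tau>'' z1 z2 Ks)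
  then show ?case using contracts.intros(9)[of \<sigma> \<tau> \<rho>1 \<rho>2 x \<sigma>' \<tau>' y1 y2 \<sigma>'' \<tau>'' z1 z2 "Ks @ [N]"] by simp
next
  case (10 \<sigma> \<tau> \<rho>1 \<rho>2 x y z w Ks)
  then show ?case using contracts.intros(10)[of \<sigma> \<tau> \<rho>1 \<rho>2 x y z w "Ks @ [N]"] by simp
qed

lemma red_spine_cong: "red M M' \<Longrightarrow> red (spine M Ks) (spine M' Ks)"
  by (induction Ks rule: rev_induct) (auto intro: red.appL)

lemma contracts_red: "contracts h Ns T \<Longrightarrow> red (spine h Ns) T"
  by (induction rule: contracts.induct) (auto intro!: red_spine_cong intro: red.intros)

text \<open>A redex at the root of an initial part of the spine is a head redex, and
  \<open>contracts_snoc\<close> adds the surplus arguments. An atomic head cannot make the function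
  part a \<open>Lam\<close>, which excludes beta.\<close>

lemma red_spine:
  "is_head h \<Longrightarrow> red (spine h Ns) T \<Longrightarrow>
    (\<exists>Ns1 N N' Ns2. Ns = Ns1 @ N # Ns2 \<and> red N N' \<and> T = spine h (Ns1 @ N' # Ns2)) \<or> contracts h Ns T"
proof (induction Ns arbitrary: T rule: rev_induct)
  case Nil
  then show ?case by (cases h) (auto elim: red_FVarE red_BVarE red_ConE)
next
  case (snoc N Ns)
  note h = snoc.prems(1)
  from snoc.prems(2) have "red (App (spine h Ns) N) T" by simp
  then show ?case
  proof (cases rule: red.cases)
    case (beta \<sigma> M)
    then show ?thesis using spine_Lam[OF h] by metis
  next
    case (appL M')
    from snoc.IH[OF h appL(2)] show ?thesis
    proof
      assume "contracts h Ns M'"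
      then show ?thesis using contracts_snoc appL(1) by blast
    next
      assume "\<exists>Ns1 N N' Ns2. Ns = Ns1 @ N # Ns2 \<and> red N N' \<and> M' = spine h (Ns1 @ N' # Ns2)"
      then obtain Ns1 K K' Ns2 where "Ns = Ns1 @ K # Ns2" "red K K'" "M' = spine h (Ns1 @ K' # Ns2)"
        by (elim exE conjE)
      then show ?thesis using appL(1) spine_simps(3)[of h "Ns1 @ K' # Ns2" N]
        by (intro disjI1 exI[of _ Ns1] exI[of _ K] exI[of _ K'] exI[of _ "Ns2 @ [N]"]) simp
    qed
  next
    case (appR N')
    then show ?thesis
      by (intro disjI1 exI[of _ Ns] exI[of _ N] exI[of _ N'] exI[of _ "[]"]) simp
  next
    case (case0 \<sigma> \<tau> \<rho> \<sigma>' \<tau>' x y)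
    then show ?thesis using h contracts.intros(1)[of \<sigma> \<tau> \<rho> \<sigma>' \<tau>' x y N "[]"]
      by (auto simp: spine_App spine_eq_head)
  next
    case (case1 \<sigma> \<tau> \<rho> \<sigma>' \<tau>' x y)
    then show ?thesis using h contracts.intros(2)[of \<sigma> \<tau> \<rho> \<sigma>' \<tau>' x y N "[]"]
      by (auto simp: spine_App spine_eq_head)
  next
    case (fst \<sigma> \<tau> \<sigma>' \<tau>' y)
    then show ?thesis using h contracts.intros(3)[of \<sigma> \<tau> \<sigma>' \<tau>' T y "[]"]
      by (auto simp: spine_App spine_eq_head)
  next
    case (snd \<sigma> \<tau> \<sigma>' \<tau>' x)
    then show ?thesis using h contracts.intros(4)[of \<sigma> \<tau> \<sigma>' \<tau>' x T "[]"]
      by (auto simp: spine_App spine_eq_head)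
  next
    case (pcase0 \<sigma> \<tau> \<rho> \<sigma>' \<tau>' x)
    then show ?thesis using h contracts.intros(5)[of \<sigma> \<tau> \<rho> \<sigma>' \<tau>' x T N "[]"]
      by (auto simp: spine_App spine_eq_head)
  next
    case (pcase1 \<sigma> \<tau> \<rho> \<sigma>' \<tau>' x y)
    then show ?thesis using h contracts.intros(6)[of \<sigma> \<tau> \<rho> \<sigma>' \<tau>' x y T "[]"]
      by (auto simp: spine_App spine_eq_head)
  next
    case (pcase_in0 \<sigma> \<tau> \<rho>0 \<rho>1 x \<sigma>' \<tau>' y \<sigma>'' \<tau>'' z)
    then show ?thesis using h contracts.intros(7)[of \<sigma> \<tau> \<rho>0 \<rho>1 x \<sigma>' \<tau>' y \<sigma>'' \<tau>'' z "[]"]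
      by (auto simp: spine_App spine_eq_head)
  next
    case (pcase_in1 \<sigma> \<tau> \<rho>0 \<rho>1 x \<sigma>' \<tau>' y \<sigma>'' \<tau>'' z)
    then show ?thesis using h contracts.intros(8)[of \<sigma> \<tau> \<rho>0 \<rho>1 x \<sigma>' \<tau>' y \<sigma>'' \<tau>'' z "[]"]
      by (auto simp: spine_App spine_eq_head)
  next
    case (pcase_pair \<sigma> \<tau> \<rho>1 \<rho>2 x \<sigma>' \<tau>' y1 y2 \<sigma>'' \<tau>'' z1 z2)
    then show ?thesis using h contracts.intros(9)[of \<sigma> \<tau> \<rho>1 \<rho>2 x \<sigma>' \<tau>' y1 y2 \<sigma>'' \<tau>'' z1 z2 "[]"]
      by (auto simp: spine_App spine_eq_head)
  next
    case (pcase_app \<sigma> \<tau> \<rho>1 \<rho>2 x y z)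
    then show ?thesis using h contracts.intros(10)[of \<sigma> \<tau> \<rho>1 \<rho>2 x y z N "[]"]
      by (auto simp: spine_App spine_eq_head)
  qed
qed

lemma reds_spine: "red\<^sup>*\<^sup>* M M' \<Longrightarrow> list_all2 red\<^sup>*\<^sup>* Ns Ns' \<Longrightarrow> red\<^sup>*\<^sup>* (spine M Ns) (spine M' Ns')"
proof (induction Ns arbitrary: M M' Ns')
  case (Cons N Ns)
  then obtain N' Ks where "Ns' = N' # Ks" "red\<^sup>*\<^sup>* N N'" "list_all2 red\<^sup>*\<^sup>* Ns Ks" by (auto simp: list_all2_Cons1)
  then show ?case using Cons.IH[OF reds_app[OF Cons.prems(1)]] by simp
qed simp

lemma reds_list_refl: "list_all2 red\<^sup>*\<^sup>* Ns Ns"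
  by (simp add: list_all2_refl)

lemma reds_list_trans: "list_all2 red\<^sup>*\<^sup>* Ns Ns' \<Longrightarrow> list_all2 red\<^sup>*\<^sup>* Ns' Ns'' \<Longrightarrow> list_all2 red\<^sup>*\<^sup>* Ns Ns''"
  by (rule list_all2_trans[of "red\<^sup>*\<^sup>*" "red\<^sup>*\<^sup>*" "red\<^sup>*\<^sup>*"]) (rule rtranclp_trans)

lemma reds_list_step: "red N N' \<Longrightarrow> list_all2 red\<^sup>*\<^sup>* (Ns1 @ N # Ns2) (Ns1 @ N' # Ns2)"
  by (intro list_all2_appendI) (simp_all add: list_all2_refl)

text \<open>Only the arguments are reduced here, but this excludes head contraction along every
  reduction of the spine: the first one would act on reducts of the arguments.\<close>

definition inert :: "trm \<Rightarrow> trm list \<Rightarrow> bool" where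
  "inert h Ns \<longleftrightarrow> (\<forall>Ns' T. list_all2 red\<^sup>*\<^sup>* Ns Ns' \<longrightarrow> \<not> contracts h Ns' T)"

lemma inert_reds: "inert h Ns \<Longrightarrow> list_all2 red\<^sup>*\<^sup>* Ns Ns' \<Longrightarrow> inert h Ns'"
  unfolding inert_def using reds_list_trans by blast

lemma reds_inert_spine:
  assumes h: "is_head h" "inert h Ns"
  shows "red\<^sup>*\<^sup>* (spine h Ns) T \<Longrightarrow> \<exists>Ns'. T = spine h Ns' \<and> list_all2 red\<^sup>*\<^sup>* Ns Ns'"
proof (induction rule: rtranclp_induct)
  case base
  then show ?case using reds_list_refl by blast
next
  case (step T T')
  then obtain Ns' where Ns': "T = spine h Ns'" "list_all2 red\<^sup>*\<^sup>* Ns Ns'" by (elim exE conjE)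
  then have "\<not> contracts h Ns' T'" using h(2) by (simp add: inert_def)
  with red_spine[OF h(1), of Ns' T'] step.hyps(2) Ns'(1) obtain Ns1 N N' Ns2 where
    "Ns' = Ns1 @ N # Ns2" "red N N'" "T' = spine h (Ns1 @ N' # Ns2)" by auto
  then show ?case using reds_list_trans[OF Ns'(2)] reds_list_step by blast
qed

text \<open>The rules test only for constants, their subscripts and the number of their arguments,
  all of which substitution preserves.\<close>

lemma contracts_subst: "contracts h Ns T \<Longrightarrow> \<exists>T'. contracts h (map (\<lambda>N. subst N u k) Ns) T'"
  by (induction rule: contracts.induct) (simp; blast intro: contracts.intros)+

lemma contracts_Con: "contracts h Ns T \<Longrightarrow> \<exists>c. h = Con c"
  by (induction rule: contracts.induct) auto


section \<open>Stable approximations\<close>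

text \<open>Normal prefixes of a term need not have a normal upper bound: \<open>fst \<Omega>\<close> and \<open>\<Omega> (x, y)\<close> are both
  below \<open>fst (x, y)\<close>. Here a spine is approximated argumentwise only if no reduct of it contracts
  at the head; the resulting approximations are direct and closed under joins.\<close>

inductive stable_approx :: "texp list \<Rightarrow> trm \<Rightarrow> trm \<Rightarrow> bool" where
  stable_approx_Omega: "\<Gamma> \<turnstile> M : \<sigma> \<Longrightarrow> stable_approx \<Gamma> (Con (Omega \<sigma>)) M"
| stable_approx_Lam: "stable_approx (\<sigma> # \<Gamma>) A M \<Longrightarrow> stable_approx \<Gamma> (Lam \<sigma> A) (Lam \<sigma> M)"
| stable_approx_spine: "is_head h \<Longrightarrow> inert h Ns \<Longrightarrow> list_all2 (stable_approx \<Gamma>) As Ns \<Longrightarrow> stable_approx \<Gamma> (spine h As) (spine h Ns)"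

lemma prefix_refl_head: "is_head h \<Longrightarrow> prefix \<Gamma> h h"
  by (cases h) (auto intro: prefix.intros)

lemma prefix_spine: "prefix \<Gamma> A M \<Longrightarrow> list_all2 (prefix \<Gamma>) As Ns \<Longrightarrow> prefix \<Gamma> (spine A As) (spine M Ns)"
proof (induction As arbitrary: A M Ns)
  case (Cons B As)
  then obtain N' Ks where *: "Ns = N' # Ks" "prefix \<Gamma> B N'" "list_all2 (prefix \<Gamma>) As Ks"
    by (auto simp: list_all2_Cons1)
  then show ?case using Cons.IH[OF prefix.intros(6)[OF Cons.prems(1) *(2)] *(3)] by simp
qed simp

lemma stable_approx_prefix: "stable_approx \<Gamma> A M \<Longrightarrow> prefix \<Gamma> A M"
proof (induction rule: stable_approx.induct)
  case (stable_approx_spine h Ns \<Gamma> As)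
  have "list_all2 (prefix \<Gamma>) As Ns" using stable_approx_spine(3) by (rule list_all2_mono) simp
  then show ?case using prefix_spine[OF prefix_refl_head[OF stable_approx_spine(1)]] by blast
qed (auto intro: prefix.intros)

lemma spine_typing_head: "\<Gamma> \<turnstile> spine M Ns : \<tau> \<Longrightarrow> \<exists>\<sigma>. \<Gamma> \<turnstile> M : \<sigma>"
proof (induction Ns arbitrary: M)
  case (Cons N Ns)
  from Cons.IH[of "App M N"] Cons.prems obtain \<sigma> where "\<Gamma> \<turnstile> App M N : \<sigma>" by auto
  from App_typing[OF this] show ?case by blast
qed auto

lemma spine_typing_args: "\<Gamma> \<turnstile> spine M Ns : \<tau> \<Longrightarrow> N \<in> set Ns \<Longrightarrow> \<exists>\<sigma>. \<Gamma> \<turnstile> N : \<sigma>"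
proof (induction Ns arbitrary: \<tau> rule: rev_induct)
  case (snoc K Ns)
  from snoc.prems(1) have "\<Gamma> \<turnstile> App (spine M Ns) K : \<tau>" by simp
  from App_typing[OF this] obtain \<sigma> \<tau>' where "\<Gamma> \<turnstile> spine M Ns : Bin Arr \<sigma> \<tau>'" "\<Gamma> \<turnstile> K : \<sigma>" by (elim exE conjE)
  then show ?case using snoc.IH snoc.prems(2) by auto
qed simp

text \<open>Inertness confines the reductions of a spine to its arguments and survives them, so one
  approximation serves all reducts. Under a lambda reduction stays in the body.\<close>

lemma stable_approx_reds: "stable_approx \<Gamma> A M \<Longrightarrow> red\<^sup>*\<^sup>* M M' \<Longrightarrow> \<Gamma> \<turnstile> M : \<tau> \<Longrightarrow> wfctx \<Gamma> \<Longrightarrow> stable_approx \<Gamma> A M'"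
proof (induction arbitrary: M' \<tau> rule: stable_approx.induct)
  case (stable_approx_Omega \<Gamma> M \<sigma>)
  then show ?case using subject_reductions stable_approx.stable_approx_Omega by blast
next
  case (stable_approx_Lam \<sigma> \<Gamma> A M)
  from reds_Lam[OF stable_approx_Lam.prems(1)] obtain M'' where M'': "M' = Lam \<sigma> M''" "red\<^sup>*\<^sup>* M M''" by (elim exE conjE)
  from Lam_typing[OF stable_approx_Lam.prems(2)] obtain \<tau>' where "is_type \<sigma>" "\<sigma> # \<Gamma> \<turnstile> M : \<tau>'" by (elim exE conjE)
  with stable_approx_Lam.IH[OF M''(2)] stable_approx_Lam.prems(3) have "stable_approx (\<sigma> # \<Gamma>) A M''" by simp
  then show ?case unfolding M''(1) by (rule stable_approx.stable_approx_Lam)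
next
  case (stable_approx_spine h Ns \<Gamma> As)
  from reds_inert_spine[OF stable_approx_spine.hyps(1,2) stable_approx_spine.prems(1)] obtain Ns' where
    Ns': "M' = spine h Ns'" "list_all2 red\<^sup>*\<^sup>* Ns Ns'" by (elim exE conjE)
  have "list_all2 (stable_approx \<Gamma>) As Ns'"
    unfolding list_all2_conv_all_nth
  proof (intro conjI allI impI)
    show "length As = length Ns'" using stable_approx_spine.IH Ns'(2) by (simp add: list_all2_conv_all_nth)
    fix i assume "i < length As"
    then have i: "i < length Ns" using stable_approx_spine.IH by (simp add: list_all2_conv_all_nth)
    from spine_typing_args[OF stable_approx_spine.prems(2) nth_mem[OF i]] obtain \<sigma> where "\<Gamma> \<turnstile> Ns ! i : \<sigma>" by (elim exE)
    moreover have "red\<^sup>*\<^sup>* (Ns ! i) (Ns' ! i)" using Ns'(2) i by (simp add: list_all2_conv_all_nth)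
    ultimately show "stable_approx \<Gamma> (As ! i) (Ns' ! i)"
      using list_all2_nthD2[OF stable_approx_spine.IH i] stable_approx_spine.prems(3) by metis
  qed
  then show ?case unfolding Ns'(1)
    by (rule stable_approx.stable_approx_spine[OF stable_approx_spine.hyps(1) inert_reds[OF stable_approx_spine.hyps(2) Ns'(2)]])
qed

text \<open>A spine approximates only spines of the same head and length, so a constructor visible
  in the approximation is present in the approximated term.\<close>

lemma stable_approx_Con1:
  assumes "stable_approx \<Gamma> (App (Con c) a) N" shows "\<exists>n. N = App (Con c) n"
  using assms
proof (cases rule: stable_approx.cases)
  case (stable_approx_spine h Ns As)
  from stable_approx_spine(1) have "h = Con c \<and> As = [a]"
    using spine_App[OF stable_approx_spine(3), of As "Con c" a] spine_eq_head[OF stable_approx_spine(3), of "Con c"] by auto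
  then show ?thesis using stable_approx_spine by (auto simp: list_all2_Cons1)
qed

lemma stable_approx_Con2:
  assumes "stable_approx \<Gamma> (App (App (Con c) a) b) N" shows "\<exists>n m. N = App (App (Con c) n) m"
  using assms
proof (cases rule: stable_approx.cases)
  case (stable_approx_spine h Ns As)
  from stable_approx_spine(1)[symmetric] have "h = Con c \<and> As = [a, b]"
    by (auto simp: spine_App[OF stable_approx_spine(3)] spine_eq_head[OF stable_approx_spine(3)])
  then show ?thesis using stable_approx_spine by (auto simp: list_all2_Cons1)
qed

text \<open>The constructor patterns required for a head redex are reflected by approximation. Hence
  an approximation of an inert spine has no redex at its head.\<close>

lemma contracts_stable_approx:
  assumes "contracts h As T" "list_all2 (stable_approx \<Gamma>) As Ns" shows "\<exists>T'. contracts h Ns T'"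
  using assms
  by (induction rule: contracts.induct)
    (auto simp: list_all2_Cons1 dest!: stable_approx_Con1 stable_approx_Con2 intro: contracts.intros)

lemma stable_approx_normal: "stable_approx \<Gamma> A M \<Longrightarrow> \<not> red A T"
proof (induction arbitrary: T rule: stable_approx.induct)
  case (stable_approx_Omega \<Gamma> M \<sigma>)
  then show ?case by (auto elim: red_ConE)
next
  case (stable_approx_Lam \<sigma> \<Gamma> A M)
  then show ?case by (auto elim: red_LamE)
next
  case (stable_approx_spine h Ns \<Gamma> As)
  show ?case
  proof
    assume "red (spine h As) T"
    from red_spine[OF stable_approx_spine(1) this] show False
    proof
      assume "contracts h As T"
      moreover have "list_all2 (stable_approx \<Gamma>) As Ns" using stable_approx_spine(3) by (rule list_all2_mono) simp
      ultimately obtain T' where "contracts h Ns T'" using contracts_stable_approx by blast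
      then show False using stable_approx_spine(2) reds_list_refl by (auto simp: inert_def)
    next
      assume "\<exists>Ns1 N N' Ns2. As = Ns1 @ N # Ns2 \<and> red N N' \<and> T = spine h (Ns1 @ N' # Ns2)"
      then obtain Ns1 N N' Ns2 where N: "As = Ns1 @ N # Ns2" "red N N'" by (elim exE conjE)
      have "\<forall>A\<in>set As. \<forall>T. \<not> red A T"
        using stable_approx_spine(3) by (auto simp: list_all2_conv_all_nth in_set_conv_nth)
      then show False using N by auto
    qed
  qed
qed

lemma stable_approx_direct: "stable_approx [] A M \<Longrightarrow> [] \<turnstile> M : \<tau> \<Longrightarrow> direct_approx A M"
  using stable_approx_normal stable_approx_reds stable_approx_prefix by (simp add: direct_approx_def normal_form_def)

text \<open>Upper bounds of approximations are used only through their semantics, so joins are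
  compared semantically, in all environments at once.\<close>

definition sem_le :: "trm \<Rightarrow> trm \<Rightarrow> bool" where
  "sem_le A B \<longleftrightarrow> (\<forall>\<epsilon> \<eta>. sem \<epsilon> \<eta> A \<subseteq> sem \<epsilon> \<eta> B)"

lemma sem_le_refl: "sem_le A A"
  by (simp add: sem_le_def)

lemma sem_le_Omega: "sem_le (Con (Omega \<sigma>)) A"
  by (simp add: sem_le_def)

lemma sem_le_Lam: "sem_le A B \<Longrightarrow> sem_le (Lam \<sigma> A) (Lam \<sigma> B)"
  by (simp add: sem_le_def Pr_mono)

lemma sem_le_spine: "sem_le A B \<Longrightarrow> list_all2 sem_le As Bs \<Longrightarrow> sem_le (spine A As) (spine B Bs)"
proof (induction As arbitrary: A B Bs)
  case (Cons C As)
  then obtain D Ds where *: "Bs = D # Ds" "sem_le C D" "list_all2 sem_le As Ds"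
    by (auto simp: list_all2_Cons1)
  have "sem_le (App A C) (App B D)" using Cons.prems(1) *(2) by (simp add: sem_le_def fun_app_mono)
  then show ?case using Cons.IH *(1,3) by simp
qed simp

text \<open>\<open>Omega\<close> is dominated by the other approximation. Otherwise the term
  decomposes uniquely, as a lambda or as an atomic head with arguments; both approximations follow
  this decomposition and are joined componentwise.\<close>

lemma stable_approx_join:
  "stable_approx \<Gamma> A M \<Longrightarrow> stable_approx \<Gamma> B M \<Longrightarrow> \<exists>C. stable_approx \<Gamma> C M \<and> sem_le A C \<and> sem_le B C"
proof (induction arbitrary: B rule: stable_approx.induct)
  case (stable_approx_Omega \<Gamma> M \<sigma>)
  then show ?case using sem_le_refl sem_le_Omega by blast
next
  case (stable_approx_Lam \<sigma> \<Gamma> A M)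
  from stable_approx_Lam.prems show ?case
  proof (cases rule: stable_approx.cases)
    case (stable_approx_Omega \<tau>)
    then show ?thesis using stable_approx.stable_approx_Lam[OF stable_approx_Lam.hyps] sem_le_refl sem_le_Omega by blast
  next
    case (stable_approx_Lam A')
    with \<open>\<And>B. stable_approx (\<sigma> # \<Gamma>) B M \<Longrightarrow> _\<close> obtain C where
      "stable_approx (\<sigma> # \<Gamma>) C M" "sem_le A C" "sem_le A' C" by blast
    then show ?thesis using stable_approx_Lam(1) by (intro exI[of _ "Lam \<sigma> C"]) (simp add: stable_approx.stable_approx_Lam sem_le_Lam)
  next
    case (stable_approx_spine h Ns As)
    then show ?thesis using spine_Lam by metis
  qed
next
  case (stable_approx_spine h Ns \<Gamma> As)
  note IH = stable_approx_spine.IH and hyps = stable_approx_spine.hyps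
  have As: "list_all2 (stable_approx \<Gamma>) As Ns" using IH by (rule list_all2_mono) simp
  from stable_approx_spine.prems show ?case
  proof (cases rule: stable_approx.cases)
    case (stable_approx_Omega \<tau>)
    then show ?thesis using stable_approx.stable_approx_spine[OF hyps(1,2) As] sem_le_refl sem_le_Omega by blast
  next
    case (stable_approx_Lam)
    then show ?thesis using spine_Lam[OF hyps(1)] by metis
  next
    case (stable_approx_spine h' Ns' Bs)
    then have eq: "h' = h" "Ns' = Ns" using spine_inject[OF hyps(1) stable_approx_spine(3)] by auto
    have "\<forall>i<length Ns. \<exists>C. stable_approx \<Gamma> C (Ns ! i) \<and> sem_le (As ! i) C \<and> sem_le (Bs ! i) C"
      using IH stable_approx_spine(5) eq by (simp add: list_all2_conv_all_nth)
    then obtain f where f: "\<forall>i<length Ns. stable_approx \<Gamma> (f i) (Ns ! i) \<and> sem_le (As ! i) (f i) \<and> sem_le (Bs ! i) (f i)"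
      by metis
    define Cs where "Cs = map f [0..<length Ns]"
    have len: "length As = length Ns" "length Bs = length Ns"
      using As stable_approx_spine(5) eq by (auto dest: list_all2_lengthD)
    have "list_all2 (stable_approx \<Gamma>) Cs Ns" "list_all2 sem_le As Cs" "list_all2 sem_le Bs Cs"
      using f len by (simp_all add: Cs_def list_all2_conv_all_nth)
    then show ?thesis using stable_approx_spine(1) eq stable_approx.stable_approx_spine[OF hyps(1,2)] sem_le_spine[OF sem_le_refl]
      by (intro exI[of _ "spine h Cs"]) simp
  qed
qed

lemma close_spine: "close x \<sigma> k (spine M Ns) = spine (close x \<sigma> k M) (map (close x \<sigma> k) Ns)"
  by (induction Ns arbitrary: M) simp_all

text \<open>Substituting the variable back for \<open>k\<close> undoes the closing and takes
  reductions and head redexes along, so a contraction after closing would give one before.\<close>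

lemma inert_close:
  assumes h: "is_head h" and i: "inert h Ns"
  shows "inert (close x \<sigma> k h) (map (close x \<sigma> k) Ns)"
  unfolding inert_def
proof (intro allI impI notI)
  fix Ns' T assume r: "list_all2 red\<^sup>*\<^sup>* (map (close x \<sigma> k) Ns) Ns'" and t: "contracts (close x \<sigma> k h) Ns' T"
  \<comment> \<open>A contracting head is a constant, and closing turns only variables into indices,
    so \<open>h\<close> is already that constant.\<close>
  from contracts_Con[OF t] h have eq: "close x \<sigma> k h = h" by (cases h) (auto split: if_splits)
  have "list_all2 red\<^sup>*\<^sup>* Ns (map (\<lambda>N. subst N (FVar x \<sigma>) k) Ns')"
    unfolding list_all2_conv_all_nth
  proof (intro conjI allI impI)
    show len: "length Ns = length (map (\<lambda>N. subst N (FVar x \<sigma>) k) Ns')"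
      using r by (simp add: list_all2_conv_all_nth)
    fix j assume j: "j < length Ns"
    then have "red\<^sup>*\<^sup>* (close x \<sigma> k (Ns ! j)) (Ns' ! j)" using r by (simp add: list_all2_conv_all_nth)
    from reds_subst[OF this, of "FVar x \<sigma>" k] j len
    show "red\<^sup>*\<^sup>* (Ns ! j) (map (\<lambda>N. subst N (FVar x \<sigma>) k) Ns' ! j)" by simp
  qed
  moreover obtain T' where "contracts h (map (\<lambda>N. subst N (FVar x \<sigma>) k) Ns') T'"
    using contracts_subst[OF t, of "FVar x \<sigma>" k] eq by auto
  ultimately show False using i by (simp add: inert_def)
qed

lemma stable_approx_close:
  "stable_approx \<Gamma> A M \<Longrightarrow> \<Gamma> = \<Gamma>1 @ \<Gamma>2 \<Longrightarrow>
    stable_approx (\<Gamma>1 @ \<sigma> # \<Gamma>2) (close x \<sigma> (length \<Gamma>1) A) (close x \<sigma> (length \<Gamma>1) M)"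
proof (induction arbitrary: \<Gamma>1 rule: stable_approx.induct)
  case (stable_approx_Omega \<Gamma> M \<tau>)
  then show ?case using close_typing by (auto intro: stable_approx.stable_approx_Omega)
next
  case (stable_approx_Lam \<tau> \<Gamma> A M)
  then show ?case using stable_approx_Lam.IH[of "\<tau> # \<Gamma>1"] by (auto intro: stable_approx.stable_approx_Lam)
next
  case (stable_approx_spine h Ns \<Gamma> As)
  have "is_head (close x \<sigma> (length \<Gamma>1) h)" using stable_approx_spine(1) by (cases h) auto
  moreover have "list_all2 (stable_approx (\<Gamma>1 @ \<sigma> # \<Gamma>2)) (map (close x \<sigma> (length \<Gamma>1)) As) (map (close x \<sigma> (length \<Gamma>1)) Ns)"
    using stable_approx_spine(3,4) by (simp add: list_all2_conv_all_nth)
  ultimately show ?case unfolding close_spine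
    using inert_close[OF stable_approx_spine(1,2)] by (intro stable_approx.stable_approx_spine)
qed

text \<open>Quantifying over all reducts \<open>M'\<close> makes the predicate stable under reduction, so that
  approximations for finitely many primes can be found one after the other and then joined; this
  replaces an appeal to confluence.\<close>

definition approximable :: "env \<Rightarrow> prime \<Rightarrow> trm \<Rightarrow> bool" where
  "approximable \<epsilon> a M \<longleftrightarrow> (\<forall>M'. red\<^sup>*\<^sup>* M M' \<longrightarrow> (\<exists>M'' A. red\<^sup>*\<^sup>* M' M'' \<and> stable_approx [] A M'' \<and> a \<in> sem \<epsilon> [] A))"

lemma approximable_reds: "approximable \<epsilon> a M \<Longrightarrow> red\<^sup>*\<^sup>* M M' \<Longrightarrow> approximable \<epsilon> a M'"
  unfolding approximable_def using rtranclp_trans by metis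

lemma approximable_approximations:
  assumes "approximable \<epsilon> a M" "[] \<turnstile> M : \<tau>"
  shows "\<exists>A\<in>approximations M. a \<in> sem \<epsilon> [] A"
proof -
  from assms(1) obtain M' A where *: "red\<^sup>*\<^sup>* M M'" "stable_approx [] A M'" "a \<in> sem \<epsilon> [] A"
    unfolding approximable_def by blast
  then show ?thesis using stable_approx_direct[OF *(2) subject_reductions[OF *(1) assms(2)]]
    by (auto simp: approximations_def)
qed

lemma approximable_sem:
  assumes "approximable \<epsilon> a M" "[] \<turnstile> M : \<tau>" "is_env \<epsilon>"
  shows "a \<in> sem \<epsilon> [] M"
proof -
  from assms(1) obtain M' A where *: "red\<^sup>*\<^sup>* M M'" "stable_approx [] A M'" "a \<in> sem \<epsilon> [] A"
    unfolding approximable_def by blast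
  have "good_env \<epsilon> [] []" using assms(3) by (simp add: good_env_def)
  from reds_sound[OF *(1) assms(2) this] prefix_sem[OF stable_approx_prefix[OF *(2)]] *(3) show ?thesis by blast
qed

lemma approximable_finite:
  assumes "finite F" "\<And>a. a \<in> F \<Longrightarrow> approximable \<epsilon> a M" "[] \<turnstile> M : \<tau>"
  shows "\<exists>M' A. red\<^sup>*\<^sup>* M M' \<and> stable_approx [] A M' \<and> F \<subseteq> sem \<epsilon> [] A"
  using assms
proof (induction rule: finite_induct)
  case empty
  then show ?case using stable_approx_Omega by blast
next
  case (insert a F)
  then obtain M' A where A: "red\<^sup>*\<^sup>* M M'" "stable_approx [] A M'" "F \<subseteq> sem \<epsilon> [] A" by auto
  from insert.prems(1)[of a] A(1) obtain M'' B where B: "red\<^sup>*\<^sup>* M' M''" "stable_approx [] B M''" "a \<in> sem \<epsilon> [] B"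
    unfolding approximable_def by blast
  have "stable_approx [] A M''" using stable_approx_reds[OF A(2) B(1) subject_reductions[OF A(1) insert.prems(2)]] by simp
  from stable_approx_join[OF this B(2)] obtain C where "stable_approx [] C M''" "sem_le A C" "sem_le B C" by (elim exE conjE)
  then show ?case using A(3) B(3) rtranclp_trans[OF A(1) B(1)]
    unfolding sem_le_def by blast
qed

lemma approximable_list:
  assumes "list_all2 (\<lambda>X N. \<forall>a\<in>fset X. approximable \<epsilon> a N) Xs Ns" "\<forall>N\<in>set Ns. \<exists>\<tau>. [] \<turnstile> N : \<tau>"
  shows "\<exists>Ns' As. list_all2 red\<^sup>*\<^sup>* Ns Ns' \<and> list_all2 (stable_approx []) As Ns' \<and> list_all2 (\<lambda>X A. fset X \<subseteq> sem \<epsilon> [] A) Xs As"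
  using assms
proof (induction rule: list_all2_induct)
  case Nil
  then show ?case by simp
next
  case (Cons X Xs N Ns)
  then obtain Ns' As where 1: "list_all2 red\<^sup>*\<^sup>* Ns Ns'" "list_all2 (stable_approx []) As Ns'"
    "list_all2 (\<lambda>X A. fset X \<subseteq> sem \<epsilon> [] A) Xs As" by auto
  from Cons.prems obtain \<tau> where "[] \<turnstile> N : \<tau>" by auto
  then have "\<exists>N' A. red\<^sup>*\<^sup>* N N' \<and> stable_approx [] A N' \<and> fset X \<subseteq> sem \<epsilon> [] A"
    by (intro approximable_finite) (use Cons.hyps(1) in auto)
  then obtain N' A where "red\<^sup>*\<^sup>* N N'" "stable_approx [] A N'" "fset X \<subseteq> sem \<epsilon> [] A" by (elim exE conjE)
  then show ?case using 1 by (intro exI[of _ "N' # Ns'"] exI[of _ "A # As"]) simp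
qed

definition arrow :: "prime fset list \<Rightarrow> prime \<Rightarrow> prime" where
  "arrow Xs b = foldr Step Xs b"

lemma arrow_simps [simp]: "arrow [] b = b" "arrow (X # Xs) b = Step X (arrow Xs b)"
  "arrow (Xs @ [X]) b = arrow Xs (Step X b)"
  by (simp_all add: arrow_def)

lemma arrow_spine:
  "arrow Xs b \<in> sem \<epsilon> \<eta> M \<Longrightarrow> list_all2 (\<lambda>X A. fset X \<subseteq> sem \<epsilon> \<eta> A) Xs As \<Longrightarrow> b \<in> sem \<epsilon> \<eta> (spine M As)"
proof (induction Xs arbitrary: M As)
  case (Cons X Xs)
  then obtain A Bs where *: "As = A # Bs" "fset X \<subseteq> sem \<epsilon> \<eta> A" "list_all2 (\<lambda>X A. fset X \<subseteq> sem \<epsilon> \<eta> A) Xs Bs"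
    by (auto simp: list_all2_Cons1)
  have "arrow Xs b \<in> sem \<epsilon> \<eta> (App M A)" using Cons.prems(1) *(2) by (auto simp: mem_fun_app)
  then show ?case using Cons.IH *(1,3) by simp
qed simp

text \<open>The head approximates itself. Applied to approximations of the arguments that contain
  the premises \<open>Xs\<close>, it yields \<open>b\<close>.\<close>

lemma inert_approximable:
  assumes h: "is_head h" "inert h Ns" and t: "[] \<turnstile> spine h Ns : \<tau>"
    and args: "list_all2 (\<lambda>X N. \<forall>a\<in>fset X. approximable \<epsilon> a N) Xs Ns" and b: "arrow Xs b \<in> sem \<epsilon> [] h"
  shows "\<exists>M A. red\<^sup>*\<^sup>* (spine h Ns) M \<and> stable_approx [] A M \<and> b \<in> sem \<epsilon> [] A"
proof -
  have "\<forall>N\<in>set Ns. \<exists>\<tau>. [] \<turnstile> N : \<tau>" using spine_typing_args[OF t] by blast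
  from approximable_list[OF args this] obtain Ns' As where *: "list_all2 red\<^sup>*\<^sup>* Ns Ns'" "list_all2 (stable_approx []) As Ns'"
    "list_all2 (\<lambda>X A. fset X \<subseteq> sem \<epsilon> [] A) Xs As" by (elim exE conjE)
  show ?thesis
    using reds_spine[OF rtranclp.rtrancl_refl *(1), of h] stable_approx_spine[OF h(1) inert_reds[OF h(2) *(1)] *(2)]
      arrow_spine[OF b *(3)] by blast
qed


section \<open>The computability predicate\<close>

definition inc :: "bool \<Rightarrow> texp \<Rightarrow> texp \<Rightarrow> cnst" where
  "inc i \<sigma> \<tau> = (if i then In1 \<sigma> \<tau> else In0 \<sigma> \<tau>)"

lemma inc_simps [simp]: "inc False \<sigma> \<tau> = In0 \<sigma> \<tau>" "inc True \<sigma> \<tau> = In1 \<sigma> \<tau>"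
  by (simp_all add: inc_def)

text \<open>Primes are untyped, so \<open>Inj\<close> covers sums and products together; for a typed
  term only one of the two clauses can apply. Subscripts are quantified because those of a reduct
  are determined only up to equivalence. The image under \<open>fimage\<close> makes the recursion
  through the finite base primitive; \<open>computable_Step\<close> gives the readable form.\<close>

primrec computable :: "env \<Rightarrow> prime \<Rightarrow> trm \<Rightarrow> bool" where
  "computable \<epsilon> (Tag i) = approximable \<epsilon> (Tag i)"
| "computable \<epsilon> (Inj i a) = (\<lambda>M. approximable \<epsilon> (Inj i a) M
    \<and> (\<forall>\<sigma> \<tau> m. red\<^sup>*\<^sup>* M (App (Con (inc i \<sigma> \<tau>)) m) \<longrightarrow> computable \<epsilon> a m)
    \<and> (\<forall>\<sigma> \<tau> m n. red\<^sup>*\<^sup>* M (Pair' \<sigma> \<tau> m n) \<longrightarrow> computable \<epsilon> a (sel m n i)))"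
| "computable \<epsilon> (Step X b) = (\<lambda>M. approximable \<epsilon> (Step X b) M
    \<and> (\<forall>N \<tau>. [] \<turnstile> App M N : \<tau> \<longrightarrow> (\<forall>p\<in>fset (fimage (computable \<epsilon>) X). p N) \<longrightarrow> computable \<epsilon> b (App M N)))"

abbreviation computables :: "env \<Rightarrow> prime fset \<Rightarrow> trm \<Rightarrow> bool" where
  "computables \<epsilon> X N \<equiv> \<forall>x\<in>fset X. computable \<epsilon> x N"

lemma computable_InjI:
  "approximable \<epsilon> (Inj i a) M \<Longrightarrow> (\<And>\<sigma> \<tau> m. red\<^sup>*\<^sup>* M (App (Con (inc i \<sigma> \<tau>)) m) \<Longrightarrow> computable \<epsilon> a m) \<Longrightarrow>
    (\<And>\<sigma> \<tau> m n. red\<^sup>*\<^sup>* M (Pair' \<sigma> \<tau> m n) \<Longrightarrow> computable \<epsilon> a (sel m n i)) \<Longrightarrow> computable \<epsilon> (Inj i a) M"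
  by simp

lemma computable_incD: "computable \<epsilon> (Inj i a) M \<Longrightarrow> red\<^sup>*\<^sup>* M (App (Con (inc i \<sigma> \<tau>)) m) \<Longrightarrow> computable \<epsilon> a m"
  and computable_PairD: "computable \<epsilon> (Inj i a) M \<Longrightarrow> red\<^sup>*\<^sup>* M (Pair' \<sigma> \<tau> m n) \<Longrightarrow> computable \<epsilon> a (sel m n i)"
  unfolding computable.simps by blast+

lemma computable_Step: "computable \<epsilon> (Step X b) M \<longleftrightarrow> approximable \<epsilon> (Step X b) M
    \<and> (\<forall>N \<tau>. [] \<turnstile> App M N : \<tau> \<longrightarrow> computables \<epsilon> X N \<longrightarrow> computable \<epsilon> b (App M N))"
  by simp

declare computable.simps(2,3) [simp del]

lemma computable_StepD: "computable \<epsilon> (Step X b) M \<Longrightarrow> [] \<turnstile> App M N : \<tau> \<Longrightarrow> computables \<epsilon> X N \<Longrightarrow> computable \<epsilon> b (App M N)"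
  unfolding computable_Step by blast

text \<open>Bases count too, since inductions on primes descend into them. The inserted 0 keeps
  \<open>Max\<close> meaningful for an empty base.\<close>

primrec rank :: "prime \<Rightarrow> nat" where
  "rank (Tag i) = 0"
| "rank (Inj i a) = Suc (rank a)"
| "rank (Step X b) = Suc (max (rank b) (Max (insert 0 (fset (fimage rank X)))))"

lemma rank_base: "x \<in> fset X \<Longrightarrow> rank x < rank (Step X b)"
proof -
  assume "x \<in> fset X"
  then have "rank x \<le> Max (insert 0 (fset (fimage rank X)))" by (intro Max_ge) auto
  then show ?thesis by simp
qed

lemma rank_Step: "rank b < rank (Step X b)"
  by simp

lemma computable_approximable: "computable \<epsilon> a M \<Longrightarrow> approximable \<epsilon> a M"
  by (cases a) (simp_all add: computable.simps(2) computable_Step)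

lemma computable_sem: "computable \<epsilon> a M \<Longrightarrow> [] \<turnstile> M : \<tau> \<Longrightarrow> is_env \<epsilon> \<Longrightarrow> a \<in> sem \<epsilon> [] M"
  using approximable_sem[OF computable_approximable] .

lemma inc_typing:
  assumes "\<Gamma> \<turnstile> App (Con (inc i \<sigma> \<tau>)) m : \<rho>" "wfctx \<Gamma>"
  shows "\<Gamma> \<turnstile> m : sel \<sigma> \<tau> i" "Bin Sum \<sigma> \<tau> \<approx> \<rho>" "is_type \<sigma>" "is_type \<tau>"
proof -
  have "ctype (inc i \<sigma> \<tau>) = Bin Arr (sel \<sigma> \<tau> i) (Bin Sum \<sigma> \<tau>)" by (cases i) simp_all
  note * = Con1_typing[OF assms this]
  show "\<Gamma> \<turnstile> m : sel \<sigma> \<tau> i" "Bin Sum \<sigma> \<tau> \<approx> \<rho>" using * by simp_all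
  show "is_type \<sigma>" "is_type \<tau>" using *(4) by (cases i; simp)+
qed

lemma sem_inc: "good_env \<epsilon> \<eta> \<Gamma> \<Longrightarrow> \<Gamma> \<turnstile> m : sel \<sigma> \<tau> i \<Longrightarrow>
    sem \<epsilon> \<eta> (App (Con (inc i \<sigma> \<tau>)) m) = inj_sem i (sem \<epsilon> \<eta> m)"
  by (cases i) (simp_all only: inc_simps sel_simps sem_In0 sem_In1)

lemma computable_reds: "computable \<epsilon> a M \<Longrightarrow> red\<^sup>*\<^sup>* M M' \<Longrightarrow> [] \<turnstile> M : \<tau> \<Longrightarrow> computable \<epsilon> a M'"
proof (induction a arbitrary: M M' \<tau>)
  case (Tag i)
  then show ?case by (simp add: approximable_reds)
next
  case (Inj i a)
  show ?case
    by (intro computable_InjI approximable_reds[OF computable_approximable[OF Inj.prems(1)] Inj.prems(2)])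
      (blast intro: computable_incD[OF Inj.prems(1)] computable_PairD[OF Inj.prems(1)] rtranclp_trans[OF Inj.prems(2)])+
next
  case (Step X b)
  have "computable \<epsilon> b (App M' N)" if N: "[] \<turnstile> App M' N : \<theta>" "computables \<epsilon> X N" for N \<theta>
  proof -
    note M' = subject_reductions[OF Step.prems(2,3) wfctx_simps(1)]
    from App_typing[OF N(1)] obtain \<sigma> \<rho> where *: "[] \<turnstile> M' : Bin Arr \<sigma> \<rho>" "[] \<turnstile> N : \<sigma>" by (elim exE conjE)
    \<comment> \<open>The typing of \<open>App M' N\<close> gives an arrow type to \<open>M'\<close>
      only; uniqueness of types transfers it to \<open>M\<close>.\<close>
    have "[] \<turnstile> M : Bin Arr \<sigma> \<rho>"
      by (rule T_Conv[OF Step.prems(3) typing_is_type[OF *(1) wfctx_simps(1)] typing_unique[OF M' *(1)]])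
    then have MN: "[] \<turnstile> App M N : \<rho>" using *(2) by (rule T_App)
    then have "computable \<epsilon> b (App M N)" using computable_StepD[OF Step.prems(1) _ N(2)] by blast
    then show ?thesis using Step.IH(2) reds_appL[OF Step.prems(2)] MN by blast
  qed
  then show ?case
    using approximable_reds[OF computable_approximable[OF Step.prems(1)] Step.prems(2)] by (simp add: computable_Step)
qed

lemma PS_sel: "sel (PS \<sigma>) (PS \<tau>) i = PS (sel \<sigma> \<tau> i)"
  by (cases i) simp_all

text \<open>Each approximation denotes an element of the domain of \<open>M\<close>, and elements
  are downward closed.\<close>

lemma approximable_down:
  assumes "approximable \<epsilon> a M" "[] \<turnstile> M : \<tau>" "(a', a) \<in> leq (PS \<tau>)" "is_env \<epsilon>" shows "approximable \<epsilon> a' M"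
  unfolding approximable_def
proof (intro allI impI)
  fix M' assume M': "red\<^sup>*\<^sup>* M M'"
  then obtain M'' A where A: "red\<^sup>*\<^sup>* M' M''" "stable_approx [] A M''" "a \<in> sem \<epsilon> [] A"
    using assms(1) unfolding approximable_def by blast
  have "[] \<turnstile> M'' : \<tau>" using subject_reductions[OF rtranclp_trans[OF M' A(1)] assms(2)] by simp
  then have "[] \<turnstile> A : \<tau>" using prefix_typing[OF stable_approx_prefix[OF A(2)]] by simp
  then have "sem \<epsilon> [] A \<in> D \<tau>" using assms(4) by (simp add: sem_D)
  from D_down[OF this A(3) assms(3)] A(1,2)
  show "\<exists>M'' A. red\<^sup>*\<^sup>* M' M'' \<and> stable_approx [] A M'' \<and> a' \<in> sem \<epsilon> [] A" by blast
qed

text \<open>The order of step primes is contravariant in the base: computability of the argument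
  must be passed from \<open>X'\<close> to \<open>X\<close>, so the upper and the lower prime
  exchange roles. The sum of both ranks is symmetric and decreases in either direction, where
  structural induction on one prime would not suffice.\<close>

lemma computable_down: "[] \<turnstile> M : \<tau> \<Longrightarrow> computable \<epsilon> a M \<Longrightarrow> (a', a) \<in> leq (PS \<tau>) \<Longrightarrow> is_env \<epsilon> \<Longrightarrow> computable \<epsilon> a' M"
proof (induction "rank a + rank a'" arbitrary: a a' M \<tau> rule: less_induct)
  case less
  note t = less.prems(1) and c = less.prems(2) and le = less.prems(3) and E = less.prems(4)
  have ap: "approximable \<epsilon> a' M" using computable_approximable[OF c] t le E by (rule approximable_down)
  show ?case
  proof (cases a')
    case (Tag i)
    then show ?thesis using ap by simp
  next
    case (Inj j b')
    have "computable \<epsilon> b' m" if r: "red\<^sup>*\<^sup>* M (App (Con (inc j \<sigma> \<rho>)) m)" for \<sigma> \<rho> m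
    proof -
      note * = inc_typing[OF subject_reductions[OF r t wfctx_simps(1)] wfctx_simps(1)]
      have "(Inj j b', a) \<in> leq (PS (Bin Sum \<sigma> \<rho>))" using le Inj PS_cong[OF *(2)] by simp
      then obtain b where b: "a = Inj j b" "(b', b) \<in> leq (PS (sel \<sigma> \<rho> j))"
        unfolding PS_Sum sum_psys_leq PS_sel by auto
      have "computable \<epsilon> b m" using computable_incD c r b(1) by blast
      then show ?thesis using less.hyps[of b b' m "sel \<sigma> \<rho> j"] b Inj *(1) E by simp
    qed
    moreover have "computable \<epsilon> b' (sel m n j)" if r: "red\<^sup>*\<^sup>* M (Pair' \<sigma> \<rho> m n)" for \<sigma> \<rho> m n
    proof -
      note * = Con2_typing[OF subject_reductions[OF r t wfctx_simps(1)] wfctx_simps(1) ctype.simps(5)]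
      have "(Inj j b', a) \<in> leq (PS (Bin Prod \<sigma> \<rho>))" using le Inj PS_cong[OF *(4)] by simp
      then obtain b where b: "a = Inj j b" "(b', b) \<in> leq (PS (sel \<sigma> \<rho> j))"
        unfolding PS_Prod prod_psys_leq PS_sel by auto
      have "computable \<epsilon> b (sel m n j)" using computable_PairD c r b(1) by blast
      moreover have "[] \<turnstile> sel m n j : sel \<sigma> \<rho> j" using *(1,2) by (cases j) simp_all
      ultimately show ?thesis using less.hyps[of b b' "sel m n j" "sel \<sigma> \<rho> j"] b Inj E by simp
    qed
    ultimately show ?thesis using ap unfolding Inj by (intro computable_InjI)
  next
    case (Step X' b')
    have "computable \<epsilon> b' (App M N)" if N: "[] \<turnstile> App M N : \<theta>" "computables \<epsilon> X' N" for N \<theta>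
    proof -
      from App_typing[OF N(1)] obtain \<sigma> \<rho> where *: "[] \<turnstile> M : Bin Arr \<sigma> \<rho>" "[] \<turnstile> N : \<sigma>" by (elim exE conjE)
      have le': "(Step X' b', a) \<in> leq (PS (Bin Arr \<sigma> \<rho>))"
        using le Step PS_cong[OF typing_unique[OF *(1) t]] by simp
      then obtain X b where a: "a = Step X b" unfolding PS_Arr fun_psys_leq by auto
      from le' have X: "fset X \<subseteq> down (PS \<sigma>) (fset X')" "(b', b) \<in> leq (PS \<rho>)"
        unfolding a Step_leq_PS by simp_all
      have "computable \<epsilon> x N" if x: "x \<in> fset X" for x
      proof -
        from X(1) x obtain x' where x': "x' \<in> fset X'" "(x, x') \<in> leq (PS \<sigma>)" unfolding down_def by blast
        have "rank x' + rank x < rank a + rank a'"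
          using rank_base[OF x, of b] rank_base[OF x'(1), of b'] by (simp only: a Step)
        from less.hyps[OF this *(2) _ x'(2) E] N(2) x'(1) show ?thesis by blast
      qed
      then have "computable \<epsilon> b (App M N)" using computable_StepD[OF c[unfolded a] N(1)] by blast
      moreover have "rank b + rank b' < rank a + rank a'"
        using rank_Step[of b X] rank_Step[of b' X'] by (simp only: a Step)
      ultimately show ?thesis using less.hyps[of b b' "App M N" \<rho>] T_App[OF *] X(2) E by blast
    qed
    then show ?thesis using ap by (simp add: Step computable_Step)
  qed
qed

lemma computables_down:
  assumes "is_env \<epsilon>" "[] \<turnstile> M : \<tau>" "computables \<epsilon> X M" "a \<in> down (PS \<tau>) (fset X)" shows "computable \<epsilon> a M"
proof -
  from assms(4) obtain x where "x \<in> fset X" "(a, x) \<in> leq (PS \<tau>)" unfolding down_def by blast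
  then show ?thesis using computable_down[OF assms(2) _ _ assms(1)] assms(3) by blast
qed

lemma computable_spine:
  "computable \<epsilon> (arrow Xs b) M \<Longrightarrow> list_all2 (computables \<epsilon>) Xs Ns \<Longrightarrow> [] \<turnstile> spine M Ns : \<tau> \<Longrightarrow> computable \<epsilon> b (spine M Ns)"
proof (induction Xs arbitrary: M Ns)
  case (Cons X Xs)
  then obtain N Ks where *: "Ns = N # Ks" "computables \<epsilon> X N" "list_all2 (computables \<epsilon>) Xs Ks"
    by (auto simp: list_all2_Cons1)
  then have t: "[] \<turnstile> spine (App M N) Ks : \<tau>" using Cons.prems(3) by simp
  from spine_typing_head[OF this] obtain \<sigma> where "[] \<turnstile> App M N : \<sigma>" by (elim exE)
  then have "computable \<epsilon> (arrow Xs b) (App M N)" using Cons.prems(1) *(2) unfolding arrow_simps computable_Step by blast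
  from Cons.IH[OF this *(3) t] show ?case by (simp add: *(1))
qed simp

section \<open>Closure under head expansion\<close>

text \<open>Until the head redex is contracted, a step acts inside its body, its argument or one of
  the remaining arguments.\<close>

lemma red_beta_spine:
  "red (spine (App (Lam \<sigma> P) N) Ks) T \<Longrightarrow> T = spine (subst P N 0) Ks \<or>
    (\<exists>P' N' Ks'. T = spine (App (Lam \<sigma> P') N') Ks' \<and> red\<^sup>*\<^sup>* P P' \<and> red\<^sup>*\<^sup>* N N' \<and> list_all2 red\<^sup>*\<^sup>* Ks Ks')"
proof (induction Ks arbitrary: T rule: rev_induct)
  case Nil
  then have "red (App (Lam \<sigma> P) N) T" by simp
  then show ?case
  proof (cases rule: red.cases)
    case (appL M')
    from appL(2) obtain P' where "M' = Lam \<sigma> P'" "red P P'" by (auto elim: red_LamE)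
    then show ?thesis using appL(1)
      by (intro disjI2 exI[of _ P'] exI[of _ N] exI[of _ "[]"]) simp
  next
    case (appR N')
    then show ?thesis by (intro disjI2 exI[of _ P] exI[of _ N'] exI[of _ "[]"]) simp
  qed simp_all
next
  case (snoc K Ks)
  obtain S where S: "S = spine (App (Lam \<sigma> P) N) Ks" by simp
  \<comment> \<open>All rules except beta and the congruences act on terms whose head is a constant,
    so they cannot apply at the root here.\<close>
  then have hd: "head S = Lam \<sigma> P" by simp
  from snoc.prems S have "red (App S K) T" by simp
  then show ?case
  proof (cases rule: red.cases)
    case (beta \<sigma>' M)
    from beta(1) S have "spine (App (Lam \<sigma> P) N) Ks = Lam \<sigma>' M" by simp
    then show ?thesis by (cases Ks rule: rev_cases) simp_all
  next
    case (appL M')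
    from snoc.IH[of M'] appL(2) S have "M' = spine (subst P N 0) Ks \<or>
      (\<exists>P' N' Ks'. M' = spine (App (Lam \<sigma> P') N') Ks' \<and> red\<^sup>*\<^sup>* P P' \<and> red\<^sup>*\<^sup>* N N' \<and> list_all2 red\<^sup>*\<^sup>* Ks Ks')"
      by simp
    then show ?thesis
    proof (elim disjE exE conjE)
      assume "M' = spine (subst P N 0) Ks"
      then show ?thesis using appL(1) by simp
    next
      fix P' N' Ks' assume "M' = spine (App (Lam \<sigma> P') N') Ks'" "red\<^sup>*\<^sup>* P P'" "red\<^sup>*\<^sup>* N N'" "list_all2 red\<^sup>*\<^sup>* Ks Ks'"
      then show ?thesis using appL(1)
        by (intro disjI2 exI[of _ P'] exI[of _ N'] exI[of _ "Ks' @ [K]"]) (simp add: list_all2_appendI)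
    qed
  next
    case (appR K')
    have "list_all2 red\<^sup>*\<^sup>* (Ks @ [K]) (Ks @ [K'])" using reds_list_step[OF appR(2), of Ks "[]"] by simp
    then show ?thesis using appR(1) S
      by (intro disjI2 exI[of _ P] exI[of _ N] exI[of _ "Ks @ [K']"]) simp
  qed (use hd in auto)
qed

text \<open>When the head redex is finally contracted, the reductions made inside its parts before
  can be repeated in the contractum.\<close>

lemma reds_beta_spine:
  "red\<^sup>*\<^sup>* (spine (App (Lam \<sigma> P) N) Ks) T \<Longrightarrow> red\<^sup>*\<^sup>* (spine (subst P N 0) Ks) T \<or>
    (\<exists>P' N' Ks'. T = spine (App (Lam \<sigma> P') N') Ks' \<and> red\<^sup>*\<^sup>* P P' \<and> red\<^sup>*\<^sup>* N N' \<and> list_all2 red\<^sup>*\<^sup>* Ks Ks')"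
proof (induction rule: rtranclp_induct)
  case base
  show ?case
    by (intro disjI2 exI[of _ P] exI[of _ N] exI[of _ Ks]) (simp add: reds_list_refl)
next
  case (step T T')
  from step.IH show ?case
  proof (elim disjE exE conjE)
    assume "red\<^sup>*\<^sup>* (spine (subst P N 0) Ks) T"
    then have "red\<^sup>*\<^sup>* (spine (subst P N 0) Ks) T'" using step.hyps(2) by (rule rtranclp.rtrancl_into_rtrancl)
    then show ?thesis by simp
  next
    fix P' N' Ks' assume T: "T = spine (App (Lam \<sigma> P') N') Ks'" and
      r: "red\<^sup>*\<^sup>* P P'" "red\<^sup>*\<^sup>* N N'" "list_all2 red\<^sup>*\<^sup>* Ks Ks'"
    from red_beta_spine[of \<sigma> P' N' Ks' T'] step.hyps(2) T
    consider "T' = spine (subst P' N' 0) Ks'" | P'' N'' Ks'' where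
      "T' = spine (App (Lam \<sigma> P'') N'') Ks''" "red\<^sup>*\<^sup>* P' P''" "red\<^sup>*\<^sup>* N' N''" "list_all2 red\<^sup>*\<^sup>* Ks' Ks''"
      by auto
    then show ?thesis
    proof cases
      case 1
      have "red\<^sup>*\<^sup>* (subst P N 0) (subst P' N' 0)"
        using rtranclp_trans[OF reds_subst[OF r(1)] reds_subst2[OF r(2)]] .
      from reds_spine[OF this r(3)] show ?thesis using 1 by simp
    next
      case (2 P'' N'' Ks'')
      then show ?thesis
        using rtranclp_trans[OF r(1) 2(2)] rtranclp_trans[OF r(2) 2(3)] reds_list_trans[OF r(3) 2(4)]
        by (intro disjI2 exI[of _ P''] exI[of _ N''] exI[of _ Ks'']) simp
    qed
  qed
qed

text \<open>Every reduct of the expanded spine leads to a reduct of the contracted one, by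
  contracting the head redex if it is still there. This much joinability can be proved
  directly.\<close>

lemma approximable_beta:
  assumes a: "approximable \<epsilon> a (spine (subst P N 0) Ks)" shows "approximable \<epsilon> a (spine (App (Lam \<sigma> P) N) Ks)"
  unfolding approximable_def
proof (intro allI impI)
  fix T assume "red\<^sup>*\<^sup>* (spine (App (Lam \<sigma> P) N) Ks) T"
  from reds_beta_spine[OF this]
  have "\<exists>T'. red\<^sup>*\<^sup>* (spine (subst P N 0) Ks) T' \<and> red\<^sup>*\<^sup>* T T'"
  proof (elim disjE exE conjE)
    fix P' N' Ks' assume *: "T = spine (App (Lam \<sigma> P') N') Ks'" "red\<^sup>*\<^sup>* P P'" "red\<^sup>*\<^sup>* N N'" "list_all2 red\<^sup>*\<^sup>* Ks Ks'"
    have "red T (spine (subst P' N' 0) Ks')" unfolding *(1) by (intro red_spine_cong red.beta)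
    moreover have "red\<^sup>*\<^sup>* (spine (subst P N 0) Ks) (spine (subst P' N' 0) Ks')"
      using reds_spine[OF rtranclp_trans[OF reds_subst[OF *(2)] reds_subst2[OF *(3)]] *(4)] .
    ultimately show ?thesis by blast
  qed blast
  then obtain T' where "red\<^sup>*\<^sup>* (spine (subst P N 0) Ks) T'" and T': "red\<^sup>*\<^sup>* T T'" by (elim exE conjE)
  with a obtain T'' A where "red\<^sup>*\<^sup>* T' T''" "stable_approx [] A T''" "a \<in> sem \<epsilon> [] A" unfolding approximable_def by blast
  then show "\<exists>T'' A. red\<^sup>*\<^sup>* T T'' \<and> stable_approx [] A T'' \<and> a \<in> sem \<epsilon> [] A" using rtranclp_trans[OF T'] by blast
qed

text \<open>The trailing arguments \<open>Ks\<close> carry the induction through step primes, where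
  one more argument is appended.\<close>

lemma computable_beta:
  "computable \<epsilon> a (spine (subst P N 0) Ks) \<Longrightarrow> [] \<turnstile> spine (App (Lam \<sigma> P) N) Ks : \<tau> \<Longrightarrow>
    computable \<epsilon> a (spine (App (Lam \<sigma> P) N) Ks)"
proof (induction a arbitrary: Ks \<tau>)
  case (Tag i)
  then show ?case by (simp add: approximable_beta)
next
  case (Inj i a)
  \<comment> \<open>A term with a constant head no longer contains the head beta redex, so it is a
    reduct of the contractum.\<close>
  have con: "red\<^sup>*\<^sup>* (spine (subst P N 0) Ks) M" if "red\<^sup>*\<^sup>* (spine (App (Lam \<sigma> P) N) Ks) M" "head M = Con c" for M c
    using reds_beta_spine[OF that(1)] that(2) by auto
  show ?case
  proof (rule computable_InjI)
    show "approximable \<epsilon> (Inj i a) (spine (App (Lam \<sigma> P) N) Ks)"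
      by (rule approximable_beta[OF computable_approximable[OF Inj.prems(1)]])
    show "computable \<epsilon> a m" if "red\<^sup>*\<^sup>* (spine (App (Lam \<sigma> P) N) Ks) (App (Con (inc i \<sigma>' \<tau>)) m)" for \<sigma>' \<tau> m
      using computable_incD[OF Inj.prems(1) con[OF that]] by simp
    show "computable \<epsilon> a (sel m n i)" if "red\<^sup>*\<^sup>* (spine (App (Lam \<sigma> P) N) Ks) (Pair' \<sigma>' \<tau> m n)" for \<sigma>' \<tau> m n
      using computable_PairD[OF Inj.prems(1) con[OF that]] by simp
  qed
next
  case (Step X b)
  have "computable \<epsilon> b (App (spine (App (Lam \<sigma> P) N) Ks) K)"
    if K: "[] \<turnstile> App (spine (App (Lam \<sigma> P) N) Ks) K : \<theta>" "computables \<epsilon> X K" for K \<theta>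
  proof -
    have "red (spine (App (Lam \<sigma> P) N) (Ks @ [K])) (spine (subst P N 0) (Ks @ [K]))"
      by (intro red_spine_cong red.beta)
    from subject_reduction[OF this, of "[]" \<theta>] K(1)
    have "[] \<turnstile> App (spine (subst P N 0) Ks) K : \<theta>" by simp
    then have "computable \<epsilon> b (spine (subst P N 0) (Ks @ [K]))" using computable_StepD[OF Step.prems(1) _ K(2)] by simp
    from Step.IH(2)[OF this, of \<theta>] K(1) show ?thesis by simp
  qed
  then show ?case using approximable_beta[OF computable_approximable[OF Step.prems(1)]] by (simp add: computable_Step)
qed

section \<open>Computability of variables and constants\<close>

text \<open>The prime \<open>b\<close> is obtained by applying the semantics of the head to finite sets of primes at
  which the arguments are computable.\<close>

definition computable_spine :: "env \<Rightarrow> trm \<Rightarrow> trm list \<Rightarrow> prime \<Rightarrow> bool" where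
  "computable_spine \<epsilon> h Ns b \<longleftrightarrow> is_head h \<and> (\<exists>Xs. arrow Xs b \<in> sem \<epsilon> [] h \<and> list_all2 (computables \<epsilon>) Xs Ns)"

lemma single_base: "a \<in> primes (PS \<sigma>) \<Longrightarrow> step_base (PS \<sigma>) {|a|}"
  using psys_okD(5)[OF psys_ok_PS] by (simp add: step_base_def)

lemma empty_base: "step_base P {||}"
  by (simp add: step_base_def)

lemma mem_down_single: "a \<in> primes (PS \<sigma>) \<Longrightarrow> a \<in> down (PS \<sigma>) (fset {|a|})"
  using psys_okD(6)[OF psys_ok_PS] by (simp add: down_def)

text \<open>\<open>P\<close> and \<open>Q\<close> record from which branches the prime is to be
  taken. The base chosen for the other branch is empty, so it demands nothing of the corresponding
  term.\<close>

lemma PCase_computable_spine: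
  assumes X: "step_base (PS (Bin Sum \<sigma> \<tau>)) X" "computables \<epsilon> X x" and a: "arrow Xs b \<in> primes (PS \<rho>)"
    and P: "P \<Longrightarrow> computable \<epsilon> (arrow Xs b) y" and Q: "Q \<Longrightarrow> computable \<epsilon> (arrow Xs b) z"
    and c: "P \<and> Q \<or> Tag False \<in> down (PS (Bin Sum \<sigma> \<tau>)) (fset X) \<and> P \<or> Tag True \<in> down (PS (Bin Sum \<sigma> \<tau>)) (fset X) \<and> Q"
    and Ks: "list_all2 (computables \<epsilon>) Xs Ks"
  shows "computable_spine \<epsilon> (Con (PCase \<sigma> \<tau> \<rho>)) (x # y # z # Ks) b"
proof -
  define Y Z where "Y = (if P then {|arrow Xs b|} else {||})" and "Z = (if Q then {|arrow Xs b|} else {||})"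
  have base: "step_base (PS \<rho>) Y" "step_base (PS \<rho>) Z"
    using single_base[OF a] empty_base by (simp_all add: Y_def Z_def)
  have mem: "P \<Longrightarrow> arrow Xs b \<in> down (PS \<rho>) (fset Y)" "Q \<Longrightarrow> arrow Xs b \<in> down (PS \<rho>) (fset Z)"
    using mem_down_single[OF a] by (simp_all add: Y_def Z_def)
  have "arrow (X # Y # Z # Xs) b \<in> csem (PCase \<sigma> \<tau> \<rho>)"
    using X(1) base mem c unfolding csem_PCase arrow_simps Step_mem_Pr pcasef_def by blast
  moreover have "list_all2 (computables \<epsilon>) (X # Y # Z # Xs) (x # y # z # Ks)"
    using X(2) P Q Ks by (simp add: Y_def Z_def)
  ultimately show ?thesis unfolding computable_spine_def sem.simps is_head.simps by blast
qed

text \<open>After distribution \<open>b\<close> must be justified from the new head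
  \<open>inc i\<close>. A tag demands nothing of the argument; for \<open>Inj i a\<close> the
  premise is \<open>a\<close>, and the inner \<open>pcase\<close> is computable at \<open>a\<close>
  by the hypothesis on smaller ranks.\<close>

lemma pcase_inc_computable_spine:
  assumes E: "is_env \<epsilon>"
    and IH: "\<And>b' h Ns \<tau>. rank b' < rank b \<Longrightarrow> [] \<turnstile> spine h Ns : \<tau> \<Longrightarrow> computable_spine \<epsilon> h Ns b' \<Longrightarrow> computable \<epsilon> b' (spine h Ns)"
    and t: "[] \<turnstile> PCase' \<sigma> \<tau> (Bin Sum \<rho>0 \<rho>1) x (App (Con (inc i \<sigma>' \<tau>')) y) (App (Con (inc i \<sigma>'' \<tau>'')) z) : \<theta>"
    and X: "computables \<epsilon> X x" and Y: "computables \<epsilon> Y (App (Con (inc i \<sigma>' \<tau>')) y)"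
    and Z: "computables \<epsilon> Z (App (Con (inc i \<sigma>'' \<tau>'')) z)"
    and b: "Step X (Step Y (Step Z b)) \<in> csem (PCase \<sigma> \<tau> (Bin Sum \<rho>0 \<rho>1))"
  shows "computable_spine \<epsilon> (Con (inc i \<rho>0 \<rho>1)) [PCase' \<sigma> \<tau> (sel \<rho>0 \<rho>1 i) x y z] b"
proof -
  note * = PCase_typing[OF t wfctx_simps(1)]
  note ty = inc_typing[OF *(2) wfctx_simps(1)] and tz = inc_typing[OF *(3) wfctx_simps(1)]
  have g: "good_env \<epsilon> [] []" using E by (simp add: good_env_def)
  have ity: "is_type \<sigma>" "is_type \<tau>" "is_type (sel \<rho>0 \<rho>1 i)" using *(6) by (simp_all add: sel_def)
  let ?S = "PS (Bin Sum \<rho>0 \<rho>1)"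
  from b have XYZ: "step_base (PS (Bin Sum \<sigma> \<tau>)) X" "step_base ?S Y" "step_base ?S Z"
    "b \<in> pcasef (down (PS (Bin Sum \<sigma> \<tau>)) (fset X)) (down ?S (fset Y)) (down ?S (fset Z))"
    unfolding csem_PCase Step_mem_Pr by blast+
  \<comment> \<open>Soundness puts \<open>b\<close> into the semantics of an injection, which
    contains only primes of the block \<open>i\<close>.\<close>
  have mem: "(b = Tag i \<or> (\<exists>a. b = Inj i a)) \<and> (\<forall>a. b = Inj i a \<longrightarrow> computable \<epsilon> a m \<and> a \<in> primes (PS (sel \<rho>0 \<rho>1 i)))"
    if bW: "b \<in> down ?S (fset W)" and W: "step_base ?S W" "computables \<epsilon> W (App (Con (inc i \<alpha> \<beta>)) m)"
      and tm: "[] \<turnstile> App (Con (inc i \<alpha> \<beta>)) m : Bin Sum \<rho>0 \<rho>1" for W \<alpha> \<beta> m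
  proof -
    have cb: "computable \<epsilon> b (App (Con (inc i \<alpha> \<beta>)) m)" by (rule computables_down[OF E tm W(2) bW])
    from computable_sem[OF cb tm E] have "b \<in> inj_sem i (sem \<epsilon> [] m)"
      unfolding sem_inc[OF g inc_typing(1)[OF tm wfctx_simps(1)]] .
    moreover have "computable \<epsilon> a m" if "b = Inj i a" for a
      using computable_incD[OF cb[unfolded that]] by blast
    moreover have "a \<in> primes (PS (sel \<rho>0 \<rho>1 i))" if "b = Inj i a" for a
      using D_prime[OF down_base_D[OF W(1)] bW] that unfolding PS_Sum sum_psys_primes PS_sel by auto
    ultimately show ?thesis by auto
  qed
  note memY = mem[OF _ XYZ(2) Y *(2)] and memZ = mem[OF _ XYZ(3) Z *(3)]
  have inc: "csem (inc i \<rho>0 \<rho>1) = Pr (PS (sel \<rho>0 \<rho>1 i)) (inj_sem i)" by (cases i) simp_all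
  from XYZ(4) have YZ: "b \<in> down ?S (fset Y) \<or> b \<in> down ?S (fset Z)" by (auto simp: pcasef_def)
  then have "b = Tag i \<or> (\<exists>a. b = Inj i a)" using memY memZ by blast
  then show ?thesis
  proof (elim disjE exE)
    assume "b = Tag i"
    then have "arrow [{||}] b \<in> sem \<epsilon> [] (Con (inc i \<rho>0 \<rho>1))"
      by (simp add: inc Step_mem_Pr empty_base)
    then show ?thesis unfolding computable_spine_def by (intro conjI exI[of _ "[{||}]"]) simp_all
  next
    fix a assume ba: "b = Inj i a"
    have a: "a \<in> primes (PS (sel \<rho>0 \<rho>1 i))" using YZ memY memZ ba by blast
    have "computable_spine \<epsilon> (Con (PCase \<sigma> \<tau> (sel \<rho>0 \<rho>1 i))) (x # y # z # []) a"
    proof (rule PCase_computable_spine[OF XYZ(1) X, where Xs = "[]" and P = "b \<in> down ?S (fset Y)" and Q = "b \<in> down ?S (fset Z)"])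
      show "arrow [] a \<in> primes (PS (sel \<rho>0 \<rho>1 i))" using a by simp
      show "computable \<epsilon> (arrow [] a) y" if "b \<in> down ?S (fset Y)" using memY[OF that] ba by simp
      show "computable \<epsilon> (arrow [] a) z" if "b \<in> down ?S (fset Z)" using memZ[OF that] ba by simp
    qed (use XYZ(4) in \<open>auto simp: pcasef_def\<close>)
    moreover have "[] \<turnstile> y : sel \<rho>0 \<rho>1 i" "[] \<turnstile> z : sel \<rho>0 \<rho>1 i"
      using ty tz ity(3) by (cases i; auto simp: tyeq_Bin intro: T_Conv)+
    then have "[] \<turnstile> spine (Con (PCase \<sigma> \<tau> (sel \<rho>0 \<rho>1 i))) [x, y, z] : sel \<rho>0 \<rho>1 i"
      using T_PCase[OF ity *(1)] by simp
    ultimately have "computable \<epsilon> a (PCase' \<sigma> \<tau> (sel \<rho>0 \<rho>1 i) x y z)"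
      using IH[of a "Con (PCase \<sigma> \<tau> (sel \<rho>0 \<rho>1 i))" "[x, y, z]"] ba by simp
    moreover have "arrow [{|a|}] b \<in> sem \<epsilon> [] (Con (inc i \<rho>0 \<rho>1))"
      using mem_down_single[OF a] by (simp add: inc Step_mem_Pr single_base[OF a] ba)
    ultimately show ?thesis unfolding computable_spine_def by (intro conjI exI[of _ "[{|a|}]"]) simp_all
  qed
qed

text \<open>A prime of a product concerns one component only. That component of the new pair is
  computable at \<open>a\<close> by the hypothesis on smaller ranks, and the base for the other
  component is empty.\<close>

lemma pcase_pair_computable_spine:
  assumes E: "is_env \<epsilon>"
    and IH: "\<And>b' h Ns \<tau>. rank b' < rank b \<Longrightarrow> [] \<turnstile> spine h Ns : \<tau> \<Longrightarrow> computable_spine \<epsilon> h Ns b' \<Longrightarrow> computable \<epsilon> b' (spine h Ns)"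
    and t: "[] \<turnstile> PCase' \<sigma> \<tau> (Bin Prod \<rho>1 \<rho>2) x (Pair' \<sigma>' \<tau>' y1 y2) (Pair' \<sigma>'' \<tau>'' z1 z2) : \<theta>"
    and X: "computables \<epsilon> X x" and Y: "computables \<epsilon> Y (Pair' \<sigma>' \<tau>' y1 y2)" and Z: "computables \<epsilon> Z (Pair' \<sigma>'' \<tau>'' z1 z2)"
    and b: "Step X (Step Y (Step Z b)) \<in> csem (PCase \<sigma> \<tau> (Bin Prod \<rho>1 \<rho>2))"
  shows "computable_spine \<epsilon> (Con (Pair \<rho>1 \<rho>2)) [PCase' \<sigma> \<tau> \<rho>1 x y1 z1, PCase' \<sigma> \<tau> \<rho>2 x y2 z2] b"
proof -
  note * = PCase_typing[OF t wfctx_simps(1)]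
  note ty = Pair_typing[OF *(2) wfctx_simps(1)] and tz = Pair_typing[OF *(3) wfctx_simps(1)]
  have g: "good_env \<epsilon> [] []" using E by (simp add: good_env_def)
  let ?S = "PS (Bin Prod \<rho>1 \<rho>2)"
  from b have XYZ: "step_base (PS (Bin Sum \<sigma> \<tau>)) X" "step_base ?S Y" "step_base ?S Z"
    "b \<in> pcasef (down (PS (Bin Sum \<sigma> \<tau>)) (fset X)) (down ?S (fset Y)) (down ?S (fset Z))"
    unfolding csem_PCase Step_mem_Pr by blast+
  from XYZ(4) have YZ: "b \<in> down ?S (fset Y) \<or> b \<in> down ?S (fset Z)" by (auto simp: pcasef_def)
  then have "b \<in> primes ?S" using D_prime down_base_D XYZ(2,3) by blast
  then obtain i a where ba: "b = Inj i a" and a: "a \<in> primes (PS (sel \<rho>1 \<rho>2 i))"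
    unfolding PS_Prod prod_psys_primes PS_sel by blast
  have mem: "computable \<epsilon> a (sel m n i)"
    if bW: "b \<in> down ?S (fset W)" and W: "computables \<epsilon> W (Pair' \<alpha> \<beta> m n)"
      and tm: "[] \<turnstile> Pair' \<alpha> \<beta> m n : Bin Prod \<rho>1 \<rho>2" for W \<alpha> \<beta> m n
    using computable_PairD[OF computables_down[OF E tm W bW, unfolded ba]] by blast
  have "computable_spine \<epsilon> (Con (PCase \<sigma> \<tau> (sel \<rho>1 \<rho>2 i))) (x # sel y1 y2 i # sel z1 z2 i # []) a"
  proof (rule PCase_computable_spine[OF XYZ(1) X, where Xs = "[]" and P = "b \<in> down ?S (fset Y)" and Q = "b \<in> down ?S (fset Z)"])
    show "arrow [] a \<in> primes (PS (sel \<rho>1 \<rho>2 i))" using a by simp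
    show "computable \<epsilon> (arrow [] a) (sel y1 y2 i)" if "b \<in> down ?S (fset Y)" using mem[OF that Y *(2)] by simp
    show "computable \<epsilon> (arrow [] a) (sel z1 z2 i)" if "b \<in> down ?S (fset Z)" using mem[OF that Z *(3)] by simp
  qed (use XYZ(4) in \<open>auto simp: pcasef_def\<close>)
  moreover have "[] \<turnstile> spine (Con (PCase \<sigma> \<tau> (sel \<rho>1 \<rho>2 i))) [x, sel y1 y2 i, sel z1 z2 i] : sel \<rho>1 \<rho>2 i"
    using *(1,6) ty(1,2) tz(1,2) by (cases i) (simp_all add: T_PCase)
  ultimately have c: "computable \<epsilon> a (PCase' \<sigma> \<tau> (sel \<rho>1 \<rho>2 i) x (sel y1 y2 i) (sel z1 z2 i))"
    using IH[of a "Con (PCase \<sigma> \<tau> (sel \<rho>1 \<rho>2 i))" "[x, sel y1 y2 i, sel z1 z2 i]"] ba by simp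
  show ?thesis
  proof (cases i)
    case False
    have "arrow [{|a|}, {||}] b \<in> sem \<epsilon> [] (Con (Pair \<rho>1 \<rho>2))"
      using mem_down_single[OF a] single_base[OF a] False
      by (simp add: ba Step_mem_Pr empty_base mem_pair_sem)
    then show ?thesis using c False unfolding computable_spine_def by (intro conjI exI[of _ "[{|a|}, {||}]"]) simp_all
  next
    case True
    have "arrow [{||}, {|a|}] b \<in> sem \<epsilon> [] (Con (Pair \<rho>1 \<rho>2))"
      using mem_down_single[OF a] single_base[OF a] True
      by (simp add: ba Step_mem_Pr empty_base mem_pair_sem)
    then show ?thesis using c True unfolding computable_spine_def by (intro conjI exI[of _ "[{||}, {|a|}]"]) simp_all
  qed
qed


text \<open>Computability implies membership in the semantics, and the semantics of an injection has
  only primes of its own block. This determines the branch that \<open>case\<close> or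
  \<open>pcase\<close> takes.\<close>

lemma inc_down:
  assumes E: "is_env \<epsilon>" and t: "[] \<turnstile> App (Con (inc i \<sigma>' \<tau>')) x : Bin Sum \<sigma> \<tau>"
    and c: "computables \<epsilon> X (App (Con (inc i \<sigma>' \<tau>')) x)" and u: "u \<in> down (PS (Bin Sum \<sigma> \<tau>)) (fset X)"
  shows "u = Tag i \<or> (\<exists>w. u = Inj i w \<and> computable \<epsilon> w x)"
proof -
  note cu = computables_down[OF E t c u]
  have "good_env \<epsilon> [] []" using E by (simp add: good_env_def)
  note s = sem_inc[OF this inc_typing(1)[OF t wfctx_simps(1)]]
  from computable_sem[OF cu t E] consider "u = Tag i" | w where "u = Inj i w" unfolding s by auto
  then show ?thesis
  proof cases
    case (2 w)
    then show ?thesis using computable_incD[OF cu[unfolded 2] rtranclp.rtrancl_refl] by blast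
  qed simp
qed

text \<open>The tag found below \<open>X\<close> must be that of the injection, so \<open>b\<close>
  comes from the selected branch. Its premises \<open>W\<close> occur as injected primes below
  \<open>X\<close>, which makes \<open>x\<close> computable at them.\<close>

lemma case_inc_computable:
  assumes E: "is_env \<epsilon>" and t: "[] \<turnstile> Case' \<sigma> \<tau> \<rho> (App (Con (inc i \<sigma>' \<tau>')) x) y z : \<theta>"
    and X: "computables \<epsilon> X (App (Con (inc i \<sigma>' \<tau>')) x)" and Y: "computables \<epsilon> Y y" and Z: "computables \<epsilon> Z z"
    and b: "Step X (Step Y (Step Z b)) \<in> csem (Case \<sigma> \<tau> \<rho>)"
  shows "computable \<epsilon> b (App (sel y z i) x)"
proof -
  note * = Case_typing[OF t wfctx_simps(1)]
  note tx = inc_typing[OF *(1) wfctx_simps(1)]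
  from *(6) have ty: "is_type (sel \<sigma> \<tau> i)" by (simp add: sel_def)
  have x: "[] \<turnstile> x : sel \<sigma> \<tau> i"
    using tx(1,2) ty by (cases i) (auto simp: tyeq_Bin intro: T_Conv)
  note dn = inc_down[OF E *(1) X]
  from b have "b \<in> casef (down (PS (Bin Sum \<sigma> \<tau>)) (fset X)) (down (PS (Bin Arr \<sigma> \<rho>)) (fset Y))
      (down (PS (Bin Arr \<tau> \<rho>)) (fset Z))"
    unfolding csem_Case Step_mem_Pr by blast
  then show ?thesis
  proof (cases rule: casef_E)
    case (1 W)
    have i: "i = False" using dn[OF 1(1)] by simp
    have "computables \<epsilon> W x"
    proof
      fix w assume "w \<in> fset W"
      then have "Inj False w \<in> down (PS (Bin Sum \<sigma> \<tau>)) (fset X)" using 1(2) by blast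
      from dn[OF this] show "computable \<epsilon> w x" by simp
    qed
    moreover have "[] \<turnstile> App y x : \<rho>" using T_App[OF *(2)] x i by simp
    ultimately show ?thesis using computable_StepD[OF computables_down[OF E *(2) Y 1(3)]] i by simp
  next
    case (2 W)
    have i: "i = True" using dn[OF 2(1)] by simp
    have "computables \<epsilon> W x"
    proof
      fix w assume "w \<in> fset W"
      then have "Inj True w \<in> down (PS (Bin Sum \<sigma> \<tau>)) (fset X)" using 2(2) by blast
      from dn[OF this] show "computable \<epsilon> w x" by simp
    qed
    moreover have "[] \<turnstile> App z x : \<rho>" using T_App[OF *(3)] x i by simp
    ultimately show ?thesis using computable_StepD[OF computables_down[OF E *(3) Z 2(3)]] i by simp
  qed
qed

text \<open>If \<open>b\<close> is known from both branches, either of them will do; if it is known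
  from one branch and a tag, the tag agrees with the injection.\<close>

lemma pcase_inc_computable:
  assumes E: "is_env \<epsilon>" and t: "[] \<turnstile> PCase' \<sigma> \<tau> \<rho> (App (Con (inc i \<sigma>' \<tau>')) x) y z : \<theta>"
    and X: "computables \<epsilon> X (App (Con (inc i \<sigma>' \<tau>')) x)" and Y: "computables \<epsilon> Y y" and Z: "computables \<epsilon> Z z"
    and b: "Step X (Step Y (Step Z b)) \<in> csem (PCase \<sigma> \<tau> \<rho>)"
  shows "computable \<epsilon> b (sel y z i)"
proof -
  note * = PCase_typing[OF t wfctx_simps(1)]
  note dn = inc_down[OF E *(1) X]
  from b have "b \<in> pcasef (down (PS (Bin Sum \<sigma> \<tau>)) (fset X)) (down (PS \<rho>) (fset Y)) (down (PS \<rho>) (fset Z))"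
    unfolding csem_PCase Step_mem_Pr by blast
  then consider "b \<in> down (PS \<rho>) (fset Y)" "b \<in> down (PS \<rho>) (fset Z)"
    | "Tag False \<in> down (PS (Bin Sum \<sigma> \<tau>)) (fset X)" "b \<in> down (PS \<rho>) (fset Y)"
    | "Tag True \<in> down (PS (Bin Sum \<sigma> \<tau>)) (fset X)" "b \<in> down (PS \<rho>) (fset Z)"
    by (auto simp: pcasef_def)
  then show ?thesis
  proof cases
    case 1
    then show ?thesis using computables_down[OF E *(2) Y] computables_down[OF E *(3) Z] by (cases i) simp_all
  next
    case 2
    then show ?thesis using dn[OF 2(1)] computables_down[OF E *(2) Y] by simp
  next
    case 3
    then show ?thesis using dn[OF 3(1)] computables_down[OF E *(3) Z] by simp
  qed
qed

text \<open>A \<open>pcase\<close> at a sum or product type is not applied any further, so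
  distributing it over a constructor leaves one or two arguments in place of three.\<close>

lemma spine_no_args:
  assumes "[] \<turnstile> spine M Ks : \<theta>" "[] \<turnstile> M : Bin c \<sigma> \<tau>" "c \<noteq> Arr" shows "Ks = []"
proof (cases Ks)
  case (Cons K Ks')
  then obtain \<theta>' where "[] \<turnstile> App M K : \<theta>'" using spine_typing_head[of "[]" "App M K" Ks'] assms(1) by auto
  from App_typing[OF this] obtain \<sigma>' \<tau>' where "[] \<turnstile> M : Bin Arr \<sigma>' \<tau>'" by (elim exE conjE)
  from typing_unique[OF assms(2) this] assms(3) show ?thesis by (simp add: tyeq_Bin)
qed simp

lemma list_all2_Cons_obtain:
  assumes "list_all2 R Xs (N # Ns)"
  obtains X Ys where "Xs = X # Ys" "R X N" "list_all2 R Ys Ns"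
  using assms by (auto simp: list_all2_Cons2)

text \<open>The second alternative arises when \<open>pcase\<close> is distributed over \<open>0\<close>, \<open>1\<close>, \<open>pair\<close> or an
  application; the number of arguments decreases, so an inert spine is reached eventually.\<close>

lemma contracts_computable_spine:
  assumes E: "is_env \<epsilon>"
    and IH: "\<And>b' h Ns \<tau>. rank b' < rank b \<Longrightarrow> [] \<turnstile> spine h Ns : \<tau> \<Longrightarrow> computable_spine \<epsilon> h Ns b' \<Longrightarrow> computable \<epsilon> b' (spine h Ns)"
    and t: "[] \<turnstile> spine h Ns : \<theta>" and Q: "computable_spine \<epsilon> h Ns b" and c: "contracts h Ns T"
  shows "computable \<epsilon> b T \<or> (\<exists>h' Ns'. T = spine h' Ns' \<and> length Ns' < length Ns \<and> computable_spine \<epsilon> h' Ns' b)"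
proof -
  have tT: "[] \<turnstile> T : \<theta>" using subject_reduction[OF contracts_red[OF c] t] by simp
  from Q obtain Xs where b: "arrow Xs b \<in> sem \<epsilon> [] h" and args: "list_all2 (computables \<epsilon>) Xs Ns"
    unfolding computable_spine_def by blast
  from c show ?thesis
  proof (cases rule: contracts.cases)
    case (1 \<sigma> \<tau> \<rho> \<sigma>' \<tau>' x y z Ks)
    from args[unfolded 1] obtain X Y Z Xs' where X: "Xs = X # Y # Z # Xs'" "computables \<epsilon> X (In0' \<sigma>' \<tau>' x)"
      "computables \<epsilon> Y y" "computables \<epsilon> Z z" "list_all2 (computables \<epsilon>) Xs' Ks" by (elim list_all2_Cons_obtain) blast
    from t[unfolded 1] have "[] \<turnstile> spine (Case' \<sigma> \<tau> \<rho> (In0' \<sigma>' \<tau>' x) y z) Ks : \<theta>" by simp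
    from spine_typing_head[OF this] obtain \<theta>' where "[] \<turnstile> Case' \<sigma> \<tau> \<rho> (In0' \<sigma>' \<tau>' x) y z : \<theta>'" by (elim exE)
    from case_inc_computable[where i = False, unfolded inc_simps sel_simps, OF E this X(2-4)] b
    have "computable \<epsilon> (arrow Xs' b) (App y x)" by (simp add: 1 X(1) del: csem.simps)
    from computable_spine[OF this X(5)] tT show ?thesis by (simp add: 1)
  next
    case (2 \<sigma> \<tau> \<rho> \<sigma>' \<tau>' x y z Ks)
    from args[unfolded 2] obtain X Y Z Xs' where X: "Xs = X # Y # Z # Xs'" "computables \<epsilon> X (In1' \<sigma>' \<tau>' x)"
      "computables \<epsilon> Y y" "computables \<epsilon> Z z" "list_all2 (computables \<epsilon>) Xs' Ks" by (elim list_all2_Cons_obtain) blast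
    from t[unfolded 2] have "[] \<turnstile> spine (Case' \<sigma> \<tau> \<rho> (In1' \<sigma>' \<tau>' x) y z) Ks : \<theta>" by simp
    from spine_typing_head[OF this] obtain \<theta>' where "[] \<turnstile> Case' \<sigma> \<tau> \<rho> (In1' \<sigma>' \<tau>' x) y z : \<theta>'" by (elim exE)
    from case_inc_computable[where i = True, unfolded inc_simps sel_simps, OF E this X(2-4)] b
    have "computable \<epsilon> (arrow Xs' b) (App z x)" by (simp add: 2 X(1) del: csem.simps)
    from computable_spine[OF this X(5)] tT show ?thesis by (simp add: 2)
  next
    case (3 \<sigma> \<tau> \<sigma>' \<tau>' x y Ks)
    from args[unfolded 3] obtain X Xs' where X: "Xs = X # Xs'" "computables \<epsilon> X (Pair' \<sigma>' \<tau>' x y)"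
      "list_all2 (computables \<epsilon>) Xs' Ks" by (elim list_all2_Cons_obtain) blast
    from t[unfolded 3] have "[] \<turnstile> spine (App (Con (Fst \<sigma> \<tau>)) (Pair' \<sigma>' \<tau>' x y)) Ks : \<theta>" by simp
    from spine_typing_head[OF this] obtain \<theta>' where "[] \<turnstile> App (Con (Fst \<sigma> \<tau>)) (Pair' \<sigma>' \<tau>' x y) : \<theta>'" by (elim exE)
    note * = Fst_typing[OF this wfctx_simps(1)]
    from b have "Step X (arrow Xs' b) \<in> csem (Fst \<sigma> \<tau>)" by (simp add: 3 X(1) del: csem.simps)
    then have "Inj False (arrow Xs' b) \<in> down (PS (Bin Prod \<sigma> \<tau>)) (fset X)"
      unfolding csem_Fst Step_mem_Pr proj_def by blast
    from computable_PairD[OF computables_down[OF E *(1) X(2) this] rtranclp.rtrancl_refl]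
    have "computable \<epsilon> (arrow Xs' b) x" by simp
    from computable_spine[OF this X(3)] tT show ?thesis by (simp add: 3)
  next
    case (4 \<sigma> \<tau> \<sigma>' \<tau>' x y Ks)
    from args[unfolded 4] obtain X Xs' where X: "Xs = X # Xs'" "computables \<epsilon> X (Pair' \<sigma>' \<tau>' x y)"
      "list_all2 (computables \<epsilon>) Xs' Ks" by (elim list_all2_Cons_obtain) blast
    from t[unfolded 4] have "[] \<turnstile> spine (App (Con (Snd \<sigma> \<tau>)) (Pair' \<sigma>' \<tau>' x y)) Ks : \<theta>" by simp
    from spine_typing_head[OF this] obtain \<theta>' where "[] \<turnstile> App (Con (Snd \<sigma> \<tau>)) (Pair' \<sigma>' \<tau>' x y) : \<theta>'" by (elim exE)
    note * = Snd_typing[OF this wfctx_simps(1)]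
    from b have "Step X (arrow Xs' b) \<in> csem (Snd \<sigma> \<tau>)" by (simp add: 4 X(1) del: csem.simps)
    then have "Inj True (arrow Xs' b) \<in> down (PS (Bin Prod \<sigma> \<tau>)) (fset X)"
      unfolding csem_Snd Step_mem_Pr proj_def by blast
    from computable_PairD[OF computables_down[OF E *(1) X(2) this] rtranclp.rtrancl_refl]
    have "computable \<epsilon> (arrow Xs' b) y" by simp
    from computable_spine[OF this X(3)] tT show ?thesis by (simp add: 4)
  next
    case (5 \<sigma> \<tau> \<rho> \<sigma>' \<tau>' x y z Ks)
    from args[unfolded 5] obtain X Y Z Xs' where X: "Xs = X # Y # Z # Xs'" "computables \<epsilon> X (In0' \<sigma>' \<tau>' x)"
      "computables \<epsilon> Y y" "computables \<epsilon> Z z" "list_all2 (computables \<epsilon>) Xs' Ks" by (elim list_all2_Cons_obtain) blast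
    from t[unfolded 5] have "[] \<turnstile> spine (PCase' \<sigma> \<tau> \<rho> (In0' \<sigma>' \<tau>' x) y z) Ks : \<theta>" by simp
    from spine_typing_head[OF this] obtain \<theta>' where "[] \<turnstile> PCase' \<sigma> \<tau> \<rho> (In0' \<sigma>' \<tau>' x) y z : \<theta>'" by (elim exE)
    from pcase_inc_computable[where i = False, unfolded inc_simps sel_simps, OF E this X(2-4)] b
    have "computable \<epsilon> (arrow Xs' b) y" by (simp add: 5 X(1) del: csem.simps)
    from computable_spine[OF this X(5)] tT show ?thesis by (simp add: 5)
  next
    case (6 \<sigma> \<tau> \<rho> \<sigma>' \<tau>' x y z Ks)
    from args[unfolded 6] obtain X Y Z Xs' where X: "Xs = X # Y # Z # Xs'" "computables \<epsilon> X (In1' \<sigma>' \<tau>' x)"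
      "computables \<epsilon> Y y" "computables \<epsilon> Z z" "list_all2 (computables \<epsilon>) Xs' Ks" by (elim list_all2_Cons_obtain) blast
    from t[unfolded 6] have "[] \<turnstile> spine (PCase' \<sigma> \<tau> \<rho> (In1' \<sigma>' \<tau>' x) y z) Ks : \<theta>" by simp
    from spine_typing_head[OF this] obtain \<theta>' where "[] \<turnstile> PCase' \<sigma> \<tau> \<rho> (In1' \<sigma>' \<tau>' x) y z : \<theta>'" by (elim exE)
    from pcase_inc_computable[where i = True, unfolded inc_simps sel_simps, OF E this X(2-4)] b
    have "computable \<epsilon> (arrow Xs' b) z" by (simp add: 6 X(1) del: csem.simps)
    from computable_spine[OF this X(5)] tT show ?thesis by (simp add: 6)
  next
    case (7 \<sigma> \<tau> \<rho>0 \<rho>1 x \<sigma>' \<tau>' y \<sigma>'' \<tau>'' z Ks)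
    from args[unfolded 7] obtain X Y Z Xs' where X: "Xs = X # Y # Z # Xs'" "computables \<epsilon> X x"
      "computables \<epsilon> Y (In0' \<sigma>' \<tau>' y)" "computables \<epsilon> Z (In0' \<sigma>'' \<tau>'' z)" "list_all2 (computables \<epsilon>) Xs' Ks"
      by (elim list_all2_Cons_obtain) blast
    from t[unfolded 7] have t': "[] \<turnstile> spine (PCase' \<sigma> \<tau> (Bin Sum \<rho>0 \<rho>1) x (In0' \<sigma>' \<tau>' y) (In0' \<sigma>'' \<tau>'' z)) Ks : \<theta>" by simp
    from spine_typing_head[OF t'] obtain \<theta>' where
      p: "[] \<turnstile> PCase' \<sigma> \<tau> (Bin Sum \<rho>0 \<rho>1) x (In0' \<sigma>' \<tau>' y) (In0' \<sigma>'' \<tau>'' z) : \<theta>'" by (elim exE)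
    have Ks: "Ks = []" using spine_no_args[OF t' PCase_typing(4)[OF p wfctx_simps(1)]] by simp
    then have Xs': "Xs' = []" using X(5) by simp
    from pcase_inc_computable_spine[where i = False, unfolded inc_simps sel_simps, OF E IH p X(2-4)] b
    have "computable_spine \<epsilon> (Con (In0 \<rho>0 \<rho>1)) [PCase' \<sigma> \<tau> \<rho>0 x y z] b" by (simp add: 7 X(1) Xs' del: csem.simps)
    then show ?thesis by (intro disjI2 exI[of _ "Con (In0 \<rho>0 \<rho>1)"] exI[of _ "[PCase' \<sigma> \<tau> \<rho>0 x y z]"]) (simp add: 7 Ks)
  next
    case (8 \<sigma> \<tau> \<rho>0 \<rho>1 x \<sigma>' \<tau>' y \<sigma>'' \<tau>'' z Ks)
    from args[unfolded 8] obtain X Y Z Xs' where X: "Xs = X # Y # Z # Xs'" "computables \<epsilon> X x"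
      "computables \<epsilon> Y (In1' \<sigma>' \<tau>' y)" "computables \<epsilon> Z (In1' \<sigma>'' \<tau>'' z)" "list_all2 (computables \<epsilon>) Xs' Ks"
      by (elim list_all2_Cons_obtain) blast
    from t[unfolded 8] have t': "[] \<turnstile> spine (PCase' \<sigma> \<tau> (Bin Sum \<rho>0 \<rho>1) x (In1' \<sigma>' \<tau>' y) (In1' \<sigma>'' \<tau>'' z)) Ks : \<theta>" by simp
    from spine_typing_head[OF t'] obtain \<theta>' where
      p: "[] \<turnstile> PCase' \<sigma> \<tau> (Bin Sum \<rho>0 \<rho>1) x (In1' \<sigma>' \<tau>' y) (In1' \<sigma>'' \<tau>'' z) : \<theta>'" by (elim exE)
    have Ks: "Ks = []" using spine_no_args[OF t' PCase_typing(4)[OF p wfctx_simps(1)]] by simp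
    then have Xs': "Xs' = []" using X(5) by simp
    from pcase_inc_computable_spine[where i = True, unfolded inc_simps sel_simps, OF E IH p X(2-4)] b
    have "computable_spine \<epsilon> (Con (In1 \<rho>0 \<rho>1)) [PCase' \<sigma> \<tau> \<rho>1 x y z] b" by (simp add: 8 X(1) Xs' del: csem.simps)
    then show ?thesis by (intro disjI2 exI[of _ "Con (In1 \<rho>0 \<rho>1)"] exI[of _ "[PCase' \<sigma> \<tau> \<rho>1 x y z]"]) (simp add: 8 Ks)
  next
    case (9 \<sigma> \<tau> \<rho>1 \<rho>2 x \<sigma>' \<tau>' y1 y2 \<sigma>'' \<tau>'' z1 z2 Ks)
    from args[unfolded 9] obtain X Y Z Xs' where X: "Xs = X # Y # Z # Xs'" "computables \<epsilon> X x"
      "computables \<epsilon> Y (Pair' \<sigma>' \<tau>' y1 y2)" "computables \<epsilon> Z (Pair' \<sigma>'' \<tau>'' z1 z2)" "list_all2 (computables \<epsilon>) Xs' Ks"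
      by (elim list_all2_Cons_obtain) blast
    from t[unfolded 9] have t': "[] \<turnstile> spine (PCase' \<sigma> \<tau> (Bin Prod \<rho>1 \<rho>2) x (Pair' \<sigma>' \<tau>' y1 y2) (Pair' \<sigma>'' \<tau>'' z1 z2)) Ks : \<theta>" by simp
    from spine_typing_head[OF t'] obtain \<theta>' where
      p: "[] \<turnstile> PCase' \<sigma> \<tau> (Bin Prod \<rho>1 \<rho>2) x (Pair' \<sigma>' \<tau>' y1 y2) (Pair' \<sigma>'' \<tau>'' z1 z2) : \<theta>'" by (elim exE)
    have Ks: "Ks = []" using spine_no_args[OF t' PCase_typing(4)[OF p wfctx_simps(1)]] by simp
    then have Xs': "Xs' = []" using X(5) by simp
    from pcase_pair_computable_spine[OF E IH p X(2-4)] b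
    have "computable_spine \<epsilon> (Con (Pair \<rho>1 \<rho>2)) [PCase' \<sigma> \<tau> \<rho>1 x y1 z1, PCase' \<sigma> \<tau> \<rho>2 x y2 z2] b"
      by (simp add: 9 X(1) Xs' del: csem.simps)
    then show ?thesis
      by (intro disjI2 exI[of _ "Con (Pair \<rho>1 \<rho>2)"] exI[of _ "[PCase' \<sigma> \<tau> \<rho>1 x y1 z1, PCase' \<sigma> \<tau> \<rho>2 x y2 z2]"])
        (simp add: 9 Ks)
  next
    case (10 \<sigma> \<tau> \<rho>1 \<rho>2 x y z w Ks)
    let ?R = "Bin Arr \<rho>1 \<rho>2"
    from args[unfolded 10] obtain X Y Z W Xs' where X: "Xs = X # Y # Z # W # Xs'" "computables \<epsilon> X x"
      "computables \<epsilon> Y y" "computables \<epsilon> Z z" "computables \<epsilon> W w" "list_all2 (computables \<epsilon>) Xs' Ks"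
      by (elim list_all2_Cons_obtain) blast
    from t[unfolded 10] have t': "[] \<turnstile> spine (App (PCase' \<sigma> \<tau> ?R x y z) w) Ks : \<theta>" by simp
    from spine_typing_head[OF t'] obtain \<theta>' where p: "[] \<turnstile> App (PCase' \<sigma> \<tau> ?R x y z) w : \<theta>'" by (elim exE)
    from App_typing[OF p] obtain \<alpha> \<beta> where "[] \<turnstile> PCase' \<sigma> \<tau> ?R x y z : Bin Arr \<alpha> \<beta>" by (elim exE conjE)
    note * = PCase_typing[OF this wfctx_simps(1)]
    note tw = App_typing_fun(1)[OF p *(4) wfctx_simps(1)]
    let ?b = "arrow Xs' b"
    from b have "Step X (Step Y (Step Z (Step W ?b))) \<in> csem (PCase \<sigma> \<tau> ?R)" by (simp add: 10 X(1) del: csem.simps)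
    then have XYZ: "step_base (PS (Bin Sum \<sigma> \<tau>)) X" "step_base (PS ?R) Y" "step_base (PS ?R) Z"
      "Step W ?b \<in> pcasef (down (PS (Bin Sum \<sigma> \<tau>)) (fset X)) (down (PS ?R) (fset Y)) (down (PS ?R) (fset Z))"
      unfolding csem_PCase Step_mem_Pr by blast+
    \<comment> \<open>Membership of the target among the primes of \<open>\<rho>2\<close> is
      required because its singleton becomes the base for the new branches.\<close>
    then have "Step W ?b \<in> down (PS ?R) (fset Y) \<or> Step W ?b \<in> down (PS ?R) (fset Z)" by (auto simp: pcasef_def)
    then have "Step W ?b \<in> primes (PS ?R)" using D_prime down_base_D XYZ(2,3) by blast
    then have pb: "?b \<in> primes (PS \<rho>2)" by (simp add: Step_prime_PS)
    have "computable_spine \<epsilon> (Con (PCase \<sigma> \<tau> \<rho>2)) (x # App y w # App z w # Ks) b"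
    proof (rule PCase_computable_spine[OF XYZ(1) X(2) pb])
      show "computable \<epsilon> ?b (App y w)" if "Step W ?b \<in> down (PS ?R) (fset Y)"
        by (rule computable_StepD[OF computables_down[OF E *(2) X(3) that] T_App[OF *(2) tw] X(5)])
      show "computable \<epsilon> ?b (App z w)" if "Step W ?b \<in> down (PS ?R) (fset Z)"
        by (rule computable_StepD[OF computables_down[OF E *(3) X(4) that] T_App[OF *(3) tw] X(5)])
      show "list_all2 (computables \<epsilon>) Xs' Ks" by (rule X(6))
    qed (use XYZ(4) in \<open>auto simp: pcasef_def\<close>)
    then show ?thesis
      by (intro disjI2 exI[of _ "Con (PCase \<sigma> \<tau> \<rho>2)"] exI[of _ "x # App y w # App z w # Ks"]) (simp add: 10)
  qed
qed

lemma computable_spine_reds: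
  assumes Q: "computable_spine \<epsilon> h Ns b" and t: "[] \<turnstile> spine h Ns : \<tau>" and r: "list_all2 red\<^sup>*\<^sup>* Ns Ns'"
  shows "computable_spine \<epsilon> h Ns' b"
proof -
  from Q obtain Xs where h: "is_head h" and b: "arrow Xs b \<in> sem \<epsilon> [] h" and args: "list_all2 (computables \<epsilon>) Xs Ns"
    unfolding computable_spine_def by blast
  have "list_all2 (computables \<epsilon>) Xs Ns'"
    unfolding list_all2_conv_all_nth
  proof (intro conjI allI impI ballI)
    show "length Xs = length Ns'" using args r by (simp add: list_all2_conv_all_nth)
    fix i x assume i: "i < length Xs" and x: "x \<in> fset (Xs ! i)"
    then have l: "i < length Ns" using args by (simp add: list_all2_conv_all_nth)
    from spine_typing_args[OF t nth_mem[OF l]] obtain \<sigma> where "[] \<turnstile> Ns ! i : \<sigma>" by (elim exE)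
    moreover have "red\<^sup>*\<^sup>* (Ns ! i) (Ns' ! i)" using r l by (simp add: list_all2_conv_all_nth)
    moreover have "computable \<epsilon> x (Ns ! i)" using list_all2_nthD[OF args i] x by blast
    ultimately show "computable \<epsilon> x (Ns' ! i)" using computable_reds by blast
  qed
  then show ?thesis using h b unfolding computable_spine_def by blast
qed

text \<open>Reducing arguments keeps their number, so a head contraction leads to a computable term
  or to a shorter spine; an inert spine is approximated argumentwise.\<close>

lemma computable_spine_stable_approx:
  assumes E: "is_env \<epsilon>"
    and IH: "\<And>b' h Ns \<tau>. rank b' < rank b \<Longrightarrow> [] \<turnstile> spine h Ns : \<tau> \<Longrightarrow> computable_spine \<epsilon> h Ns b' \<Longrightarrow> computable \<epsilon> b' (spine h Ns)"
  shows "[] \<turnstile> spine h Ns : \<tau> \<Longrightarrow> computable_spine \<epsilon> h Ns b \<Longrightarrow>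
    \<exists>M A. red\<^sup>*\<^sup>* (spine h Ns) M \<and> stable_approx [] A M \<and> b \<in> sem \<epsilon> [] A"
proof (induction "length Ns" arbitrary: h Ns rule: less_induct)
  case less
  note t = less.prems(1) and Q = less.prems(2)
  from Q obtain Xs where h: "is_head h" and b: "arrow Xs b \<in> sem \<epsilon> [] h" and args: "list_all2 (computables \<epsilon>) Xs Ns"
    unfolding computable_spine_def by blast
  show ?case
  proof (cases "inert h Ns")
    case True
    have "list_all2 (\<lambda>X N. \<forall>a\<in>fset X. approximable \<epsilon> a N) Xs Ns"
      using args by (rule list_all2_mono) (simp add: computable_approximable)
    from inert_approximable[OF h True t this b] show ?thesis .
  next
    case False
    then obtain Ns1 T where r: "list_all2 red\<^sup>*\<^sup>* Ns Ns1" and c: "contracts h Ns1 T" unfolding inert_def by blast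
    have r1: "red\<^sup>*\<^sup>* (spine h Ns) (spine h Ns1)" by (rule reds_spine[OF rtranclp.rtrancl_refl r])
    then have rT: "red\<^sup>*\<^sup>* (spine h Ns) T" using contracts_red[OF c] by (rule rtranclp.rtrancl_into_rtrancl)
    have t1: "[] \<turnstile> spine h Ns1 : \<tau>" using subject_reductions[OF r1 t] by simp
    have "computable \<epsilon> b T \<or> (\<exists>h' Ns'. T = spine h' Ns' \<and> length Ns' < length Ns1 \<and> computable_spine \<epsilon> h' Ns' b)"
      by (rule contracts_computable_spine[OF E _ t1 computable_spine_reds[OF Q t r] c]) (rule IH)
    then have "\<exists>M A. red\<^sup>*\<^sup>* T M \<and> stable_approx [] A M \<and> b \<in> sem \<epsilon> [] A"
    proof (elim disjE exE conjE)
      assume "computable \<epsilon> b T"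
      then show ?thesis using computable_approximable rtranclp.rtrancl_refl unfolding approximable_def by blast
    next
      fix h' Ns' assume *: "T = spine h' Ns'" "length Ns' < length Ns1" "computable_spine \<epsilon> h' Ns' b"
      have "length Ns' < length Ns" using *(2) list_all2_lengthD[OF r] by simp
      moreover have "[] \<turnstile> spine h' Ns' : \<tau>" using subject_reductions[OF rT t] *(1) by simp
      ultimately show ?thesis using less.hyps[of Ns' h'] *(1,3) by blast
    qed
    then show ?thesis using rtranclp_trans[OF rT] by blast
  qed
qed

text \<open>The fact \<open>reach\<close> is an invariant of reduction: each reduct is computable at
  \<open>b\<close> or is again a spine that justifies \<open>b\<close>. It yields approximability
  below every reduct as well as the clauses for constructors; the clause for step primes is the
  induction hypothesis.\<close>

lemma computable_computable_spine: "is_env \<epsilon> \<Longrightarrow> [] \<turnstile> spine h Ns : \<tau> \<Longrightarrow> computable_spine \<epsilon> h Ns b \<Longrightarrow> computable \<epsilon> b (spine h Ns)"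
proof (induction "rank b" arbitrary: h Ns \<tau> b rule: less_induct)
  case less
  note E = less.prems(1) and t = less.prems(2) and Q = less.prems(3)
  have IH: "computable \<epsilon> b' (spine h Ns)" if "rank b' < rank b" "[] \<turnstile> spine h Ns : \<tau>" "computable_spine \<epsilon> h Ns b'" for b' h Ns \<tau>
    using less.hyps[OF that(1) E that(2,3)] .
  have reach: "computable \<epsilon> b T \<or> (\<exists>h' Ns'. T = spine h' Ns' \<and> computable_spine \<epsilon> h' Ns' b)" if "red\<^sup>*\<^sup>* (spine h Ns) T" for T
    using that
  proof (induction rule: rtranclp_induct)
    case base
    then show ?case using Q by blast
  next
    case (step T T')
    have tT: "[] \<turnstile> T : \<tau>" using subject_reductions[OF step.hyps(1) t] by simp
    from step.IH show ?case
    proof (elim disjE exE conjE)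
      assume "computable \<epsilon> b T"
      then show ?thesis using computable_reds[OF _ r_into_rtranclp[of red, OF step.hyps(2)] tT] by blast
    next
      fix h' Ns' assume T: "T = spine h' Ns'" and Q': "computable_spine \<epsilon> h' Ns' b"
      then have "is_head h'" by (simp add: computable_spine_def)
      from red_spine[OF this step.hyps(2)[unfolded T]] show ?thesis
      proof (elim disjE exE conjE)
        fix Ns1 N N' Ns2 assume *: "Ns' = Ns1 @ N # Ns2" "red N N'" "T' = spine h' (Ns1 @ N' # Ns2)"
        have "list_all2 red\<^sup>*\<^sup>* Ns' (Ns1 @ N' # Ns2)" unfolding *(1) using *(2) by (rule reds_list_step)
        from computable_spine_reds[OF Q' tT[unfolded T] this] show ?thesis using *(3) by blast
      next
        assume c: "contracts h' Ns' T'"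
        have "computable \<epsilon> b T' \<or> (\<exists>h'' Ns''. T' = spine h'' Ns'' \<and> length Ns'' < length Ns' \<and> computable_spine \<epsilon> h'' Ns'' b)"
          by (rule contracts_computable_spine[OF E _ tT[unfolded T] Q' c]) (rule IH)
        then show ?thesis by blast
      qed
    qed
  qed
  have ap: "approximable \<epsilon> b (spine h Ns)"
    unfolding approximable_def
  proof (intro allI impI)
    fix T assume r: "red\<^sup>*\<^sup>* (spine h Ns) T"
    have tT: "[] \<turnstile> T : \<tau>" using subject_reductions[OF r t] by simp
    from reach[OF r] show "\<exists>M A. red\<^sup>*\<^sup>* T M \<and> stable_approx [] A M \<and> b \<in> sem \<epsilon> [] A"
    proof (elim disjE exE conjE)
      assume "computable \<epsilon> b T"
      then show ?thesis using computable_approximable rtranclp.rtrancl_refl unfolding approximable_def by blast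
    next
      fix h' Ns' assume *: "T = spine h' Ns'" "computable_spine \<epsilon> h' Ns' b"
      show ?thesis unfolding *(1) by (rule computable_spine_stable_approx[OF E _ tT[unfolded *(1)] *(2)]) (rule IH)
    qed
  qed
  show ?case
  proof (cases b)
    case (Tag i)
    then show ?thesis using ap by simp
  next
    case (Inj i a)
    show ?thesis
      unfolding Inj
    proof (rule computable_InjI[OF ap[unfolded Inj]])
      fix \<alpha> \<beta> m assume r: "red\<^sup>*\<^sup>* (spine h Ns) (App (Con (inc i \<alpha> \<beta>)) m)"
      note ty = inc_typing(1)[OF subject_reductions[OF r t wfctx_simps(1)] wfctx_simps(1)]
      from reach[OF r] show "computable \<epsilon> a m"
      proof (elim disjE exE conjE)
        assume "computable \<epsilon> b (App (Con (inc i \<alpha> \<beta>)) m)"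
        from computable_incD[OF this[unfolded Inj] rtranclp.rtrancl_refl] show ?thesis .
      next
        fix h' Ns' assume s: "App (Con (inc i \<alpha> \<beta>)) m = spine h' Ns'" and Q': "computable_spine \<epsilon> h' Ns' b"
        then have h': "is_head h'" by (simp add: computable_spine_def)
        \<comment> \<open>The constructor itself justifies \<open>b\<close>. Its semantics places
          the component prime below the base at which the argument is computable.\<close>
        from s[symmetric] have e: "h' = Con (inc i \<alpha> \<beta>)" "Ns' = [m]"
          by (auto simp: spine_App[OF h'] spine_eq_head[OF h'])
        from Q' obtain X where X: "Step X b \<in> csem (inc i \<alpha> \<beta>)" "computables \<epsilon> X m"
          unfolding computable_spine_def e by (auto simp: list_all2_Cons2)
        have "csem (inc i \<alpha> \<beta>) = Pr (PS (sel \<alpha> \<beta> i)) (inj_sem i)" by (cases i) simp_all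
        then have "a \<in> down (PS (sel \<alpha> \<beta> i)) (fset X)" using X(1) by (simp add: Step_mem_Pr Inj)
        from computables_down[OF E ty X(2) this] show ?thesis .
      qed
    next
      fix \<alpha> \<beta> m n assume r: "red\<^sup>*\<^sup>* (spine h Ns) (Pair' \<alpha> \<beta> m n)"
      note ty = Con2_typing[OF subject_reductions[OF r t wfctx_simps(1)] wfctx_simps(1) ctype.simps(5)]
      from reach[OF r] show "computable \<epsilon> a (sel m n i)"
      proof (elim disjE exE conjE)
        assume "computable \<epsilon> b (Pair' \<alpha> \<beta> m n)"
        from computable_PairD[OF this[unfolded Inj] rtranclp.rtrancl_refl] show ?thesis .
      next
        fix h' Ns' assume s: "Pair' \<alpha> \<beta> m n = spine h' Ns'" and Q': "computable_spine \<epsilon> h' Ns' b"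
        then have h': "is_head h'" by (simp add: computable_spine_def)
        from s[symmetric] have e: "h' = Con (Pair \<alpha> \<beta>)" "Ns' = [m, n]"
          by (auto simp: spine_App[OF h'] spine_eq_head[OF h'])
        from Q' obtain X Y where X: "Step X (Step Y b) \<in> csem (Pair \<alpha> \<beta>)" "computables \<epsilon> X m" "computables \<epsilon> Y n"
          unfolding computable_spine_def e by (auto simp: list_all2_Cons2 simp del: csem.simps)
        then have "b \<in> pair_sem (down (PS \<alpha>) (fset X)) (down (PS \<beta>) (fset Y))" by (simp add: Step_mem_Pr)
        then show ?thesis
          using computables_down[OF E ty(1) X(2)] computables_down[OF E ty(2) X(3)] by (auto simp: mem_pair_sem Inj)
      qed
    qed
  next
    case (Step X b')
    have "computable \<epsilon> b' (App (spine h Ns) N)" if N: "[] \<turnstile> App (spine h Ns) N : \<theta>" "computables \<epsilon> X N" for N \<theta>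
    proof -
      from Q obtain Xs where Xs: "is_head h" "arrow Xs b \<in> sem \<epsilon> [] h" "list_all2 (computables \<epsilon>) Xs Ns"
        unfolding computable_spine_def by blast
      \<comment> \<open>One more argument turns the target \<open>Step X b'\<close> into
        \<open>b'\<close>, which has smaller rank.\<close>
      have "list_all2 (computables \<epsilon>) (Xs @ [X]) (Ns @ [N])" using Xs(3) N(2) by (simp add: list_all2_appendI)
      moreover have "arrow (Xs @ [X]) b' \<in> sem \<epsilon> [] h" using Xs(2) Step by simp
      ultimately have "computable_spine \<epsilon> h (Ns @ [N]) b'" using Xs(1) unfolding computable_spine_def by blast
      then show ?thesis using IH[of b' h "Ns @ [N]" \<theta>] N(1) Step by simp
    qed
    then show ?thesis using ap unfolding Step computable_Step by blast
  qed
qed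

section \<open>The fundamental lemma\<close>

lemma closed_invariant:
  "\<Gamma> \<turnstile> M : \<tau> \<Longrightarrow> length \<Gamma> \<le> k \<Longrightarrow> lift M k = M \<and> subst M N k = M"
  by (induction arbitrary: k N rule: typing.induct) auto

lemma weakening: "\<Gamma> \<turnstile> M : \<tau> \<Longrightarrow> \<Gamma> @ \<Delta> \<turnstile> M : \<tau>"
proof (induction rule: typing.induct)
  case (T_BVar n \<Gamma>)
  then show ?case using typing.T_BVar[of n "\<Gamma> @ \<Delta>"] by (simp add: nth_append)
next
  case (T_Con c \<Gamma>)
  then show ?case by (rule typing.T_Con)
qed (auto intro: typing.intros)

text \<open>The terms \<open>\<theta>\<close> are meant to be closed; they are therefore not lifted under binders.\<close>

fun inst :: "trm list \<Rightarrow> nat \<Rightarrow> trm \<Rightarrow> trm" where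
  "inst \<theta> k (FVar x \<sigma>) = FVar x \<sigma>"
| "inst \<theta> k (BVar i) = (if i < k then BVar i else if i - k < length \<theta> then \<theta> ! (i - k) else BVar (i - length \<theta>))"
| "inst \<theta> k (Con c) = Con c"
| "inst \<theta> k (Lam \<sigma> M) = Lam \<sigma> (inst \<theta> (Suc k) M)"
| "inst \<theta> k (App M N) = App (inst \<theta> k M) (inst \<theta> k N)"

lemma inst_Nil: "inst [] k M = M"
  by (induction M arbitrary: k) auto

text \<open>The terms in \<open>\<theta>\<close> are closed and hence unaffected by the
  substitution, which therefore only adds \<open>N\<close> to the list.\<close>

lemma subst_inst:
  assumes \<theta>: "\<forall>K\<in>set \<theta>. \<exists>\<tau>. [] \<turnstile> K : \<tau>" and N: "[] \<turnstile> N : \<sigma>"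
  shows "subst (inst \<theta> (Suc k) M) N k = inst (N # \<theta>) k M"
proof (induction M arbitrary: k)
  case (BVar i)
  have c: "subst (\<theta> ! j) N k = \<theta> ! j" if "j < length \<theta>" for j
    using \<theta> nth_mem[OF that] closed_invariant by fastforce
  consider "i < k" | "i = k" | j where "i = Suc (k + j)"
    using less_imp_Suc_add linorder_neqE_nat by metis
  then show ?case
  proof cases
    case (3 j)
    then show ?thesis using c[of j] by auto
  qed auto
next
  case (Lam \<tau> M)
  have "lift N 0 = N" using closed_invariant[OF N] by simp
  then show ?case using Lam by simp
qed simp_all

lemma inst_typing:
  "\<Gamma>' \<turnstile> M : \<tau> \<Longrightarrow> \<Gamma>' = \<Delta> @ \<Gamma> \<Longrightarrow> list_all2 (\<lambda>N \<sigma>. [] \<turnstile> N : \<sigma>) \<theta> \<Gamma> \<Longrightarrow> \<Delta> \<turnstile> inst \<theta> (length \<Delta>) M : \<tau>"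
proof (induction arbitrary: \<Delta> rule: typing.induct)
  case (T_BVar n \<Gamma>')
  show ?case
  proof (cases "n < length \<Delta>")
    case True
    then show ?thesis using T_BVar typing.T_BVar[of n \<Delta>] by (simp add: nth_append)
  next
    case False
    then have l: "n - length \<Delta> < length \<theta>" using T_BVar list_all2_lengthD by fastforce
    from list_all2_nthD[OF T_BVar(3) l] have "[] @ \<Delta> \<turnstile> \<theta> ! (n - length \<Delta>) : \<Gamma> ! (n - length \<Delta>)" by (rule weakening)
    then show ?thesis using False l T_BVar(2) by (simp add: nth_append)
  qed
next
  case (T_Con c \<Gamma>')
  then show ?case using typing.T_Con by simp
next
  case (T_Lam \<sigma> \<Gamma>' M \<tau>)
  then show ?case using T_Lam.IH[of "\<sigma> # \<Delta>"] by (auto intro: typing.T_Lam)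
next
  case (T_App \<Gamma>' M \<sigma> \<tau> N)
  show ?case unfolding inst.simps
    by (rule typing.T_App[OF T_App.IH(1)[OF T_App.prems] T_App.IH(2)[OF T_App.prems]])
qed (auto intro: typing.intros)

text \<open>In a rich environment a fresh variable can stand for any given finite element, so a single
  environment suffices to go under a binder.\<close>

definition rich :: "env \<Rightarrow> bool" where
  "rich \<epsilon> \<longleftrightarrow> (\<forall>\<sigma> X V. step_base (PS \<sigma>) X \<longrightarrow> finite V \<longrightarrow> (\<exists>x. x \<notin> V \<and> \<epsilon> x \<sigma> = down (PS \<sigma>) (fset X)))"

text \<open>The body is opened with a fresh variable, approximated there and closed again. Freshness
  turns reducts of the opened body into reducts of the body, and the value of the variable makes
  \<open>X\<close> the base of the resulting prime.\<close>

lemma approximable_Lam: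
  assumes X: "step_base (PS \<sigma>) X" and x: "\<epsilon> x \<sigma> = down (PS \<sigma>) (fset X)" "x \<notin> names P"
    and b: "approximable \<epsilon> b (subst P (FVar x \<sigma>) 0)"
  shows "approximable \<epsilon> (Step X b) (Lam \<sigma> P)"
  unfolding approximable_def
proof (intro allI impI)
  fix M' assume "red\<^sup>*\<^sup>* (Lam \<sigma> P) M'"
  from reds_Lam[OF this] obtain P' where P': "M' = Lam \<sigma> P'" "red\<^sup>*\<^sup>* P P'" by (elim exE conjE)
  from b reds_subst[OF P'(2)] obtain Q A where
    Q: "red\<^sup>*\<^sup>* (subst P' (FVar x \<sigma>) 0) Q" "stable_approx [] A Q" "b \<in> sem \<epsilon> [] A" unfolding approximable_def by blast
  have "x \<notin> names P'" using names_reds[OF P'(2)] x(2) by blast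
  then have "red\<^sup>*\<^sup>* P' (close x \<sigma> 0 Q)" using reds_close[OF Q(1), of x \<sigma> 0] by (simp add: close_subst_FVar)
  then have "red\<^sup>*\<^sup>* M' (Lam \<sigma> (close x \<sigma> 0 Q))" unfolding P'(1) by (rule reds_lam)
  moreover have "stable_approx [] (Lam \<sigma> (close x \<sigma> 0 A)) (Lam \<sigma> (close x \<sigma> 0 Q))"
    using stable_approx_close[OF Q(2), of "[]" "[]" \<sigma> x] by (simp add: stable_approx_Lam)
  moreover have "Step X b \<in> sem \<epsilon> [] (Lam \<sigma> (close x \<sigma> 0 A))"
    using X Q(3) sem_close[of \<epsilon> x \<sigma> _ "[]" "[]" A, OF x(1)] by (simp add: Step_mem_Pr)
  ultimately show "\<exists>M'' A. red\<^sup>*\<^sup>* M' M'' \<and> stable_approx [] A M'' \<and> Step X b \<in> sem \<epsilon> [] A" by blast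
qed

text \<open>At a lambda the induction hypothesis for the body is used twice: with a fresh variable,
  to obtain approximability, and with an arbitrary argument computable at the premises, for the
  clause on application via head expansion.\<close>

lemma fundamental:
  assumes E: "is_env \<epsilon>" "rich \<epsilon>"
  shows "\<Gamma> \<turnstile> M : \<tau> \<Longrightarrow> wfctx \<Gamma> \<Longrightarrow> list_all2 (\<lambda>N \<sigma>. [] \<turnstile> N : \<sigma>) \<theta> \<Gamma>
    \<Longrightarrow> list_all2 (\<lambda>d N. \<forall>a\<in>d. computable \<epsilon> a N) \<eta> \<theta> \<Longrightarrow> a \<in> sem \<epsilon> \<eta> M \<Longrightarrow> computable \<epsilon> a (inst \<theta> 0 M)"
proof (induction arbitrary: \<theta> \<eta> a rule: typing.induct)
  case (T_FVar \<sigma> \<Gamma> x)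
  have "computable_spine \<epsilon> (FVar x \<sigma>) [] a" unfolding computable_spine_def using T_FVar.prems by (intro conjI exI[of _ "[]"]) simp_all
  from computable_computable_spine[OF E(1) _ this] typing.T_FVar[OF T_FVar.hyps, of "[]" x] show ?case by simp
next
  case (T_BVar n \<Gamma>)
  have "n < length \<theta>" "n < length \<eta>"
    using T_BVar.hyps list_all2_lengthD[OF T_BVar.prems(2)] list_all2_lengthD[OF T_BVar.prems(3)] by simp_all
  then show ?case using T_BVar.prems list_all2_nthD[OF T_BVar.prems(3)] by simp
next
  case (T_Con c \<Gamma>)
  have "computable_spine \<epsilon> (Con c) [] a" unfolding computable_spine_def using T_Con.prems by (intro conjI exI[of _ "[]"]) simp_all
  moreover have "[] \<turnstile> spine (Con c) [] : ctype c" using typing.T_Con[OF T_Con.hyps] by simp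
  ultimately show ?case using computable_computable_spine[OF E(1)] by fastforce
next
  case (T_Lam \<sigma> \<Gamma> P \<tau>)
  note ht = T_Lam.prems(2)
  have cl: "\<forall>K\<in>set \<theta>. \<exists>\<tau>. [] \<turnstile> K : \<tau>"
  proof
    fix K assume "K \<in> set \<theta>"
    then obtain i where "i < length \<theta>" "\<theta> ! i = K" by (auto simp: in_set_conv_nth)
    then show "\<exists>\<tau>. [] \<turnstile> K : \<tau>" using list_all2_nthD[OF ht] by blast
  qed
  define Q where "Q = inst \<theta> (Suc 0) P"
  from T_Lam.prems(4) obtain X b where a: "a = Step X b" and X: "step_base (PS \<sigma>) X"
    and b: "b \<in> sem \<epsilon> (down (PS \<sigma>) (fset X) # \<eta>) P" by (auto simp: mem_Pr)
  have step: "computable \<epsilon> b (subst Q N 0)" if N: "[] \<turnstile> N : \<sigma>" "\<forall>a\<in>down (PS \<sigma>) (fset X). computable \<epsilon> a N" for N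
  proof -
    have "computable \<epsilon> b (inst (N # \<theta>) 0 P)"
      by (rule T_Lam.IH[OF _ _ _ b]) (use T_Lam N in simp_all)
    then show ?thesis unfolding Q_def subst_inst[OF cl N(1)] .
  qed
  from E(2) X finite_names[of Q] obtain x where x: "x \<notin> names Q" "\<epsilon> x \<sigma> = down (PS \<sigma>) (fset X)"
    unfolding rich_def by blast
  have "computable \<epsilon> a (FVar x \<sigma>)" if "a \<in> down (PS \<sigma>) (fset X)" for a
  proof -
    have "computable_spine \<epsilon> (FVar x \<sigma>) [] a" unfolding computable_spine_def using that x(2) by (intro conjI exI[of _ "[]"]) simp_all
    from computable_computable_spine[OF E(1) _ this] typing.T_FVar[OF T_Lam.hyps(1), of "[]" x] show ?thesis by simp
  qed
  then have "computable \<epsilon> b (subst Q (FVar x \<sigma>) 0)" using step typing.T_FVar[OF T_Lam.hyps(1)] by blast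
  from approximable_Lam[OF X x(2,1) computable_approximable[OF this]] have ap: "approximable \<epsilon> (Step X b) (Lam \<sigma> Q)" .
  have "computable \<epsilon> b (App (Lam \<sigma> Q) N)" if N: "[] \<turnstile> App (Lam \<sigma> Q) N : \<rho>" "computables \<epsilon> X N" for N \<rho>
  proof -
    have "[] \<turnstile> Lam \<sigma> Q : Bin Arr \<sigma> \<tau>"
      using inst_typing[OF typing.T_Lam[OF T_Lam.hyps(1,2)] _ ht, of "[]"] by (simp add: Q_def)
    from App_typing_fun(1)[OF N(1) this wfctx_simps(1)] have tN: "[] \<turnstile> N : \<sigma>" .
    then have "computable \<epsilon> b (subst Q N 0)" using step computables_down[OF E(1) tN N(2)] by blast
    then show ?thesis using computable_beta[of \<epsilon> b Q N "[]"] N(1) by simp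
  qed
  then have "computable \<epsilon> (Step X b) (Lam \<sigma> Q)" using ap unfolding computable_Step by blast
  then show ?case by (simp add: a Q_def)
next
  case (T_App \<Gamma> M \<sigma> \<tau> N)
  from T_App.prems(4) obtain X where X: "fset X \<subseteq> sem \<epsilon> \<eta> N" "Step X a \<in> sem \<epsilon> \<eta> M"
    by (auto simp: mem_fun_app)
  have "computables \<epsilon> X (inst \<theta> 0 N)" using T_App.IH(2)[OF T_App.prems(1-3)] X(1) by blast
  moreover have "[] \<turnstile> App (inst \<theta> 0 M) (inst \<theta> 0 N) : \<tau>"
    using inst_typing[OF typing.T_App[OF T_App.hyps] _ T_App.prems(2), of "[]"] by simp
  ultimately show ?case using computable_StepD[OF T_App.IH(1)[OF T_App.prems(1-3) X(2)]] by simp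
next
  case (T_Conv \<Gamma> M \<sigma> \<tau>)
  then show ?case by blast
qed

instance prime :: countable
  by countable_datatype

text \<open>Primes are countable, so a name can encode a base together with a counter. Each base
  then has infinitely many names, and finitely many excluded ones leave some over.\<close>

lemma ex_rich_env:
  assumes "is_env \<epsilon>" "finite V"
  shows "\<exists>\<epsilon>'. is_env \<epsilon>' \<and> rich \<epsilon>' \<and> (\<forall>x\<in>V. \<forall>\<sigma>. \<epsilon>' x \<sigma> = \<epsilon> x \<sigma>)"
proof -
  define f :: "nat \<Rightarrow> prime list \<times> nat" where "f = from_nat"
  define B where "B x = fset_of_list (fst (f x))" for x
  \<comment> \<open>Decoding does not depend on the type. Where the decoded set is not a base for
    \<open>\<sigma>\<close>, the value is the least element.\<close>
  define \<epsilon>' where "\<epsilon>' x \<sigma> = (if x \<in> V then \<epsilon> x \<sigma> else if step_base (PS \<sigma>) (B x)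
    then down (PS \<sigma>) (fset (B x)) else {})" for x \<sigma>
  have "is_env \<epsilon>'" using assms(1) by (simp add: is_env_def \<epsilon>'_def down_base_D D_empty)
  moreover have "rich \<epsilon>'"
    unfolding rich_def
  proof (intro allI impI)
    fix \<sigma> X and W :: "nat set" assume X: "step_base (PS \<sigma>) X" and W: "finite W"
    obtain xs where xs: "fset_of_list xs = X" using exists_fset_of_list by blast
    have "inj (\<lambda>n. to_nat (xs, n :: nat))" by (rule injI) simp
    then have "infinite (range (\<lambda>n. to_nat (xs, n :: nat)))" using finite_imageD infinite_UNIV_nat by blast
    moreover have "finite (V \<union> W)" using assms(2) W by simp
    ultimately obtain n where "to_nat (xs, n :: nat) \<notin> V \<union> W" by (meson finite_subset image_subsetI)
    moreover have "B (to_nat (xs, n)) = X" by (simp add: B_def f_def xs)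
    ultimately show "\<exists>x. x \<notin> W \<and> \<epsilon>' x \<sigma> = down (PS \<sigma>) (fset X)"
      using X by (intro exI[of _ "to_nat (xs, n)"]) (simp add: \<epsilon>'_def)
  qed
  ultimately show ?thesis by (intro exI[of _ \<epsilon>']) (simp add: \<epsilon>'_def)
qed

theorem mainTheorem9:
  fixes M :: trm and \<sigma> :: texp and \<epsilon> :: env
  assumes "[] \<turnstile> M : \<sigma>"
    and "is_env \<epsilon>"
  shows "sem \<epsilon> [] M = (\<Union>A\<in>approximations M. sem \<epsilon> [] A)"
proof
  show "sem \<epsilon> [] M \<subseteq> (\<Union>A\<in>approximations M. sem \<epsilon> [] A)"
  proof
    fix a assume a: "a \<in> sem \<epsilon> [] M"
    from ex_rich_env[OF assms(2) finite_names[of M]] obtain \<epsilon>' where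
      \<epsilon>': "is_env \<epsilon>'" "rich \<epsilon>'" "\<forall>x\<in>names M. \<forall>\<sigma>. \<epsilon>' x \<sigma> = \<epsilon> x \<sigma>" by (elim exE conjE)
    have "a \<in> sem \<epsilon>' [] M" using a sem_names[of M \<epsilon>' \<epsilon>] \<epsilon>'(3) by simp
    from fundamental[OF \<epsilon>'(1,2) assms(1) wfctx_simps(1) _ _ this, of "[]"]
    have "computable \<epsilon>' a M" by (simp add: inst_Nil)
    from approximable_approximations[OF computable_approximable[OF this] assms(1)] obtain A where
      A: "A \<in> approximations M" "a \<in> sem \<epsilon>' [] A" by blast
    from A(1) obtain N where N: "red\<^sup>*\<^sup>* M N" "prefix [] A N"
      unfolding approximations_def direct_approx_def by blast
    \<comment> \<open>Neither reduction nor the prefix order introduces names, so the semantics of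
      \<open>A\<close> is the same in both environments.\<close>
    then have "names A \<subseteq> names M" using names_prefix[OF N(2)] names_reds[OF N(1)] by blast
    then have "sem \<epsilon>' [] A = sem \<epsilon> [] A" using \<epsilon>'(3) by (intro sem_names) blast
    then show "a \<in> (\<Union>A\<in>approximations M. sem \<epsilon> [] A)" using A by blast
  qed
  show "(\<Union>A\<in>approximations M. sem \<epsilon> [] A) \<subseteq> sem \<epsilon> [] M"
  proof (rule UN_least)
    fix A assume "A \<in> approximations M"
    then obtain N where N: "red\<^sup>*\<^sup>* M N" "prefix [] A N"
      unfolding approximations_def direct_approx_def by blast
    have "good_env \<epsilon> [] []" using assms(2) by (simp add: good_env_def)
    from reds_sound[OF N(1) assms(1) this] prefix_sem[OF N(2)] show "sem \<epsilon> [] A \<subseteq> sem \<epsilon> [] M" by blast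
  qed
qed

end
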